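(* Let $\Omega\subseteq\mathbb{R}^n$ be open and simply connected. Let $G=(G_1,\dots,G_n)\in\mathcal{D}'(\Omega)^n$ be such that $\partial_jG_k=\partial_kG_j$ for all $j,k\in\{1,\dots,n\}$. Then there exists $F\in\mathcal{D}'(\Omega)$ such that $\operatorname{grad}F=G$.
   Context: The scalar field is $\mathbb{K}\in\{\mathbb{R},\mathbb{C}\}$. $\mathcal{D}'(\Omega)$ is the space of ($\mathbb{K}$-valued) distributions on $\Omega$; all derivatives are distributional, and $\operatorname{grad}F=(\partial_1F,\dots,\partial_nF)$. *)

theory Defs
  imports "HOL-Analysis.Analysis"
begin

definition partial_deriv :: "'n::finite \<Rightarrow> (real^'n \<Rightarrow> 'k::real_normed_vector) \<Rightarrow> (real^'n \<Rightarrow> 'k)"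
  where "partial_deriv j f = (\<lambda>x. vector_derivative (\<lambda>t. f (x + t *\<^sub>R axis j 1)) (at 0))"

text \<open>Multi-indices are lists of coordinates: \<open>[i\<^sub>1, \<dots>, i\<^sub>m]\<close> stands for
  \<open>\<partial>\<^sub>i\<^sub>1 \<dots> \<partial>\<^sub>i\<^sub>m\<close>, an operator of order \<open>m\<close>.\<close>

definition iterated_partial :: "'n::finite list \<Rightarrow> (real^'n \<Rightarrow> 'k::real_normed_vector) \<Rightarrow> (real^'n \<Rightarrow> 'k)"
  where "iterated_partial is f = foldr partial_deriv is f"

definition smooth :: "(real^'n \<Rightarrow> 'k::real_normed_vector) \<Rightarrow> bool"
  where "smooth f \<longleftrightarrow> (\<forall>is x. iterated_partial is f differentiable (at x))"

definition supp :: "(real^'n \<Rightarrow> 'k::real_normed_vector) \<Rightarrow> (real^'n) set"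
  where "supp f = closure {x. f x \<noteq> 0}"

text \<open>The space \<open>C\<^sub>c\<^sup>\<infinity>(\<Omega>)\<close>; its elements are identified with their extensions by zero
  to the whole of \<open>\<real>\<^sup>n\<close>.\<close>

definition test_functions :: "(real^'n) set \<Rightarrow> (real^'n \<Rightarrow> 'k::real_normed_vector) set"
  where "test_functions \<Omega> = {\<phi>. smooth \<phi> \<and> compact (supp \<phi>) \<and> supp \<phi> \<subseteq> \<Omega>}"

type_synonym ('n, 'k) functional = "(real^'n \<Rightarrow> 'k) \<Rightarrow> 'k"

text \<open>The space \<open>\<D>'(\<Omega>)\<close> of \<open>'k\<close>-linear functionals on \<open>C\<^sub>c\<^sup>\<infinity>(\<Omega>)\<close>, continuous in the sense of the
  usual seminorm estimates on compact sets. Functionals are \<^const>\<open>undefined\<close> off the test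
  functions, so that HOL equality is equality of distributions. The suprema are
  finite because the functions involved are continuous with compact support.\<close>

definition distributions :: "(real^'n) set \<Rightarrow> ('n::finite, 'k::real_normed_field) functional set"
  where "distributions \<Omega> = {u \<in> extensional (test_functions \<Omega>).
    (\<forall>\<phi>\<in>test_functions \<Omega>. \<forall>\<psi>\<in>test_functions \<Omega>. u (\<lambda>x. \<phi> x + \<psi> x) = u \<phi> + u \<psi>) \<and>
    (\<forall>c. \<forall>\<phi>\<in>test_functions \<Omega>. u (\<lambda>x. c * \<phi> x) = c * u \<phi>) \<and>
    (\<forall>K. compact K \<and> K \<subseteq> \<Omega> \<longrightarrow>
      (\<exists>C::real. \<exists>N::nat. \<forall>\<phi>\<in>test_functions \<Omega>. supp \<phi> \<subseteq> K \<longrightarrow>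
        norm (u \<phi>) \<le> C * (\<Sum>is | length is \<le> N. SUP x. norm (iterated_partial is \<phi> x))))}"

definition distr_deriv ::
    "(real^'n) set \<Rightarrow> 'n \<Rightarrow> ('n::finite, 'k::real_normed_field) functional \<Rightarrow> ('n, 'k) functional"
  where "distr_deriv \<Omega> j u = (\<lambda>\<phi>\<in>test_functions \<Omega>. - u (partial_deriv j \<phi>))"

definition distr_grad ::
    "(real^'n) set \<Rightarrow> ('n::finite, 'k::real_normed_field) functional \<Rightarrow> ('n, 'k) functional ^ 'n"
  where "distr_grad \<Omega> F = (\<chi> j. distr_deriv \<Omega> j F)"

end

theory Submission
  imports Defs
begin

text \<open>
  On a box, primitives are built one coordinate at a time: dually to integration along the \<open>j\<close>-th
  coordinate, \<open>F \<phi> = - G\<^sub>j (P\<^sub>j \<phi>)\<close> solves \<open>\<partial>\<^sub>j F = G\<^sub>j\<close>, where \<open>P\<^sub>j\<close> is an operator on test functions with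
  \<open>P\<^sub>j \<partial>\<^sub>j = id\<close> that commutes with the other partial derivatives; subtracting \<open>grad F\<close> from \<open>G\<close>
  removes the \<open>j\<close>-th component and creates no new ones. Since \<open>\<phi> - \<partial>\<^sub>j (P\<^sub>j \<phi>)\<close> replaces the dependence of
  \<open>\<phi>\<close> on \<open>x\<^sub>j\<close> by a fixed bump, a distribution on a box with vanishing gradient is a multiple of
  \<open>\<phi> \<mapsto> \<integral> \<phi>\<close>. Hence the primitives \<open>F\<^sub>x\<close> on boxes around the points \<open>x \<in> \<Omega>\<close> differ by constants
  \<open>c(x, y)\<close>, which satisfy the cocycle identity for nearby points. Transporting along paths and
  comparing homotopic paths on the square shows that \<open>c(x, y) = g(y) - g(x)\<close> when \<open>\<Omega>\<close> is simply
  connected, and the corrected primitives \<open>F\<^sub>x + g(x) \<integral>\<close> agree on overlaps and can be glued by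
  partitions of unity.
\<close>

section \<open>Local cocycles on simply connected sets\<close>

text \<open>A distribution has no values to integrate along a path, so the topology of \<Omega>
  cannot act on \<open>G\<close> directly; it enters only through the scalars by which local
  primitives differ. Boxes suit the local work: integration along one coordinate can be kept inside
  them, and an intersection of two or three of them is empty or again a box, so one constant per
  overlap exists without any further connectedness argument. The box around \<open>x\<close> is a
  cube whose radius depends continuously on \<open>x\<close>. Hence \<open>x \<in> W y\<close> is an
  open condition in \<open>y\<close>, and cubes around nearby points share a point, as the cocycle
  identity requires. The topological part trivialises the constants only between points close to
  each other, while cubes may overlap although their centres are not close in that sense; the
  identity is therefore spread over each cube by connectedness and then carried to all overlapping
  pairs through a common point. The sign in the formula for \<open>F\<close> comes from the
  distributional derivative: \<open>- F (\<partial>_j \<phi>) = G_j (P_j (\<partial>_j \<phi>)) =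
  G_j \<phi>\<close>.\<close>

definition local_cocycle :: "'a::topological_space set \<Rightarrow> ('a \<Rightarrow> 'a \<Rightarrow> 'k::ab_group_add) \<Rightarrow> bool"
  where "local_cocycle S D \<longleftrightarrow> (\<forall>x\<in>S. \<exists>U. open U \<and> x \<in> U \<and>
    (\<forall>p\<in>U \<inter> S. \<forall>q\<in>U \<inter> S. \<forall>r\<in>U \<inter> S. D p r = D p q + D q r))"

text \<open>\<open>l\<close> plays the part of the integral of \<open>D\<close> along \<gamma>. Only
  its increments are determined, and the relation is imposed only for nearby parameters because
  \<open>D\<close> is additive only locally.\<close>

definition path_lift :: "('a \<Rightarrow> 'a \<Rightarrow> 'k::ab_group_add) \<Rightarrow> (real \<Rightarrow> 'a) \<Rightarrow> (real \<Rightarrow> 'k) \<Rightarrow> bool"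
  where "path_lift D \<gamma> l \<longleftrightarrow>
    (\<exists>\<delta>>0. \<forall>s\<in>{0..1}. \<forall>t\<in>{0..1}. \<bar>s - t\<bar> < \<delta> \<longrightarrow> D (\<gamma> s) (\<gamma> t) = l t - l s)"

text \<open>Lebesgue number argument: the open sets on which the pulled-back cocycle is additive
  cover the compact \<open>Q\<close>, so a single radius \<delta> works around every centre
  \<open>o'\<close>.\<close>

lemma local_cocycle_pullback_uniform:
  fixes Q :: "'b::metric_space set" and h :: "'b \<Rightarrow> 'a::topological_space"
  assumes D: "local_cocycle S D" and Q: "compact Q" and h: "continuous_on Q h" "h ` Q \<subseteq> S"
  obtains \<delta> where "\<delta> > 0"
    "\<And>o' p q r. \<lbrakk>o' \<in> Q; p \<in> Q; q \<in> Q; r \<in> Q; dist o' p < \<delta>; dist o' q < \<delta>; dist o' r < \<delta>\<rbrakk>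
      \<Longrightarrow> D (h p) (h r) = D (h p) (h q) + D (h q) (h r)"
proof -
  define C where "C = {T. open T \<and> (\<forall>p\<in>T \<inter> Q. \<forall>q\<in>T \<inter> Q. \<forall>r\<in>T \<inter> Q. 
       D (h p) (h r) = D (h p) (h q) + D (h q) (h r))}"
  have "Q \<subseteq> \<Union>C"
  proof
    fix x assume x: "x \<in> Q"
    then have "h x \<in> S" using h by auto
    then obtain U where U: "open U" "h x \<in> U"
      "\<forall>p\<in>U \<inter> S. \<forall>q\<in>U \<inter> S. \<forall>r\<in>U \<inter> S. D p r = D p q + D q r"
      using D unfolding local_cocycle_def by meson
    obtain T where T: "open T" "T \<inter> Q = h -` U \<inter> Q"
      using h(1) U(1) by (auto simp: continuous_on_open_invariant)
    have "T \<in> C" unfolding C_def using T U h(2) by blast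
    moreover have "x \<in> T" using T U x by blast
    ultimately show "x \<in> \<Union>C" by blast
  qed
  moreover have "open T" if "T \<in> C" for T using that unfolding C_def by blast
  ultimately have "\<exists>\<delta>>0. \<forall>x\<in>Q. \<exists>G\<in>C. ball x \<delta> \<subseteq> G"
    by (rule Heine_Borel_lemma[OF Q]) blast+
  then obtain \<delta> where "\<delta> > 0" and \<delta>: "\<And>x. x \<in> Q \<Longrightarrow> \<exists>G\<in>C. ball x \<delta> \<subseteq> G"
    by blast
  show ?thesis
  proof (rule that[OF \<open>\<delta> > 0\<close>])
    fix o' p q r assume "o' \<in> Q" and pqr: "p \<in> Q" "q \<in> Q" "r \<in> Q" "dist o' p < \<delta>" "dist o' q < \<delta>" "dist o' r < \<delta>"
    then obtain G where "G \<in> C" "ball o' \<delta> \<subseteq> G" using \<delta> by blast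
    moreover have "p \<in> ball o' \<delta>" "q \<in> ball o' \<delta>" "r \<in> ball o' \<delta>" using pqr by auto
    ultimately show "D (h p) (h r) = D (h p) (h q) + D (h q) (h r)"
      unfolding C_def using pqr by blast
  qed
qed

text \<open>The lift of \<open>p\<close> is the sum of the cocycle over \<open>N\<close> equal steps from \<open>0\<close> to \<open>p\<close>; for nearby \<open>p\<close>, \<open>q\<close> the
  difference of the two sums telescopes over the quadrilaterals between the two segments.\<close>

lemma local_cocycle_lift:
  fixes Q :: "'b::real_normed_vector set" and h :: "'b \<Rightarrow> 'a::topological_space"
  assumes D: "local_cocycle S D" and Q: "compact Q" "convex Q" "0 \<in> Q"
    and h: "continuous_on Q h" "h ` Q \<subseteq> S"
  obtains l \<delta> where "\<delta> > 0" "\<And>p q. \<lbrakk>p \<in> Q; q \<in> Q; dist p q < \<delta>\<rbrakk> \<Longrightarrow> D (h p) (h q) = l q - l p"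
proof -
  obtain \<delta> where "\<delta> > 0" and \<delta>: 
    "\<And>o' p q r. \<lbrakk>o' \<in> Q; p \<in> Q; q \<in> Q; r \<in> Q; dist o' p < \<delta>; dist o' q < \<delta>; dist o' r < \<delta>\<rbrakk>
      \<Longrightarrow> D (h p) (h r) = D (h p) (h q) + D (h q) (h r)"
    using local_cocycle_pullback_uniform[OF D Q(1) h] by metis
  obtain B where B: "\<And>p. p \<in> Q \<Longrightarrow> norm p \<le> B" and "B > 0"
    using compact_imp_bounded[OF Q(1)] bounded_pos by metis
  \<comment> \<open>Steps of length at most \<open>B / N < \<delta> / 2\<close>, together with
    \<open>dist p q < \<delta> / 2\<close>, keep all four corners of each quadrilateral within
    \<delta> of the corner \<open>sc i p\<close>.\<close>
  define N where "N = nat \<lceil>2 * B / \<delta>\<rceil> + 1"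
  have N: "B / real N < \<delta> / 2" "N > 0"
  proof -
    have "2 * B / \<delta> < real N" unfolding N_def by linarith
    moreover show "N > 0" by (simp add: N_def)
    ultimately show "B / real N < \<delta> / 2"
      using \<open>\<delta> > 0\<close> by (simp add: pos_divide_less_eq mult.commute)
  qed
  define E where "E p q = D (h p) (h q)" for p q
  define sc where "sc i p = (real i / real N) *\<^sub>R p" for i and p :: 'b
  define l where "l p = (\<Sum>i<N. E (sc i p) (sc (Suc i) p))" for p
  have scQ: "sc i p \<in> Q" if "p \<in> Q" "i \<le> N" for i p
  proof -
    have "(real i / real N) *\<^sub>R p + (1 - real i / real N) *\<^sub>R 0 \<in> Q"
      by (rule convexD[OF Q(2) that(1) Q(3)]) (use that N in simp_all)
    then show ?thesis by (simp add: sc_def)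
  qed
  show ?thesis
  proof (rule that[of "\<delta>/2"])
    show "0 < \<delta> / 2" using \<open>\<delta> > 0\<close> by simp
    fix p q assume pq: "p \<in> Q" "q \<in> Q" "dist p q < \<delta>/2"
    have step: "E (sc i q) (sc (Suc i) q) - E (sc i p) (sc (Suc i) p)
        = E (sc (Suc i) p) (sc (Suc i) q) - E (sc i p) (sc i q)" if "i < N" for i
    proof -
      have inQ: "sc i p \<in> Q" "sc i q \<in> Q" "sc (Suc i) p \<in> Q" "sc (Suc i) q \<in> Q"
        using scQ pq that by auto
      have d1: "dist (sc k p) (sc k q) < \<delta>/2" if "k \<le> N" for k
      proof -
        have "dist (sc k p) (sc k q) = (real k / real N) * dist p q"
          by (simp add: sc_def dist_norm flip: scaleR_diff_right)
        also have "\<dots> \<le> 1 * dist p q" using that N by (intro mult_right_mono) auto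
        finally show ?thesis using pq by simp
      qed
      have "sc i p - sc (Suc i) p = - (1 / real N) *\<^sub>R p"
        by (simp add: sc_def flip: scaleR_diff_left diff_divide_distrib)
      then have "dist (sc i p) (sc (Suc i) p) = norm p / real N"
        unfolding dist_norm by simp
      also have "\<dots> \<le> B / real N" using B pq N by (intro divide_right_mono) auto
      finally have d2: "dist (sc i p) (sc (Suc i) p) < \<delta>/2" using N by linarith
      have d3: "dist (sc i p) (sc (Suc i) q) < \<delta>"
        using dist_triangle[of "sc i p" "sc (Suc i) q" "sc (Suc i) p"] d1[of "Suc i"] d2 that by linarith
      have d4: "dist (sc i p) (sc i q) < \<delta>" "dist (sc i p) (sc (Suc i) p) < \<delta>"
        using d1[of i] d2 that \<open>\<delta> > 0\<close> by linarith+
      \<comment> \<open>The diagonal of the quadrilateral is decomposed in two ways, through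
        \<open>sc i q\<close> and through \<open>sc (Suc i) p\<close>; equating them gives the
        telescoping step.\<close>
      have "E (sc i p) (sc (Suc i) q) = E (sc i p) (sc i q) + E (sc i q) (sc (Suc i) q)"
        "E (sc i p) (sc (Suc i) q) = E (sc i p) (sc (Suc i) p) + E (sc (Suc i) p) (sc (Suc i) q)"
        unfolding E_def by (rule \<delta>[of "sc i p"]; use inQ d3 d4 \<open>\<delta> > 0\<close> in simp)+
      then show ?thesis by (simp add: algebra_simps)
    qed
    have "l q - l p = (\<Sum>i<N. E (sc (Suc i) p) (sc (Suc i) q) - E (sc i p) (sc i q))"
      unfolding l_def sum_subtractf[symmetric] by (intro sum.cong) (auto simp: step)
    also have "\<dots> = E (sc N p) (sc N q) - E (sc 0 p) (sc 0 q)"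
      by (rule sum_lessThan_telescope)
    finally have "l q - l p = E (sc N p) (sc N q) - E (sc 0 p) (sc 0 q)" .
    moreover have "sc N p = p" "sc N q = q" "sc 0 p = 0" "sc 0 q = 0" using N by (auto simp: sc_def)
    \<comment> \<open>Telescoping leaves a term at the common starting point 0. It vanishes because
      additivity at equal points reads \<open>E 0 0 = E 0 0 + E 0 0\<close>.\<close>
    moreover have "E 0 0 = 0" using \<delta>[of 0 0 0 0] Q \<open>\<delta> > 0\<close> unfolding E_def by simp
    ultimately show "D (h p) (h q) = l q - l p" by (simp add: E_def)
  qed
qed

lemma path_lift_exists:
  fixes \<gamma> :: "real \<Rightarrow> 'a::topological_space"
  assumes "local_cocycle S D" "path \<gamma>" "path_image \<gamma> \<subseteq> S"
  obtains l where "path_lift D \<gamma> l"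
proof -
  obtain l \<delta> where "\<delta> > 0" "\<And>p q. \<lbrakk>p \<in> {0..1}; q \<in> {0..1}; dist p q < \<delta>\<rbrakk> \<Longrightarrow> D (\<gamma> p) (\<gamma> q) = l q - l p"
    by (rule local_cocycle_lift[OF assms(1), of "{0..1::real}" \<gamma>])
       (use assms in \<open>auto simp: path_def path_image_def\<close>)
  then have "path_lift D \<gamma> l" unfolding path_lift_def dist_real_def by blast
  then show ?thesis by (rule that)
qed

text \<open>Two lifts have the same increments over short parameter intervals, so their difference
  is locally constant on the connected interval \<open>{0..1}\<close>.\<close>

lemma path_lift_unique:
  assumes "path_lift D \<gamma> l" "path_lift D \<gamma> l'"
  shows "l 1 - l 0 = l' 1 - l' 0"
proof -
  obtain \<delta> where "\<delta> > 0" and \<delta>: "\<And>s t. \<lbrakk>s\<in>{0..1}; t\<in>{0..1}; \<bar>s - t\<bar> < \<delta>\<rbrakk> \<Longrightarrow> D (\<gamma> s) (\<gamma> t) = l t - l s"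
    using assms(1) unfolding path_lift_def by blast
  obtain \<delta>' where "\<delta>' > 0" and \<delta>': "\<And>s t. \<lbrakk>s\<in>{0..1}; t\<in>{0..1}; \<bar>s - t\<bar> < \<delta>'\<rbrakk> \<Longrightarrow> D (\<gamma> s) (\<gamma> t) = l' t - l' s"
    using assms(2) unfolding path_lift_def by blast
  have "(\<lambda>t. l t - l' t) constant_on {0..1}"
  proof (rule locally_constant_imp_constant)
    fix a :: real assume a: "a \<in> {0..1}"
    let ?T = "{0..1} \<inter> ball a (min \<delta> \<delta>')"
    have "l x - l' x = l a - l' a" if "x \<in> ?T" for x
    proof -
      have "\<bar>a - x\<bar> < \<delta>" "\<bar>a - x\<bar> < \<delta>'" "x \<in> {0..1}" using that by (auto simp: dist_real_def)
      then have "l x - l a = l' x - l' a" using \<delta>[OF a, of x] \<delta>'[OF a, of x] by simp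
      then show ?thesis by (simp add: algebra_simps)
    qed
    moreover have "openin (top_of_set {0..1}) ?T" by (rule openin_open_Int) simp
    moreover have "a \<in> ?T" using a \<open>\<delta> > 0\<close> \<open>\<delta>' > 0\<close> by simp
    ultimately show "\<exists>T. openin (top_of_set {0..1}) T \<and> a \<in> T \<and> (\<forall>x\<in>T. l x - l' x = l a - l' a)"
      by blast
  qed auto
  then have "l 1 - l' 1 = l 0 - l' 0" unfolding constant_on_def
    by (metis atLeastAtMost_iff order_refl zero_le_one)
  then show ?thesis by (simp add: algebra_simps)
qed

text \<open>A single lift \<open>m\<close> of the homotopy over the square restricts to lifts of
  both paths on two opposite sides. On the other two sides the homotopy stands still, so
  \<open>m\<close> is constant there.\<close>

lemma path_lift_homotopic:
  fixes \<gamma> \<gamma>' :: "real \<Rightarrow> 'a::topological_space"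
  assumes D: "local_cocycle S D" and hom: "homotopic_paths S \<gamma> \<gamma>'"
    and l: "path_lift D \<gamma> l" "path_lift D \<gamma>' l'"
  shows "l 1 - l 0 = l' 1 - l' 0"
proof -
  let ?Q = "{0..1} \<times> {0..1} :: (real \<times> real) set"
  obtain h where h: "continuous_on ?Q h" "h \<in> ?Q \<rightarrow> S"
    "\<And>x. x \<in> {0..1} \<Longrightarrow> h (0,x) = \<gamma> x" "\<And>x. x \<in> {0..1} \<Longrightarrow> h (1,x) = \<gamma>' x"
    "\<And>t. t \<in> {0..1} \<Longrightarrow> h (t,0) = pathstart \<gamma> \<and> h (t,1) = pathfinish \<gamma>"
    using hom unfolding homotopic_paths by (auto simp: pathstart_def pathfinish_def)
  have "compact ?Q" "convex ?Q" "0 \<in> ?Q" by (auto intro: compact_Times convex_Times simp: zero_prod_def)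
  then obtain m \<delta> where "\<delta> > 0" and m: "\<And>p q. \<lbrakk>p \<in> ?Q; q \<in> ?Q; dist p q < \<delta>\<rbrakk> \<Longrightarrow> D (h p) (h q) = m q - m p"
    by (rule local_cocycle_lift[OF D _ _ _ h(1)]) (use h(2) in auto)
  have "path_lift D \<gamma> (\<lambda>t. m (0,t))" "path_lift D \<gamma>' (\<lambda>t. m (1,t))"
    unfolding path_lift_def
    by (rule exI[of _ \<delta>]; use \<open>\<delta> > 0\<close> in \<open>simp add: h(3,4)[symmetric] m dist_Pair_Pair dist_real_def\<close>)+
  then have eq: "l 1 - l 0 = m (0,1) - m (0,0)" "l' 1 - l' 0 = m (1,1) - m (1,0)"
    using l path_lift_unique by blast+
  have edge: "m (1,e) = m (0,e)" if e: "e \<in> {0,1}" for e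
  proof -
    have "(\<lambda>t. m (t,e)) constant_on {0..1}"
    proof (rule locally_constant_imp_constant)
      fix a :: real assume a: "a \<in> {0..1}"
      let ?T = "{0..1} \<inter> ball a \<delta>"
      have "m (x,e) = m (a,e)" if "x \<in> ?T" for x
      proof -
        have "dist (a,e) (x,e) < \<delta>" "(x,e) \<in> ?Q" "(a,e) \<in> ?Q"
          using that a e by (auto simp: dist_Pair_Pair)
        then have "D (h (a,e)) (h (x,e)) = m (x,e) - m (a,e)" by (simp add: m)
        moreover have "h (x,e) = h (a,e)" using h(5)[of x] h(5)[of a] a e that by auto
        \<comment> \<open>This says that \<open>D\<close> vanishes at the repeated end point, hence
          \<open>m\<close> has zero increment along the edge.\<close>
        moreover have "D (h (a,e)) (h (a,e)) = m (a,e) - m (a,e)"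
          using \<open>(a,e) \<in> ?Q\<close> \<open>\<delta> > 0\<close> by (intro m) auto
        ultimately show ?thesis by simp
      qed
      moreover have "openin (top_of_set {0..1}) ?T" by (rule openin_open_Int) simp
      moreover have "a \<in> ?T" using a \<open>\<delta> > 0\<close> by simp
      ultimately show "\<exists>T. openin (top_of_set {0..1}) T \<and> a \<in> T \<and> (\<forall>x\<in>T. m (x,e) = m (a,e))"
        by blast
    qed auto
    then show ?thesis unfolding constant_on_def
      by (metis atLeastAtMost_iff order_refl zero_le_one)
  qed
  then show ?thesis using eq by simp
qed

text \<open>A potential is built as for closed 1-forms: \<open>g x\<close> is the total increment of
  a lift along a chosen path from a base point to \<open>x\<close>. The conclusion is local because
  nothing is known about \<open>D\<close> at distant points.\<close>

proposition simply_connected_local_cocycle_trivial: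
  fixes S :: "'a::real_normed_vector set"
  assumes S: "open S" "simply_connected S" and D: "local_cocycle S D"
  obtains g where "\<And>x. x \<in> S \<Longrightarrow> \<exists>U. open U \<and> x \<in> U \<and> U \<subseteq> S \<and> (\<forall>y\<in>U. \<forall>z\<in>U. D y z = g z - g y)"
proof (cases "S = {}")
  case False
  then obtain o' where o': "o' \<in> S" by blast
  have hom: "homotopic_paths S p q" if "path p" "path_image p \<subseteq> S" "path q" "path_image q \<subseteq> S"
      "pathstart q = pathstart p" "pathfinish q = pathfinish p" for p q
    using S(2) that unfolding simply_connected_eq_homotopic_paths by blast
  have "path_connected S" using S(2) simply_connected_imp_path_connected by blast
  then have "\<forall>x\<in>S. \<exists>\<gamma>. path \<gamma> \<and> path_image \<gamma> \<subseteq> S \<and> pathstart \<gamma> = o' \<and> pathfinish \<gamma> = x"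
    using o' unfolding path_connected_def by blast
  then obtain \<gamma> where \<gamma>: "\<And>x. x \<in> S \<Longrightarrow> path (\<gamma> x)" "\<And>x. x \<in> S \<Longrightarrow> path_image (\<gamma> x) \<subseteq> S"
     "\<And>x. x \<in> S \<Longrightarrow> pathstart (\<gamma> x) = o'" "\<And>x. x \<in> S \<Longrightarrow> pathfinish (\<gamma> x) = x" by metis
  have "\<forall>x\<in>S. \<exists>l. path_lift D (\<gamma> x) l" using path_lift_exists[OF D \<gamma>(1,2)] by metis
  then obtain l where l: "\<And>x. x \<in> S \<Longrightarrow> path_lift D (\<gamma> x) (l x)" by metis
  define g where "g x = l x 1 - l x 0" for x
  show ?thesis
  proof (rule that[of g])
    fix x assume x: "x \<in> S"
    then obtain V where V: "open V" "x \<in> V"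
      "\<And>p q r. p \<in> V \<inter> S \<Longrightarrow> q \<in> V \<inter> S \<Longrightarrow> r \<in> V \<inter> S \<Longrightarrow> D p r = D p q + D q r"
      using D unfolding local_cocycle_def by meson
    obtain e where e: "e > 0" "ball x e \<subseteq> V \<inter> S"
      using V S x by (meson IntI open_Int open_contains_ball)
    have "D y z = g z - g y" if yz: "y \<in> ball x e" "z \<in> ball x e" for y z
    proof -
      have ySz: "y \<in> S" "z \<in> S" using yz e by auto
      let ?L = "linepath y z"
      have L: "path_image ?L \<subseteq> ball x e"
        using yz by (simp add: closed_segment_subset)
      then have LS: "path_image ?L \<subseteq> S" using e by blast
      have pL: "path (\<gamma> y +++ ?L)" "path_image (\<gamma> y +++ ?L) \<subseteq> S"
        using \<gamma>[OF ySz(1)] LS by (simp_all add: path_image_join)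
      obtain m where m: "path_lift D (\<gamma> y +++ ?L) m"
        using path_lift_exists[OF D pL] by blast
      \<comment> \<open>The path to \<open>z\<close> and the path to \<open>y\<close> followed by
        the segment have the same end points in a simply connected set, so they are homotopic and
        have equal increments.\<close>
      have gz: "g z = m 1 - m 0"
        unfolding g_def
        by (rule path_lift_homotopic[OF D _ l[OF ySz(2)] m], rule hom)
           (use \<gamma> ySz pL in auto)
      obtain \<delta> where "\<delta> > 0" and \<delta>: "\<And>s t. \<lbrakk>s\<in>{0..1}; t\<in>{0..1}; \<bar>s - t\<bar> < \<delta>\<rbrakk>
          \<Longrightarrow> D ((\<gamma> y +++ ?L) s) ((\<gamma> y +++ ?L) t) = m t - m s"
        using m unfolding path_lift_def by blast
      \<comment> \<open>\<open>+++\<close> runs each path at double speed, so the lift of the join,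
        restricted to either half and rescaled, lifts that path with the same \<delta>.\<close>
      have "path_lift D (\<gamma> y) (\<lambda>t. m (t/2))"
        unfolding path_lift_def
      proof (intro exI[of _ \<delta>] conjI ballI impI \<open>\<delta> > 0\<close>)
        fix s t :: real assume st: "s \<in> {0..1}" "t \<in> {0..1}" "\<bar>s - t\<bar> < \<delta>"
        then have "\<bar>s/2 - t/2\<bar> < \<delta>" by linarith
        with \<delta>[of "s/2" "t/2"] st show "D (\<gamma> y s) (\<gamma> y t) = m (t / 2) - m (s / 2)"
          by (simp add: joinpaths_def)
      qed
      then have gy: "g y = m (1/2) - m 0"
        using path_lift_unique[OF l[OF ySz(1)]] unfolding g_def by force
      have join2: "(\<gamma> y +++ ?L) (1/2 + t/2) = ?L t" if "t \<in> {0..1}" for t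
      proof (cases "t = 0")
        case True
        then show ?thesis using \<gamma>(4)[OF ySz(1)] by (simp add: joinpaths_def pathfinish_def linepath_def)
      qed (use that in \<open>auto simp: joinpaths_def\<close>)
      have "path_lift D ?L (\<lambda>t. m (1/2 + t/2))"
        unfolding path_lift_def
      proof (intro exI[of _ \<delta>] conjI ballI impI \<open>\<delta> > 0\<close>)
        fix s t :: real assume st: "s \<in> {0..1}" "t \<in> {0..1}" "\<bar>s - t\<bar> < \<delta>"
        then have "\<bar>(1/2 + s/2) - (1/2 + t/2)\<bar> < \<delta>" by linarith
        with \<delta>[of "1/2 + s/2" "1/2 + t/2"] st show "D (?L s) (?L t) = m (1/2 + t / 2) - m (1/2 + s / 2)"
          by (simp add: join2)
      qed
      \<comment> \<open>The segment stays in \<open>V\<close>, where \<open>D\<close> is additive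
        for all triples of points of \<open>S\<close>; so \<open>D y\<close> itself lifts the
        segment, and its increment is \<open>D y z - D y y = D y z\<close>.\<close>
      moreover have "path_lift D ?L (\<lambda>t. D y (?L t))"
        unfolding path_lift_def
      proof (intro exI[of _ 1] conjI ballI impI)
        fix s t :: real assume "s \<in> {0..1}" "t \<in> {0..1}"
        then have "?L s \<in> path_image ?L" "?L t \<in> path_image ?L" by (auto simp: path_image_def)
        then have "?L s \<in> V \<inter> S" "?L t \<in> V \<inter> S" "y \<in> V \<inter> S" using L e yz by auto
        then show "D (?L s) (?L t) = D y (?L t) - D y (?L s)" using V(3)[of y "?L s" "?L t"] by simp
      qed simp
      ultimately have "m (1/2 + 1/2) - m (1/2 + 0/2) = D y (?L 1) - D y (?L 0)"
        by (rule path_lift_unique)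
      moreover have "y \<in> V \<inter> S" using yz e by blast
      then have "D y y = 0" using V(3)[of y y y] by simp
      ultimately show ?thesis using gz gy by (simp add: linepath_def)
    qed
    then show "\<exists>U. open U \<and> x \<in> U \<and> U \<subseteq> S \<and> (\<forall>y\<in>U. \<forall>z\<in>U. D y z = g z - g y)"
      using e by (intro exI[of _ "ball x e"]) auto
  qed
qed (use that in auto)

section \<open>Smooth functions and averages over segments\<close>

lemma partial_deriv_eqI:
  assumes "(f has_derivative f') (at x)"
  shows "partial_deriv i f x = f' (axis i 1)"
proof -
  have "((\<lambda>t. x + t *\<^sub>R axis i (1::real)) has_derivative (\<lambda>t. t *\<^sub>R axis i 1)) (at 0)"
    by (auto intro!: derivative_eq_intros)
  then have "((\<lambda>t. f (x + t *\<^sub>R axis i (1::real))) has_derivative (\<lambda>t. f' (t *\<^sub>R axis i 1))) (at 0)"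
    by (rule has_derivative_compose) (simp add: assms)
  then have "((\<lambda>t. f (x + t *\<^sub>R axis i (1::real))) has_vector_derivative f' (axis i 1)) (at 0)"
    unfolding has_vector_derivative_def
    using has_derivative_linear[OF assms] by (simp add: linear_scale)
  then show ?thesis unfolding partial_deriv_def by (rule vector_derivative_at)
qed

lemma has_derivative_partial_deriv:
  fixes f :: "real^'n \<Rightarrow> 'k::real_normed_vector"
  assumes "f differentiable (at x)"
  shows "(f has_derivative (\<lambda>v. \<Sum>i\<in>UNIV. (v $ i) *\<^sub>R partial_deriv i f x)) (at x)"
proof -
  obtain f' where f': "(f has_derivative f') (at x)"
    using assms unfolding differentiable_def by blast
  interpret linear f' using f' by (rule has_derivative_linear)
  have "f' v = (\<Sum>i\<in>UNIV. (v $ i) *\<^sub>R partial_deriv i f x)" for v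
  proof -
    have "f' v = f' (\<Sum>i\<in>UNIV. (v $ i) *\<^sub>R axis i 1)"
      using basis_expansion[of v] by (simp add: scalar_mult_eq_scaleR)
    then show ?thesis by (simp add: sum scale partial_deriv_eqI[OF f'])
  qed
  then show ?thesis using f' by (metis (no_types, lifting) ext)
qed

lemma iterated_partial_simps [simp]:
  "iterated_partial [] f = f"
  "iterated_partial (i # is) f = partial_deriv i (iterated_partial is f)"
  "iterated_partial (is @ [i]) f = iterated_partial is (partial_deriv i f)"
  by (simp_all add: iterated_partial_def)

lemma smooth_differentiable: "smooth f \<Longrightarrow> f differentiable (at x)"
  unfolding smooth_def by (metis iterated_partial_simps(1))

lemma smooth_continuous_on: "smooth f \<Longrightarrow> continuous_on S f"
  by (meson continuous_at_imp_continuous_on differentiable_imp_continuous_within smooth_differentiable)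

lemma smooth_has_derivative:
  fixes f :: "real^'n \<Rightarrow> 'k::real_normed_vector"
  shows "smooth f \<Longrightarrow> (f has_derivative (\<lambda>v. \<Sum>i\<in>UNIV. (v $ i) *\<^sub>R partial_deriv i f x)) (at x)"
  by (intro has_derivative_partial_deriv smooth_differentiable)

lemma smooth_partial_deriv [intro]: "smooth f \<Longrightarrow> smooth (partial_deriv i f)"
  unfolding smooth_def by (metis iterated_partial_simps(3))

lemma smooth_iterated_partial [intro]: "smooth f \<Longrightarrow> smooth (iterated_partial is f)"
  by (induction "is") auto

lemma smoothI:
  assumes "\<And>x. f differentiable (at x)" "\<And>i. smooth (partial_deriv i f)"
  shows "smooth f"
  unfolding smooth_def
proof (intro allI)
  fix "is" x show "iterated_partial is f differentiable at x"
    using assms by (cases "is" rule: rev_cases) (auto simp: smooth_def)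
qed

text \<open>Smoothness is the largest property that implies differentiability and passes to partial
  derivatives. Exhibiting a class \<open>X\<close> closed under partial derivatives avoids formulas
  for higher derivatives.\<close>

lemma smooth_coinduct:
  assumes "X f" and "\<And>g x. X g \<Longrightarrow> g differentiable (at x)" "\<And>g i. X g \<Longrightarrow> X (partial_deriv i g)"
  shows "smooth f"
proof -
  have "X (iterated_partial is f)" for "is"
    by (induction "is") (auto simp: assms)
  then show ?thesis unfolding smooth_def using assms(2) by blast
qed

lemma partial_deriv_bounded_linear:
  assumes "bounded_linear L" "smooth f"
  shows "partial_deriv i (\<lambda>x. L (f x)) = (\<lambda>x. L (partial_deriv i f x))"
  using partial_deriv_eqI[OF bounded_linear.has_derivative[OF assms(1) smooth_has_derivative[OF assms(2)]]]
  by (simp add: partial_deriv_eqI[OF smooth_has_derivative[OF assms(2)], symmetric] fun_eq_iff)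

lemma smooth_bounded_linear:
  fixes f :: "real^'n \<Rightarrow> 'k::real_normed_vector" and L :: "'k \<Rightarrow> 'l::real_normed_vector"
  assumes "bounded_linear L" "smooth f"
  shows "smooth (\<lambda>x. L (f x))"
proof (rule smooth_coinduct[where X = "\<lambda>h. \<exists>g. smooth g \<and> h = (\<lambda>x. L (g x))"])
  fix h :: "real^'n \<Rightarrow> 'l" and x i assume "\<exists>g. smooth g \<and> h = (\<lambda>x. L (g x))"
  then obtain g where g: "smooth g" "h = (\<lambda>x. L (g x))" by blast
  show "h differentiable at x"
    unfolding g differentiable_def
    using bounded_linear.has_derivative[OF assms(1) smooth_has_derivative[OF g(1)]] by blast
  show "\<exists>g. smooth g \<and> partial_deriv i h = (\<lambda>x. L (g x))"
    using g partial_deriv_bounded_linear[OF assms(1) g(1)] by blast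
qed (use assms in blast)

lemma partial_deriv_add:
  assumes "smooth f" "smooth g"
  shows "partial_deriv i (\<lambda>x. f x + g x) = (\<lambda>x. partial_deriv i f x + partial_deriv i g x)"
  using partial_deriv_eqI[OF has_derivative_add[OF smooth_has_derivative[OF assms(1)] smooth_has_derivative[OF assms(2)]]]
  by (simp add: partial_deriv_eqI[OF smooth_has_derivative[OF assms(1)], symmetric]
      partial_deriv_eqI[OF smooth_has_derivative[OF assms(2)], symmetric] fun_eq_iff)

lemma smooth_add:
  fixes f g :: "real^'n \<Rightarrow> 'k::real_normed_vector"
  assumes "smooth f" "smooth g"
  shows "smooth (\<lambda>x. f x + g x)"
proof (rule smooth_coinduct[where X = "\<lambda>h. \<exists>f g. smooth f \<and> smooth g \<and> h = (\<lambda>x. f x + g x)"])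
  fix h :: "real^'n \<Rightarrow> 'k" and x i assume "\<exists>f g. smooth f \<and> smooth g \<and> h = (\<lambda>x. f x + g x)"
  then obtain f g where fg: "smooth f" "smooth g" "h = (\<lambda>x. f x + g x)" by blast
  show "h differentiable at x" unfolding fg by (intro differentiable_add smooth_differentiable fg)
  show "\<exists>f g. smooth f \<and> smooth g \<and> partial_deriv i h = (\<lambda>x. f x + g x)"
    using fg partial_deriv_add[OF fg(1,2)] by blast
qed (use assms in blast)

lemma iterated_partial_add:
  assumes "smooth f" "smooth g"
  shows "iterated_partial is (\<lambda>x. f x + g x) = (\<lambda>x. iterated_partial is f x + iterated_partial is g x)"
  by (induction "is") (simp_all add: partial_deriv_add smooth_iterated_partial assms)

lemma partial_deriv_scaleR:
  fixes m :: "real^'n \<Rightarrow> real" and f :: "real^'n \<Rightarrow> 'k::real_normed_vector"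
  assumes "smooth m" "smooth f"
  shows "partial_deriv i (\<lambda>x. m x *\<^sub>R f x) = (\<lambda>x. partial_deriv i m x *\<^sub>R f x + m x *\<^sub>R partial_deriv i f x)"
proof
  fix x
  show "partial_deriv i (\<lambda>x. m x *\<^sub>R f x) x = partial_deriv i m x *\<^sub>R f x + m x *\<^sub>R partial_deriv i f x"
    using partial_deriv_eqI[OF has_derivative_scaleR[OF smooth_has_derivative[OF assms(1)] smooth_has_derivative[OF assms(2)]], of i x]
    unfolding partial_deriv_eqI[OF smooth_has_derivative[OF assms(1)], symmetric]
      partial_deriv_eqI[OF smooth_has_derivative[OF assms(2)], symmetric]
    by (simp add: add.commute)
qed

text \<open>Products alone are not closed under partial derivatives, since the product rule gives a
  sum of two products; closing them under sums yields a class to which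
  \<open>smooth_coinduct\<close> applies.\<close>

inductive scaleR_sum :: "(real^'n \<Rightarrow> 'k::real_normed_vector) \<Rightarrow> bool"
  where prod: "smooth m \<Longrightarrow> smooth f \<Longrightarrow> scaleR_sum (\<lambda>x. m x *\<^sub>R f x)"
  | add: "scaleR_sum f \<Longrightarrow> scaleR_sum g \<Longrightarrow> scaleR_sum (\<lambda>x. f x + g x)"

lemma smooth_scaleR:
  fixes m :: "real^'n \<Rightarrow> real" and f :: "real^'n \<Rightarrow> 'k::real_normed_vector"
  assumes "smooth m" "smooth f"
  shows "smooth (\<lambda>x. m x *\<^sub>R f x)"
proof -
  have *: "(\<forall>x. h differentiable (at x)) \<and> (\<forall>i. scaleR_sum (partial_deriv i h))"
    if "scaleR_sum h" for h :: "real^'n \<Rightarrow> 'k"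
    using that
  proof induction
    case (prod m f)
    then show ?case
      by (auto simp: partial_deriv_scaleR
          intro!: scaleR_sum.intros differentiable_scaleR smooth_partial_deriv intro: smooth_differentiable)
  next
    case (add f g)
    have "partial_deriv i (\<lambda>x. f x + g x) = (\<lambda>x. partial_deriv i f x + partial_deriv i g x)" for i
    proof
      fix x
      have d: "f differentiable at x" "g differentiable at x" using add by auto
      show "partial_deriv i (\<lambda>x. f x + g x) x = partial_deriv i f x + partial_deriv i g x"
        using partial_deriv_eqI[OF has_derivative_add[OF has_derivative_partial_deriv[OF d(1)]
              has_derivative_partial_deriv[OF d(2)]], of i]
        unfolding partial_deriv_eqI[OF has_derivative_partial_deriv[OF d(1)], symmetric]
          partial_deriv_eqI[OF has_derivative_partial_deriv[OF d(2)], symmetric] .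
    qed
    then show ?case using add by (auto intro: scaleR_sum.intros differentiable_add)
  qed
  show ?thesis
    by (rule smooth_coinduct[where X = scaleR_sum]) (use * assms in \<open>auto intro: scaleR_sum.intros\<close>)
qed

lemma partial_deriv_const [simp]: "partial_deriv i (\<lambda>x. c) = (\<lambda>x. 0)"
  by (auto simp: partial_deriv_def)

lemma smooth_const [simp, intro]: "smooth (\<lambda>x. c)"
  by (rule smooth_coinduct[where X = "\<lambda>f. \<exists>c. f = (\<lambda>x. c)"]) auto

lemma smooth_uminus: "smooth f \<Longrightarrow> smooth (\<lambda>x. - f x)"
  by (rule smooth_bounded_linear) (rule bounded_linear_minus[OF bounded_linear_ident])

lemma smooth_diff: "smooth f \<Longrightarrow> smooth g \<Longrightarrow> smooth (\<lambda>x. f x - g x)"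
  using smooth_add[of f "\<lambda>x. - g x"] smooth_uminus by auto

lemma smooth_mult_left:
  fixes f :: "real^'n \<Rightarrow> 'k::real_normed_field"
  shows "smooth f \<Longrightarrow> smooth (\<lambda>x. c * f x)"
  by (rule smooth_bounded_linear[OF bounded_linear_mult_right])

lemma smooth_sum: "(\<And>i. i \<in> I \<Longrightarrow> smooth (f i)) \<Longrightarrow> smooth (\<lambda>x. \<Sum>i\<in>I. f i x)"
  by (induction I rule: infinite_finite_induct) (auto intro: smooth_add)

lemma smooth_prod:
  fixes f :: "'i \<Rightarrow> real^'n \<Rightarrow> real"
  assumes "\<And>i. i \<in> I \<Longrightarrow> smooth (f i)"
  shows "smooth (\<lambda>x. \<Prod>i\<in>I. f i x)"
  using assms
proof (induction I rule: infinite_finite_induct)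
  case (insert i I)
  then show ?case using smooth_scaleR[of "f i" "\<lambda>x. \<Prod>i\<in>I. f i x"] by simp
qed auto


text \<open>The mean of \<open>f\<close> over the segment from \<open>x\<close> to
  \<open>x + v\<close>. Over the fixed interval \<open>{0..1}\<close> the point \<open>x\<close>
  enters only through the integrand, so averaging commutes with every partial derivative; one-sided
  line integrals are later recovered as multiples of such means.\<close>

definition segment_average :: "real^'n \<Rightarrow> (real^'n \<Rightarrow> 'k::euclidean_space) \<Rightarrow> real^'n \<Rightarrow> 'k"
  where "segment_average v f x = integral {0..1} (\<lambda>t. f (x + t *\<^sub>R v))"

lemma smooth_integrable_segment:
  fixes f :: "real^'n \<Rightarrow> 'k::euclidean_space"
  shows "smooth f \<Longrightarrow> (\<lambda>t. f (x + t *\<^sub>R v)) integrable_on {a..b}"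
  by (intro integrable_continuous_real continuous_on_compose2[OF smooth_continuous_on[of f UNIV]] continuous_intros) auto

lemma segment_average_has_derivative:
  fixes f :: "real^'n \<Rightarrow> 'k::euclidean_space"
  assumes f: "smooth f"
  shows "(segment_average v f has_derivative 
    (\<lambda>w. \<Sum>i\<in>UNIV. (w $ i) *\<^sub>R segment_average v (partial_deriv i f) x)) (at x)"
proof -
  \<comment> \<open>The rule for differentiating under the integral sign takes derivatives valued in
    the bounded linear maps, so the total derivative of \<open>f\<close> is packaged as the
    continuous function \<open>B\<close>.\<close>
  define B :: "real^'n \<Rightarrow> (real^'n) \<Rightarrow>\<^sub>L 'k"
    where "B y = (\<Sum>i\<in>UNIV. blinfun_scaleR_left (partial_deriv i f y) o\<^sub>L blinfun_inner_left (axis i 1))" for y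
  have B: "blinfun_apply (B y) = (\<lambda>w. \<Sum>i\<in>UNIV. (w $ i) *\<^sub>R partial_deriv i f y)" for y
    by (auto simp: B_def blinfun.sum_left inner_axis fun_eq_iff)
  have cB: "continuous_on S B" for S
    unfolding B_def by (intro continuous_intros smooth_continuous_on smooth_partial_deriv f)
  have cB': "continuous_on S (\<lambda>x. B (g x))" if "continuous_on S g" for S and g :: "'z::topological_space \<Rightarrow> real^'n"
    by (rule continuous_on_compose2[OF cB[of UNIV] that]) auto
  have "((\<lambda>x. integral (cbox 0 (1::real)) (\<lambda>t. f (x + t *\<^sub>R v))) has_derivative
      blinfun_apply (integral (cbox 0 1) (\<lambda>t. B (x + t *\<^sub>R v)))) (at x within UNIV)"
  proof (rule leibniz_rule)
    fix x and t :: real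
    have "((\<lambda>x. x + t *\<^sub>R v) has_derivative (\<lambda>w. w)) (at x)"
      by (auto intro!: derivative_eq_intros)
    from has_derivative_compose[OF this smooth_has_derivative[OF f]]
    show "((\<lambda>x. f (x + t *\<^sub>R v)) has_derivative blinfun_apply (B (x + t *\<^sub>R v))) (at x within UNIV)"
      by (simp add: B)
    show "(\<lambda>t. f (x + t *\<^sub>R v)) integrable_on cbox 0 (1::real)"
      using smooth_integrable_segment[OF f] by simp
  next
    show "continuous_on (UNIV \<times> cbox 0 (1::real)) (\<lambda>(x, t). B (x + t *\<^sub>R v))"
      unfolding split_beta by (intro cB' continuous_intros)
  qed auto
  moreover have "blinfun_apply (integral (cbox 0 1) (\<lambda>t. B (x + t *\<^sub>R v))) =
     (\<lambda>w. \<Sum>i\<in>UNIV. (w $ i) *\<^sub>R segment_average v (partial_deriv i f) x)"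
  proof
    fix w
    have "(\<lambda>t. B (x + t *\<^sub>R v)) integrable_on cbox 0 (1::real)"
      by (intro integrable_continuous cB' continuous_intros)
    then have "blinfun_apply (integral (cbox 0 1) (\<lambda>t. B (x + t *\<^sub>R v))) w = 
       integral (cbox 0 1) (\<lambda>t. \<Sum>i\<in>UNIV. (w $ i) *\<^sub>R partial_deriv i f (x + t *\<^sub>R v))"
      by (simp add: blinfun_apply_integral B)
    also have "\<dots> = (\<Sum>i\<in>UNIV. integral {0..1} (\<lambda>t. (w $ i) *\<^sub>R partial_deriv i f (x + t *\<^sub>R v)))"
      using smooth_integrable_segment[OF smooth_partial_deriv[OF f]]
      by (subst integral_sum) (auto intro!: integrable_cmul)
    finally show "blinfun_apply (integral (cbox 0 1) (\<lambda>t. B (x + t *\<^sub>R v))) w =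
        (\<Sum>i\<in>UNIV. (w $ i) *\<^sub>R segment_average v (partial_deriv i f) x)"
      by (simp add: segment_average_def)
  qed
  ultimately show ?thesis unfolding segment_average_def by simp
qed

lemma partial_deriv_segment_average:
  fixes f :: "real^'n \<Rightarrow> 'k::euclidean_space"
  assumes f: "smooth f"
  shows "partial_deriv i (segment_average v f) = segment_average v (partial_deriv i f)"
proof
  fix x
  have "partial_deriv i (segment_average v f) x = 
      (\<Sum>j\<in>UNIV. (axis i (1::real) $ j) *\<^sub>R segment_average v (partial_deriv j f) x)"
    by (rule partial_deriv_eqI[OF segment_average_has_derivative[OF f]])
  also have "\<dots> = (\<Sum>j\<in>UNIV. if j = i then segment_average v (partial_deriv j f) x else 0)"
    by (intro sum.cong) (auto simp: axis_def)
  finally show "partial_deriv i (segment_average v f) x = segment_average v (partial_deriv i f) x" by simp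
qed

lemma smooth_segment_average:
  fixes f :: "real^'n \<Rightarrow> 'k::euclidean_space"
  assumes f: "smooth f"
  shows "smooth (segment_average v f)"
proof (rule smooth_coinduct[where X = "\<lambda>h. \<exists>g. smooth g \<and> h = segment_average v g"])
  fix h :: "real^'n \<Rightarrow> 'k" and x i assume "\<exists>g. smooth g \<and> h = segment_average v g"
  then obtain g where g: "smooth g" "h = segment_average v g" by blast
  show "h differentiable at x"
    unfolding g differentiable_def using segment_average_has_derivative[OF g(1)] by blast
  show "\<exists>g. smooth g \<and> partial_deriv i h = segment_average v g"
    using g partial_deriv_segment_average[OF g(1)] by blast
qed (use assms in blast)

lemma iterated_partial_segment_average:
  fixes f :: "real^'n \<Rightarrow> 'k::euclidean_space"
  assumes f: "smooth f"
  shows "iterated_partial is (segment_average v f) = segment_average v (iterated_partial is f)"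
  by (induction "is") (simp_all add: partial_deriv_segment_average smooth_iterated_partial assms)

lemma smooth_line_has_vector_derivative:
  fixes f :: "real^'n \<Rightarrow> 'k::real_normed_vector"
  assumes f: "smooth f"
  shows "((\<lambda>t. f (x + (t * r) *\<^sub>R axis j 1)) has_vector_derivative r *\<^sub>R partial_deriv j f (x + (t * r) *\<^sub>R axis j 1)) (at t within S)"
proof -
  have "((\<lambda>t. x + (t * r) *\<^sub>R axis j (1::real)) has_derivative (\<lambda>t. t *\<^sub>R r *\<^sub>R axis j 1)) (at t within S)"
    by (auto intro!: derivative_eq_intros)
  from has_derivative_compose[OF this smooth_has_derivative[OF f]]
  have "((\<lambda>t. f (x + (t * r) *\<^sub>R axis j 1)) has_derivative (\<lambda>s. \<Sum>i\<in>UNIV. ((s *\<^sub>R r *\<^sub>R axis j 1) $ i) *\<^sub>R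
      partial_deriv i f (x + (t * r) *\<^sub>R axis j 1))) (at t within S)" .
  moreover have "(\<Sum>i\<in>UNIV. ((s *\<^sub>R r *\<^sub>R axis j (1::real)) $ i) *\<^sub>R partial_deriv i f y) = s *\<^sub>R r *\<^sub>R partial_deriv j f y"
    for s y
  proof -
    have "(\<Sum>i\<in>UNIV. ((s *\<^sub>R r *\<^sub>R axis j (1::real)) $ i) *\<^sub>R partial_deriv i f y) =
      (\<Sum>i\<in>UNIV. if i = j then s *\<^sub>R r *\<^sub>R partial_deriv i f y else 0)"
      by (intro sum.cong) (auto simp: axis_def)
    then show ?thesis by simp
  qed
  ultimately show ?thesis by (simp add: has_vector_derivative_def)
qed

text \<open>Fundamental theorem of calculus along the segment. Keeping the factor \<open>r\<close>
  on the left covers zero and negative \<open>r\<close>; negative \<open>r\<close> serves for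
  integrals to the left.\<close>

lemma segment_average_partial_deriv:
  fixes f :: "real^'n \<Rightarrow> 'k::euclidean_space"
  assumes f: "smooth f"
  shows "r *\<^sub>R segment_average (r *\<^sub>R axis j 1) (partial_deriv j f) x = f (x + r *\<^sub>R axis j 1) - f x"
proof -
  have "((\<lambda>t. r *\<^sub>R partial_deriv j f (x + (t * r) *\<^sub>R axis j 1)) has_integral
      f (x + (1 * r) *\<^sub>R axis j 1) - f (x + (0 * r) *\<^sub>R axis j 1)) {0..1}"
    by (intro fundamental_theorem_of_calculus smooth_line_has_vector_derivative f) simp
  then show ?thesis
    unfolding segment_average_def by (simp add: integral_unique flip: integral_cmul)
qed

text \<open>Both mixed derivatives are recovered from the averages of \<open>\<partial>\<^sub>i \<partial>\<^sub>j f\<close> over shrinking segments, because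
  \<open>\<partial>\<^sub>i\<close> commutes with averaging.\<close>

lemma partial_deriv_commute:
  fixes f :: "real^'n \<Rightarrow> 'k::euclidean_space"
  assumes f: "smooth f"
  shows "partial_deriv i (partial_deriv j f) = partial_deriv j (partial_deriv i f)"
proof
  fix x
  define \<psi> where "\<psi> = partial_deriv i (partial_deriv j f)"
  have s\<psi>: "smooth \<psi>" unfolding \<psi>_def by (intro smooth_partial_deriv f)
  have diff_i: "s *\<^sub>R segment_average (s *\<^sub>R axis j 1) \<psi> x = 
      partial_deriv i f (x + s *\<^sub>R axis j 1) - partial_deriv i f x" for s
  proof -
    have 1: "((\<lambda>x. x + s *\<^sub>R axis j 1) has_derivative (\<lambda>w. w)) (at x)" for x :: "real^'n"
      by (auto intro!: derivative_eq_intros)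
    note 2 = has_derivative_compose[OF 1 smooth_has_derivative[OF f]]
    have "(\<lambda>x. s *\<^sub>R segment_average (s *\<^sub>R axis j 1) (partial_deriv j f) x) = (\<lambda>x. f (x + s *\<^sub>R axis j 1) - f x)"
      using segment_average_partial_deriv[OF f] by blast
    moreover have "partial_deriv i (\<lambda>x. f (x + s *\<^sub>R axis j 1) - f x) x =
        partial_deriv i f (x + s *\<^sub>R axis j 1) - partial_deriv i f x"
      using partial_deriv_eqI[OF has_derivative_diff[OF 2 smooth_has_derivative[OF f]], of i x]
      unfolding partial_deriv_eqI[OF smooth_has_derivative[OF f], symmetric] .
    moreover have "partial_deriv i (\<lambda>x. s *\<^sub>R segment_average (s *\<^sub>R axis j 1) (partial_deriv j f) x) x
        = s *\<^sub>R segment_average (s *\<^sub>R axis j 1) \<psi> x"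
      by (simp add: partial_deriv_bounded_linear[OF bounded_linear_scaleR_right] smooth_segment_average
          smooth_partial_deriv f partial_deriv_segment_average \<psi>_def)
    ultimately show ?thesis by simp
  qed
  \<comment> \<open>Joint continuity of the integrand makes the mean over the segment of length
    \<open>|s|\<close> tend to the value at its fixed end point \<open>x\<close>.\<close>
  have "continuous_on UNIV (\<lambda>s. integral (cbox 0 (1::real)) (\<lambda>t. \<psi> (x + t *\<^sub>R s *\<^sub>R axis j 1)))"
    by (intro integral_continuous_on_param, unfold split_beta)
       (intro continuous_on_compose2[OF smooth_continuous_on[OF s\<psi>, of UNIV]] continuous_intros, auto)
  then have "((\<lambda>s. segment_average (s *\<^sub>R axis j 1) \<psi> x) \<longlongrightarrow> segment_average (0 *\<^sub>R axis j 1) \<psi> x) (at 0)"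
    unfolding segment_average_def continuous_on_def cbox_interval by blast
  then have lim: "((\<lambda>s. segment_average (s *\<^sub>R axis j 1) \<psi> x) \<longlongrightarrow> \<psi> x) (at 0)"
    by (simp add: segment_average_def)
  have "((\<lambda>t. partial_deriv i f (x + (t * 1) *\<^sub>R axis j 1)) has_vector_derivative
      1 *\<^sub>R partial_deriv j (partial_deriv i f) (x + (0 * 1) *\<^sub>R axis j 1)) (at 0)"
    by (intro smooth_line_has_vector_derivative smooth_partial_deriv f)
  then have "((\<lambda>s. (partial_deriv i f (x + s *\<^sub>R axis j 1) - partial_deriv i f x) /\<^sub>R s) \<longlongrightarrow>
      partial_deriv j (partial_deriv i f) x) (at 0)"
  proof -
    assume "((\<lambda>t. partial_deriv i f (x + (t * 1) *\<^sub>R axis j 1)) has_vector_derivative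
      1 *\<^sub>R partial_deriv j (partial_deriv i f) (x + (0 * 1) *\<^sub>R axis j 1)) (at 0)"
    then have "(\<lambda>s. norm (partial_deriv i f (x + s *\<^sub>R axis j 1) - partial_deriv i f x - 
        s *\<^sub>R partial_deriv j (partial_deriv i f) x) / norm s) \<midarrow>0\<rightarrow> 0"
      unfolding has_vector_derivative_def has_derivative_at by simp
    moreover have "eventually (\<lambda>s. norm (partial_deriv i f (x + s *\<^sub>R axis j 1) - partial_deriv i f x - 
        s *\<^sub>R partial_deriv j (partial_deriv i f) x) / norm s = 
        norm ((partial_deriv i f (x + s *\<^sub>R axis j 1) - partial_deriv i f x) /\<^sub>R s
          - partial_deriv j (partial_deriv i f) x)) (at (0::real))"
    proof (intro eventually_at_filter[THEN iffD2] always_eventually allI impI)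
      fix s :: real assume "s \<noteq> 0"
      define u where "u = partial_deriv i f (x + s *\<^sub>R axis j 1) - partial_deriv i f x"
      have "u - s *\<^sub>R partial_deriv j (partial_deriv i f) x = s *\<^sub>R (u /\<^sub>R s - partial_deriv j (partial_deriv i f) x)"
        using \<open>s \<noteq> 0\<close> by (simp add: scaleR_diff_right)
      then have "norm (u - s *\<^sub>R partial_deriv j (partial_deriv i f) x) / norm s 
          = norm (u /\<^sub>R s - partial_deriv j (partial_deriv i f) x)"
        using \<open>s \<noteq> 0\<close> by simp
      then show "norm (partial_deriv i f (x + s *\<^sub>R axis j 1) - partial_deriv i f x - 
        s *\<^sub>R partial_deriv j (partial_deriv i f) x) / norm s = 
        norm ((partial_deriv i f (x + s *\<^sub>R axis j 1) - partial_deriv i f x) /\<^sub>R s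
          - partial_deriv j (partial_deriv i f) x)" unfolding u_def .
    qed
    ultimately have "(\<lambda>s. norm ((partial_deriv i f (x + s *\<^sub>R axis j 1) - partial_deriv i f x) /\<^sub>R s
          - partial_deriv j (partial_deriv i f) x)) \<midarrow>0\<rightarrow> 0"
      by (rule Lim_transform_eventually)
    then show ?thesis by (simp add: tendsto_norm_zero_iff flip: Lim_null)
  qed
  moreover have "eventually (\<lambda>s. (partial_deriv i f (x + s *\<^sub>R axis j 1) - partial_deriv i f x) /\<^sub>R s = 
      segment_average (s *\<^sub>R axis j 1) \<psi> x) (at (0::real))"
    by (auto simp: eventually_at_filter diff_i[symmetric])
  ultimately have "((\<lambda>s. segment_average (s *\<^sub>R axis j 1) \<psi> x) \<longlongrightarrow> partial_deriv j (partial_deriv i f) x) (at (0::real))"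
    by (rule Lim_transform_eventually)
  then show "partial_deriv i (partial_deriv j f) x = partial_deriv j (partial_deriv i f) x"
    using tendsto_unique[OF _ lim] unfolding \<psi>_def by auto
qed

section \<open>Test functions and their seminorms\<close>

lemma eq_0_if_notin_supp: "x \<notin> supp f \<Longrightarrow> f x = 0"
  unfolding supp_def using closure_subset[of "{x. f x \<noteq> 0}"] by blast

lemma supp_subsetI: "closed K \<Longrightarrow> (\<And>x. x \<notin> K \<Longrightarrow> f x = 0) \<Longrightarrow> supp f \<subseteq> K"
  unfolding supp_def by (rule closure_minimal) auto

lemma closed_supp [simp]: "closed (supp f)"
  by (simp add: supp_def)

text \<open>Off its closed support \<open>f\<close> vanishes on an open set and so has derivative 0
  there.\<close>

lemma supp_partial_deriv: "supp (partial_deriv i f) \<subseteq> supp f"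
proof (rule supp_subsetI)
  fix x assume x: "x \<notin> supp f"
  have "(f has_derivative (\<lambda>_. 0)) (at x)"
    by (rule has_derivative_transform_within_open[OF has_derivative_const[of 0], of "- supp f"])
       (use x in \<open>auto simp: open_Compl eq_0_if_notin_supp[of _ f]\<close>)
  then show "partial_deriv i f x = 0" by (rule partial_deriv_eqI)
qed simp

lemma supp_iterated_partial: "supp (iterated_partial is f) \<subseteq> supp f"
  by (induction "is") (use supp_partial_deriv in auto)

lemma test_functionsI:
  assumes "smooth f" "compact K" "K \<subseteq> U" "\<And>x. x \<notin> K \<Longrightarrow> f x = 0"
  shows "f \<in> test_functions U"
proof -
  have "supp f \<subseteq> K" using assms by (intro supp_subsetI compact_imp_closed)
  moreover from this have "compact (supp f)"
    using compact_Int_closed[OF assms(2) closed_supp[of f]] by (simp add: Int_absorb1)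
  ultimately show ?thesis using assms by (auto simp: test_functions_def)
qed

lemma test_functionsD:
  assumes "f \<in> test_functions U"
  shows "smooth f" "compact (supp f)" "supp f \<subseteq> U"
  using assms by (auto simp: test_functions_def)

lemma test_functions_mono: "U \<subseteq> V \<Longrightarrow> f \<in> test_functions U \<Longrightarrow> f \<in> test_functions V"
  by (auto simp: test_functions_def)

lemma test_functions_Int:
  "f \<in> test_functions U \<Longrightarrow> f \<in> test_functions V \<Longrightarrow> f \<in> test_functions (U \<inter> V)"
  by (auto simp: test_functions_def)

lemma test_functions_partial_deriv [intro]:
  assumes "f \<in> test_functions U"
  shows "partial_deriv i f \<in> test_functions U"
proof (rule test_functionsI[where K = "supp f"])
  fix x assume "x \<notin> supp f"
  then have "x \<notin> supp (partial_deriv i f)" using supp_partial_deriv by blast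
  then show "partial_deriv i f x = 0" by (rule eq_0_if_notin_supp)
qed (use test_functionsD[OF assms] in auto)

lemma test_functions_add:
  assumes "f \<in> test_functions U" "g \<in> test_functions U"
  shows "(\<lambda>x. f x + g x) \<in> test_functions U"
  by (rule test_functionsI[where K = "supp f \<union> supp g"])
     (use test_functionsD[OF assms(1)] test_functionsD[OF assms(2)] in
       \<open>auto intro: smooth_add simp: eq_0_if_notin_supp[of _ f] eq_0_if_notin_supp[of _ g]\<close>)

lemma test_functions_zero [simp, intro]: "(\<lambda>x. 0) \<in> test_functions U"
  by (rule test_functionsI[where K = "{}"]) auto

lemma test_functions_empty: "f \<in> test_functions {} \<Longrightarrow> f = (\<lambda>x. 0)"
  using test_functionsD(3) by (intro ext eq_0_if_notin_supp) blast

lemma test_functions_bounded_linear: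
  assumes "bounded_linear L" "f \<in> test_functions U"
  shows "(\<lambda>x. L (f x)) \<in> test_functions U"
  by (rule test_functionsI[where K = "supp f"])
     (use test_functionsD[OF assms(2)] assms(1) in 
       \<open>auto intro: smooth_bounded_linear simp: eq_0_if_notin_supp[of _ f] linear_0 bounded_linear.linear\<close>)

lemma test_functions_mult_left:
  fixes f :: "real^'n \<Rightarrow> 'k::real_normed_field"
  shows "f \<in> test_functions U \<Longrightarrow> (\<lambda>x. c * f x) \<in> test_functions U"
  by (rule test_functions_bounded_linear[OF bounded_linear_mult_right])

lemma test_functions_diff:
  "f \<in> test_functions U \<Longrightarrow> g \<in> test_functions U \<Longrightarrow> (\<lambda>x. f x - g x) \<in> test_functions U"
  using test_functions_add[of f U "\<lambda>x. - g x"] 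
    test_functions_bounded_linear[OF bounded_linear_minus[OF bounded_linear_ident], of g U] by simp

lemma test_functions_sum:
  "(\<And>i. i \<in> I \<Longrightarrow> f i \<in> test_functions U) \<Longrightarrow> (\<lambda>x. \<Sum>i\<in>I. f i x) \<in> test_functions U"
  by (induction I rule: infinite_finite_induct) (auto intro: test_functions_add)

lemma test_functions_scaleR:
  fixes m :: "real^'n \<Rightarrow> real"
  assumes "smooth m" "f \<in> test_functions U"
  shows "(\<lambda>x. m x *\<^sub>R f x) \<in> test_functions U"
  by (rule test_functionsI[where K = "supp f"])
     (use test_functionsD[OF assms(2)] assms(1) in \<open>auto intro: smooth_scaleR simp: eq_0_if_notin_supp[of _ f]\<close>)

lemma supp_scaleR: "supp (\<lambda>x. m x *\<^sub>R f x) \<subseteq> supp f" "supp (\<lambda>x. m x *\<^sub>R f x) \<subseteq> supp m"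
  by (rule supp_subsetI; simp add: eq_0_if_notin_supp[of _ f] eq_0_if_notin_supp[of _ m])+

lemma test_functions_scaleR':
  fixes m :: "real^'n \<Rightarrow> real"
  assumes "m \<in> test_functions U" "smooth f"
  shows "(\<lambda>x. m x *\<^sub>R f x) \<in> test_functions U"
  by (rule test_functionsI[where K = "supp m"])
     (use test_functionsD[OF assms(1)] assms(2) in \<open>auto intro: smooth_scaleR simp: eq_0_if_notin_supp[of _ m]\<close>)

section \<open>Seminorms of derivatives, averages and products\<close>

lemma bounded_range_if_compact_supp:
  fixes f :: "real^'n \<Rightarrow> 'k::real_normed_vector"
  assumes "continuous_on UNIV f" "compact (supp f)"
  shows "bdd_above (range (\<lambda>x. norm (f x)))"
proof -
  have "bounded (f ` supp f)"
    using assms by (meson compact_continuous_image compact_imp_bounded continuous_on_subset subset_UNIV)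
  then obtain B where B: "B > 0" "\<And>x. x \<in> supp f \<Longrightarrow> norm (f x) \<le> B"
    by (auto simp: bounded_pos)
  have "norm (f x) \<le> B" for x
    by (cases "x \<in> supp f") (use B in \<open>auto simp: eq_0_if_notin_supp[of _ f] less_imp_le\<close>)
  then show ?thesis by (intro bdd_aboveI[of _ B]) auto
qed

text \<open>This is the sum occurring in \<open>distributions\<close>, named so that continuity
  estimates can be chained.\<close>

definition seminorm :: "nat \<Rightarrow> (real^'n \<Rightarrow> 'k::real_normed_vector) \<Rightarrow> real"
  where "seminorm N f = (\<Sum>is | length is \<le> N. SUP x. norm (iterated_partial is f x))"

lemma finite_lists_bounded_length: "finite {is :: 'n::finite list. length is \<le> N}"
  using finite_lists_length_le[of "UNIV :: 'n set" N] by simp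

text \<open>The supremum of an unbounded set of reals carries no information, so the estimates of a
  function by its own \<open>seminorm\<close> rest on this bound.\<close>

lemma bdd_above_iterated_partial:
  assumes "smooth f" "compact (supp f)"
  shows "bdd_above (range (\<lambda>x. norm (iterated_partial is f x)))"
proof (rule bounded_range_if_compact_supp)
  show "continuous_on UNIV (iterated_partial is f)"
    by (intro smooth_continuous_on smooth_iterated_partial assms)
  show "compact (supp (iterated_partial is f))"
    using compact_Int_closed[OF assms(2) closed_supp[of "iterated_partial is f"]]
    by (simp add: Int_absorb1 supp_iterated_partial)
qed

lemma sup_nonneg:
  assumes "bdd_above (range (\<lambda>x. norm (f x)))"
  shows "0 \<le> (SUP x. norm (f x))"
  by (rule order_trans[OF norm_ge_zero cSUP_upper[OF UNIV_I assms]])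

lemma seminorm_nonneg:
  assumes "smooth f" "compact (supp f)"
  shows "0 \<le> seminorm N f"
  unfolding seminorm_def by (intro sum_nonneg sup_nonneg bdd_above_iterated_partial assms)

lemma norm_iterated_partial_le_seminorm:
  assumes "smooth f" "compact (supp f)" "length is \<le> N"
  shows "norm (iterated_partial is f x) \<le> seminorm N f"
proof -
  have "norm (iterated_partial is f x) \<le> (SUP x. norm (iterated_partial is f x))"
    by (rule cSUP_upper[OF UNIV_I bdd_above_iterated_partial[OF assms(1,2)]])
  also have "\<dots> \<le> seminorm N f"
    unfolding seminorm_def using assms
    by (intro member_le_sum) (auto intro!: sup_nonneg bdd_above_iterated_partial finite_lists_bounded_length)
  finally show ?thesis .
qed

lemma norm_le_seminorm:
  assumes "smooth f" "compact (supp f)"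
  shows "norm (f x) \<le> seminorm N f"
  using norm_iterated_partial_le_seminorm[OF assms, of "[]" N] by simp

lemma seminorm_le:
  fixes f :: "real^'n \<Rightarrow> 'k::real_normed_vector"
  assumes "\<And>is x. length is \<le> N \<Longrightarrow> norm (iterated_partial is f x) \<le> C is"
  shows "seminorm N f \<le> (\<Sum>is | length is \<le> N. C is)"
  unfolding seminorm_def by (intro sum_mono cSUP_least) (use assms in auto)

lemma seminorm_mono:
  assumes "smooth f" "compact (supp f)" "N \<le> M"
  shows "seminorm N f \<le> seminorm M f"
  unfolding seminorm_def using assms
  by (intro sum_mono2 sup_nonneg bdd_above_iterated_partial finite_lists_bounded_length) auto

text \<open>Appending \<open>i\<close> to a multi-index is injective and raises its length by one,
  so the left side is a partial sum of the right side, whose terms are nonnegative.\<close>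

lemma seminorm_partial_deriv:
  assumes "smooth f" "compact (supp f)"
  shows "seminorm N (partial_deriv i f) \<le> seminorm (Suc N) f"
proof -
  have "seminorm N (partial_deriv i f) =
      (\<Sum>is\<in>(\<lambda>is. is @ [i]) ` {is. length is \<le> N}. SUP x. norm (iterated_partial is f x))"
    unfolding seminorm_def by (subst sum.reindex) (auto simp: inj_on_def)
  also have "\<dots> \<le> seminorm (Suc N) f"
    unfolding seminorm_def using assms
    by (intro sum_mono2 sup_nonneg bdd_above_iterated_partial finite_lists_bounded_length) auto
  finally show ?thesis .
qed

text \<open>Averaging commutes with iterated derivatives and does not increase a supremum
  norm.\<close>

lemma seminorm_segment_average:
  fixes f :: "real^'n \<Rightarrow> 'k::euclidean_space"
  assumes "smooth f" "compact (supp f)"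
  shows "seminorm N (segment_average v f) \<le> seminorm N f"
proof -
  have "norm (iterated_partial is (segment_average v f) x) \<le> (SUP x. norm (iterated_partial is f x))" for "is" x
  proof -
    have "norm (iterated_partial is (segment_average v f) x) = 
        norm (integral {0..1} (\<lambda>t. iterated_partial is f (x + t *\<^sub>R v)))"
      by (simp add: iterated_partial_segment_average[OF assms(1)] segment_average_def)
    also have "\<dots> \<le> integral {0..1::real} (\<lambda>t. SUP x. norm (iterated_partial is f x))"
      by (intro integral_norm_bound_integral smooth_integrable_segment smooth_iterated_partial assms integrable_const_ivl
          cSUP_upper bdd_above_iterated_partial) auto
    finally show ?thesis by simp
  qed
  then show ?thesis unfolding seminorm_def[of N f] by (intro seminorm_le)
qed

text \<open>Induction from the right end of the list, where the innermost derivative sits: the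
  product rule leaves two products and a shorter list. In one of them \<open>m\<close> is replaced
  by its derivative, so the claim must be general in \<open>m\<close>. The constant is uniform in
  \<open>f\<close>, which makes multiplication continuous.\<close>

lemma norm_iterated_partial_scaleR_le:
  fixes L :: "(real^'n) set"
  assumes "compact L" "smooth m"
  shows "\<exists>C\<ge>0. \<forall>f :: real^'n \<Rightarrow> 'k::real_normed_vector. smooth f \<longrightarrow> supp f \<subseteq> L \<longrightarrow>
    (\<forall>x. norm (iterated_partial is (\<lambda>x. m x *\<^sub>R f x) x) \<le> C * seminorm (length is) f)"
  using assms(2)
proof (induction "is" arbitrary: m rule: rev_induct)
  case Nil
  have "bounded (m ` L)"
    using assms(1) by (intro compact_imp_bounded compact_continuous_image smooth_continuous_on Nil)
  then obtain C where C: "C > 0" "\<And>x. x \<in> L \<Longrightarrow> norm (m x) \<le> C"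
    by (auto simp: bounded_pos)
  have "norm (m x *\<^sub>R f x) \<le> C * seminorm 0 f" if f: "smooth f" "supp f \<subseteq> L" for f :: "real^'n \<Rightarrow> 'k" and x
  proof (cases "x \<in> L")
    case True
    have "compact (supp f)" using compact_Int_closed[OF assms(1) closed_supp[of f]] f by (simp add: Int_absorb1)
    then show ?thesis using C True norm_le_seminorm[OF f(1)] by (simp add: mult_mono)
  next
    case False
    then have "f x = 0" using f eq_0_if_notin_supp by blast
    moreover have "compact (supp f)" using compact_Int_closed[OF assms(1) closed_supp[of f]] f by (simp add: Int_absorb1)
    ultimately show ?thesis using C seminorm_nonneg[OF f(1)] by simp
  qed
  then show ?case using C by (auto intro!: exI[of _ C])
next
  case (snoc i "is")
  obtain C1 where C1: "C1 \<ge> 0" "\<And>f :: real^'n \<Rightarrow> 'k. \<And>x. smooth f \<Longrightarrow> supp f \<subseteq> L \<Longrightarrow> 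
      norm (iterated_partial is (\<lambda>x. m x *\<^sub>R f x) x) \<le> C1 * seminorm (length is) f"
    using snoc.IH[OF snoc.prems] by blast
  obtain C2 where C2: "C2 \<ge> 0" "\<And>f :: real^'n \<Rightarrow> 'k. \<And>x. smooth f \<Longrightarrow> supp f \<subseteq> L \<Longrightarrow> 
      norm (iterated_partial is (\<lambda>x. partial_deriv i m x *\<^sub>R f x) x) \<le> C2 * seminorm (length is) f"
    using snoc.IH[OF smooth_partial_deriv[OF snoc.prems, of i]] by blast
  have "norm (iterated_partial (is @ [i]) (\<lambda>x. m x *\<^sub>R f x) x) \<le> (C1 + C2) * seminorm (length (is @ [i])) f"
    if f: "smooth f" "supp f \<subseteq> L" for f :: "real^'n \<Rightarrow> 'k" and x
  proof -
    have cf: "compact (supp f)" using compact_Int_closed[OF assms(1) closed_supp[of f]] f by (simp add: Int_absorb1)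
    have "iterated_partial (is @ [i]) (\<lambda>x. m x *\<^sub>R f x) x =
      iterated_partial is (\<lambda>x. partial_deriv i m x *\<^sub>R f x) x + iterated_partial is (\<lambda>x. m x *\<^sub>R partial_deriv i f x) x"
      using f snoc.prems
      by (simp add: partial_deriv_scaleR iterated_partial_add smooth_scaleR smooth_partial_deriv)
    then have "norm (iterated_partial (is @ [i]) (\<lambda>x. m x *\<^sub>R f x) x) \<le> 
      C2 * seminorm (length is) f + C1 * seminorm (length is) (partial_deriv i f)"
      using norm_triangle_le[OF add_mono[OF C2(2)[OF f] C1(2)[OF smooth_partial_deriv[OF f(1)]
            order_trans[OF supp_partial_deriv f(2)]]]] by simp
    also have "\<dots> \<le> C2 * seminorm (Suc (length is)) f + C1 * seminorm (Suc (length is)) f"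
      using C1(1) C2(1) by (intro add_mono mult_left_mono seminorm_partial_deriv seminorm_mono f cf) auto
    finally show ?thesis by (simp add: algebra_simps)
  qed
  then show ?case using C1(1) C2(1) by (intro exI[of _ "C1 + C2"]) auto
qed

lemma seminorm_scaleR:
  fixes L :: "(real^'n) set"
  assumes "compact L" "smooth m"
  obtains C where "C \<ge> 0" "\<And>f :: real^'n \<Rightarrow> 'k::real_normed_vector. smooth f \<Longrightarrow> supp f \<subseteq> L \<Longrightarrow>
    seminorm N (\<lambda>x. m x *\<^sub>R f x) \<le> C * seminorm N f"
proof -
  have "\<forall>is. \<exists>C\<ge>0. \<forall>f :: real^'n \<Rightarrow> 'k::real_normed_vector. smooth f \<longrightarrow> supp f \<subseteq> L \<longrightarrow>
    (\<forall>x. norm (iterated_partial is (\<lambda>x. m x *\<^sub>R f x) x) \<le> C * seminorm (length is) f)"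
    using norm_iterated_partial_scaleR_le[OF assms] by blast
  then obtain C where C: "\<And>is. C is \<ge> 0" "\<And>is. \<And>f :: real^'n \<Rightarrow> 'k. \<And>x. smooth f \<Longrightarrow> supp f \<subseteq> L \<Longrightarrow>
    norm (iterated_partial is (\<lambda>x. m x *\<^sub>R f x) x) \<le> C is * seminorm (length is) f" by metis
  show ?thesis
  proof (rule that[of "\<Sum>is | length is \<le> N. C is"])
    show "0 \<le> (\<Sum>is | length is \<le> N. C is)" using C(1) by (simp add: sum_nonneg)
    fix f :: "real^'n \<Rightarrow> 'k" assume f: "smooth f" "supp f \<subseteq> L"
    have cf: "compact (supp f)" using compact_Int_closed[OF assms(1) closed_supp[of f]] f by (simp add: Int_absorb1)
    have "norm (iterated_partial is (\<lambda>x. m x *\<^sub>R f x) x) \<le> C is * seminorm N f" if "length is \<le> N" for "is" x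
      by (rule order_trans[OF C(2)[OF f]]) (intro mult_left_mono seminorm_mono f cf that C)
    from seminorm_le[OF this] show "seminorm N (\<lambda>x. m x *\<^sub>R f x) \<le> (\<Sum>is | length is \<le> N. C is) * seminorm N f"
      by (simp add: sum_distrib_right)
  qed
qed

section \<open>Smooth steps and bumps\<close>

text \<open>These functions form a class closed under differentiation that contains the standard
  flat function \<open>exp (- 1 / t)\<close>, the case \<open>p = 1\<close>.\<close>

definition flat :: "real poly \<Rightarrow> real \<Rightarrow> real"
  where "flat p t = (if t > 0 then poly p (1 / t) * exp (- (1 / t)) else 0)"

lemma poly_times_exp_minus_tendsto_0: "((\<lambda>s. poly p s * exp (- s)) \<longlongrightarrow> 0) (at_top :: real filter)"
proof -
  have "((\<lambda>s. \<Sum>i\<le>degree p. coeff p i * (s ^ i / exp s)) \<longlongrightarrow> (\<Sum>i\<le>degree p. coeff p i * 0)) (at_top :: real filter)"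
    by (intro tendsto_intros tendsto_power_div_exp_0)
  moreover have "(\<lambda>s. \<Sum>i\<le>degree p. coeff p i * (s ^ i / exp s)) = (\<lambda>s. poly p s * exp (- s))"
    by (simp add: poly_altdef sum_distrib_right exp_minus divide_inverse mult.assoc)
  ultimately show ?thesis by simp
qed

text \<open>With \<open>s = 1 / t\<close> the derivative for \<open>t > 0\<close> is
  \<open>s^2 * (p s - p' s) * exp (- s)\<close>, which explains the polynomial. At 0 the difference
  quotient from the right is \<open>s * p s * exp (- s)\<close> with \<open>s\<close> tending to
  infinity.\<close>

lemma flat_has_real_derivative:
  "(flat p has_real_derivative flat ([:0, 0, 1:] * (p - pderiv p)) t) (at t)"
proof (cases t "0::real" rule: linorder_cases)
  case less
  have "(flat p has_real_derivative 0) (at t)"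
    by (rule has_field_derivative_transform_within_open[of "\<lambda>_. 0" _ _ "{..<0}"])
       (use less in \<open>auto simp: flat_def\<close>)
  then show ?thesis using less by (simp add: flat_def)
next
  case greater
  have "((\<lambda>t. poly p (1 / t) * exp (- (1 / t))) has_real_derivative flat ([:0, 0, 1:] * (p - pderiv p)) t) (at t)"
    using greater
    by (auto intro!: derivative_eq_intros DERIV_chain2[OF poly_DERIV] simp: flat_def field_simps power2_eq_square)
  then show ?thesis
    by (rule has_field_derivative_transform_within_open[of _ _ _ "{0<..}"])
       (use greater in \<open>auto simp: flat_def\<close>)
next
  case equal
  have "((\<lambda>s. poly (pCons 0 p) s * exp (- s)) \<longlongrightarrow> 0) (at_top :: real filter)"
    by (rule poly_times_exp_minus_tendsto_0)
  then have "((\<lambda>h. poly (pCons 0 p) (inverse h) * exp (- inverse h)) \<longlongrightarrow> 0) (at_right (0::real))"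
    by (rule filterlim_compose[OF _ filterlim_inverse_at_top_right])
  then have "((\<lambda>h. flat p h / h) \<longlongrightarrow> 0) (at_right (0::real))"
    by (rule Lim_transform_eventually)
       (auto simp: eventually_at_right_field flat_def field_simps intro!: exI[of _ 1])
  moreover have "((\<lambda>h. flat p h / h) \<longlongrightarrow> 0) (at_left (0::real))"
    by (rule Lim_transform_eventually[of "\<lambda>_. 0"])
       (auto simp: eventually_at_left_field flat_def intro!: exI[of _ "-1"])
  ultimately have "((\<lambda>h. flat p h / h) \<longlongrightarrow> 0) (at (0::real))"
    by (simp add: filterlim_split_at)
  then show ?thesis using equal by (simp add: DERIV_def flat_def)
qed

lemma partial_deriv_coordinate:
  fixes j :: "'n::finite" and H h :: "real \<Rightarrow> real"
  assumes "\<And>t. (H has_real_derivative h t) (at t)"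
  shows "(\<lambda>x::real^'n. H (x $ j)) differentiable (at x)"
    "partial_deriv i (\<lambda>x::real^'n. H (x $ j)) = (\<lambda>x. if i = j then h (x $ j) else 0)"
proof -
  have D: "((\<lambda>x::real^'n. H (x $ j)) has_derivative (\<lambda>w. w $ j * h (x $ j))) (at x)" for x
  proof -
    have "((\<lambda>x::real^'n. x $ j) has_derivative (\<lambda>w. w $ j)) (at x)"
      by (rule bounded_linear.has_derivative[OF bounded_linear_vec_nth has_derivative_ident])
    from has_derivative_compose[OF this assms[of "x $ j", unfolded has_field_derivative_def]]
    show ?thesis by (simp add: mult.commute)
  qed
  then show "(\<lambda>x::real^'n. H (x $ j)) differentiable (at x)" unfolding differentiable_def by blast
  show "partial_deriv i (\<lambda>x::real^'n. H (x $ j)) = (\<lambda>x. if i = j then h (x $ j) else 0)"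
    using partial_deriv_eqI[OF D] by (auto simp: axis_def fun_eq_iff)
qed

text \<open>In the coinduction the scalar \<open>c\<close> absorbs the factor \<open>s\<close> of
  the chain rule and becomes 0 for derivatives in the other coordinates.\<close>

lemma smooth_flat_coordinate: "smooth (\<lambda>x::real^'n. flat p (s * x $ j + a))"
proof (rule smooth_coinduct[where X = "\<lambda>f. \<exists>c p. f = (\<lambda>x::real^'n. c * flat p (s * x $ j + a))"])
  show "\<exists>c p'. (\<lambda>x::real^'n. flat p (s * x $ j + a)) = (\<lambda>x. c * flat p' (s * x $ j + a))"
    by (intro exI[of _ 1] exI[of _ p]) simp
  fix f :: "real^'n \<Rightarrow> real" and x :: "real^'n" and i
  assume "\<exists>c p. f = (\<lambda>x::real^'n. c * flat p (s * x $ j + a))"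
  then obtain c p where f: "f = (\<lambda>x. c * flat p (s * x $ j + a))" by blast
  let ?q = "[:0, 0, 1:] * (p - pderiv p)"
  have D: "((\<lambda>t. c * flat p (s * t + a)) has_real_derivative c * s * flat ?q (s * t + a)) (at t)" for t
  proof -
    have "((\<lambda>t. s * t + a) has_real_derivative s) (at t)" by (auto intro!: derivative_eq_intros)
    from DERIV_cmult[OF DERIV_chain2[OF flat_has_real_derivative this], of c p]
    show ?thesis by (simp only: mult_ac)
  qed
  show "f differentiable at x" unfolding f by (rule partial_deriv_coordinate[OF D])
  have "partial_deriv i f = (\<lambda>x. (if i = j then c * s else 0) * flat ?q (s * x $ j + a))"
    unfolding f partial_deriv_coordinate[OF D] by (simp add: fun_eq_iff)
  then show "\<exists>c p. partial_deriv i f = (\<lambda>x. c * flat p (s * x $ j + a))" by blast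
qed

text \<open>\<open>H\<close> is the normalised primitive of a bump that is positive exactly between
  \<open>p\<close> and \<open>q\<close>. Its smoothness follows from that of its derivative, so no
  formula for the primitive is required.\<close>

lemma smooth_step_exists:
  fixes p q :: real
  assumes "p < q"
  obtains H h where "\<And>t. (H has_real_derivative h t) (at t)" "\<And>t. t \<le> p \<Longrightarrow> H t = 0" "\<And>t. q \<le> t \<Longrightarrow> H t = 1"
    "\<And>t. 0 \<le> H t" "\<And>t. H t \<le> 1" "\<And>t. t \<notin> {p..q} \<Longrightarrow> h t = 0"
    "\<And>j::'n::finite. smooth (\<lambda>x::real^'n. H (x $ j))" 
proof -
  \<comment> \<open>The arguments have the shape \<open>s * t + a\<close> of
    \<open>smooth_flat_coordinate\<close>; one factor vanishes for \<open>t \<le> p\<close>, the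
    other for \<open>q \<le> t\<close>.\<close>
  define h0 where "h0 t = flat 1 (1 * t + - p) * flat 1 (- 1 * t + q)" for t
  have flat_cont: "isCont (flat 1) t" for t
    by (rule DERIV_isCont[OF flat_has_real_derivative])
  have "isCont h0 t" for t
    unfolding h0_def by (intro continuous_intros isCont_o2[OF _ flat_cont])
  then obtain F where F: "\<And>t. (F has_real_derivative h0 t) (at t)"
    using einterval_antiderivative[of "-\<infinity>" "\<infinity>" h0]
    by (auto simp: has_real_derivative_iff_has_vector_derivative)
  have h0_nonneg: "0 \<le> h0 t" for t by (simp add: h0_def flat_def)
  have h0_zero: "h0 t = 0" if "t \<notin> {p<..<q}" for t using that by (auto simp: h0_def flat_def)
  have h0_pos: "0 < h0 t" if "p < t" "t < q" for t using that by (simp add: h0_def flat_def)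
  have Fmono: "F s \<le> F t" if "s \<le> t" for s t
    by (rule DERIV_nonneg_imp_nondecreasing[OF that]) (use F h0_nonneg in blast)
  have Fp: "F t = F p" if "t \<le> p" for t
  proof -
    have "F p \<le> F t"
      by (rule DERIV_nonpos_imp_nonincreasing[OF that]) (use F h0_zero in force)
    then show ?thesis using Fmono[OF that] by simp
  qed
  have Fq: "F t = F q" if "q \<le> t" for t
  proof -
    have "F t \<le> F q"
      by (rule DERIV_nonpos_imp_nonincreasing[OF that]) (use F h0_zero in force)
    then show ?thesis using Fmono[OF that] by simp
  qed
  have Fpq: "F p < F q"
  proof (rule DERIV_pos_imp_increasing_open[OF assms])
    show "\<exists>y. (F has_real_derivative y) (at x) \<and> 0 < y" if "p < x" "x < q" for x
      using F h0_pos[OF that] by blast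
    show "continuous_on {p..q} F" using F DERIV_continuous_on has_field_derivative_at_within by blast
  qed
  define c where "c = inverse (F q - F p)"
  have c: "c > 0" "c * (F q - F p) = 1" using Fpq by (auto simp: c_def)
  have D: "((\<lambda>t. c * (F t - F p)) has_real_derivative c * h0 t) (at t)" for t
    by (auto intro!: derivative_eq_intros F)
  show ?thesis
  proof (rule that[of "\<lambda>t. c * (F t - F p)" "\<lambda>t. c * h0 t"])
    fix t
    show "((\<lambda>t. c * (F t - F p)) has_real_derivative c * h0 t) (at t)" by (rule D)
    show "t \<le> p \<Longrightarrow> c * (F t - F p) = 0" using Fp[of t] by simp
    show "q \<le> t \<Longrightarrow> c * (F t - F p) = 1" using Fq[of t] c by simp
    have "F p \<le> F t" "F t \<le> F q" using Fmono Fp Fq by (metis linear order_refl)+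
    then show "0 \<le> c * (F t - F p)" "c * (F t - F p) \<le> 1" 
      using c mult_left_mono[of "F t - F p" "F q - F p" c] by auto
    show "t \<notin> {p..q} \<Longrightarrow> c * h0 t = 0" using h0_zero[of t] by auto
  next
    fix j :: 'n
    have "smooth (\<lambda>x::real^'n. flat 1 (1 * x $ j + - p) *\<^sub>R flat 1 (- 1 * x $ j + q))"
      by (intro smooth_scaleR smooth_flat_coordinate)
    then have "smooth (\<lambda>x::real^'n. c * h0 (x $ j))"
      unfolding h0_def real_scaleR_def by (rule smooth_mult_left)
    then have "smooth (partial_deriv i (\<lambda>x::real^'n. c * (F (x $ j) - F p)))" for i
      unfolding partial_deriv_coordinate(2)[OF D] by (cases "i = j") simp_all
    then show "smooth (\<lambda>x::real^'n. c * (F (x $ j) - F p))"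
      by (rule smoothI[OF partial_deriv_coordinate(1)[OF D]])
  qed
qed

text \<open>The bump is the product, over all coordinates, of a rising step and one minus another
  rising step. These factors are already 0 at the midpoints \<open>m\<close> and \<open>M\<close>,
  strictly inside the open box, so the support is compact in it.\<close>

lemma smooth_bump_exists:
  fixes a a' b' b :: "real^'n"
  assumes "\<And>i. a $ i < a' $ i" "\<And>i. b' $ i < b $ i"
  obtains \<beta> :: "real^'n \<Rightarrow> real" where "\<beta> \<in> test_functions (box a b)" "\<And>x. 0 \<le> \<beta> x" "\<And>x. x \<in> cbox a' b' \<Longrightarrow> \<beta> x = 1"
proof -
  define m M where "m i = (a $ i + a' $ i) / 2" and "M i = (b' $ i + b $ i) / 2" for i
  have m: "a $ i < m i" "m i < a' $ i" and M: "b' $ i < M i" "M i < b $ i" for i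
    using assms[of i] by (auto simp: m_def M_def)
  have "\<forall>i. \<exists>H :: real \<Rightarrow> real. (\<forall>t\<le>m i. H t = 0) \<and> (\<forall>t\<ge>a' $ i. H t = 1) \<and> (\<forall>t. 0 \<le> H t) \<and> smooth (\<lambda>x::real^'n. H (x $ i))"
  proof (rule allI)
    fix i show "\<exists>H :: real \<Rightarrow> real. (\<forall>t\<le>m i. H t = 0) \<and> (\<forall>t\<ge>a' $ i. H t = 1) \<and> (\<forall>t. 0 \<le> H t) \<and> smooth (\<lambda>x::real^'n. H (x $ i))"
  proof (rule smooth_step_exists[OF m(2)[of i], where 'n='n], goal_cases)
    case (1 H h)
    show ?case by (rule exI[of _ H], intro conjI allI impI) (rule 1; assumption)+
  qed
  qed
  from choice[OF this] obtain H :: "'n \<Rightarrow> real \<Rightarrow> real" where H: "\<And>i t. t \<le> m i \<Longrightarrow> H i t = 0" "\<And>i t. a' $ i \<le> t \<Longrightarrow> H i t = 1" "\<And>i t. 0 \<le> H i t"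
    "\<And>i. smooth (\<lambda>x::real^'n. H i (x $ i))" by blast
  have "\<forall>i. \<exists>H :: real \<Rightarrow> real. (\<forall>t\<le>b' $ i. H t = 0) \<and> (\<forall>t\<ge>M i. H t = 1) \<and> (\<forall>t. H t \<le> 1) \<and> smooth (\<lambda>x::real^'n. H (x $ i))"
  proof (rule allI)
    fix i show "\<exists>H :: real \<Rightarrow> real. (\<forall>t\<le>b' $ i. H t = 0) \<and> (\<forall>t\<ge>M i. H t = 1) \<and> (\<forall>t. H t \<le> 1) \<and> smooth (\<lambda>x::real^'n. H (x $ i))"
  proof (rule smooth_step_exists[OF M(1)[of i], where 'n='n], goal_cases)
    case (1 H h)
    show ?case by (rule exI[of _ H], intro conjI allI impI) (rule 1; assumption)+
  qed
  qed
  from choice[OF this] obtain G :: "'n \<Rightarrow> real \<Rightarrow> real" where G: "\<And>i t. t \<le> b' $ i \<Longrightarrow> G i t = 0" "\<And>i t. M i \<le> t \<Longrightarrow> G i t = 1" "\<And>i t. G i t \<le> 1"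
    "\<And>i. smooth (\<lambda>x::real^'n. G i (x $ i))" by blast
  define \<beta> where "\<beta> x = (\<Prod>i\<in>UNIV. H i (x $ i) *\<^sub>R (1 - G i (x $ i)))" for x :: "real^'n"
  show ?thesis
  proof (rule that[of \<beta>])
    show "\<beta> \<in> test_functions (box a b)"
    proof (rule test_functionsI[where K = "cbox (\<chi> i. m i) (\<chi> i. M i)"])
      show "smooth \<beta>" unfolding \<beta>_def
        by (intro smooth_prod smooth_scaleR smooth_diff smooth_const H G)
      show "cbox (\<chi> i. m i) (\<chi> i. M i) \<subseteq> box a b"
        using less_le_trans[OF m(1)] le_less_trans[OF _ M(2)] by (auto simp: mem_box_cart subset_eq)
      fix x :: "real^'n" assume "x \<notin> cbox (\<chi> i. m i) (\<chi> i. M i)"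
      then obtain i where "x $ i < m i \<or> M i < x $ i" by (auto simp: mem_box_cart not_le)
      then have "H i (x $ i) *\<^sub>R (1 - G i (x $ i)) = 0" using H(1)[of "x $ i" i] G(2)[of i "x $ i"] by auto
      then have "\<exists>i\<in>UNIV. H i (x $ i) *\<^sub>R (1 - G i (x $ i)) = 0" by blast
      then show "\<beta> x = 0" unfolding \<beta>_def by (rule prod_zero[OF finite])
    qed auto
    show "0 \<le> \<beta> x" for x unfolding \<beta>_def by (intro prod_nonneg) (simp add: H(3) G(3))
    show "\<beta> x = 1" if "x \<in> cbox a' b'" for x
      unfolding \<beta>_def by (intro prod.neutral) (use that in \<open>simp add: mem_box_cart H(2) G(1)\<close>)
  qed
qed

text \<open>On a nonempty compact set each coordinate attains its extrema, which therefore stay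
  strictly inside the open box.\<close>

lemma compact_subset_box:
  fixes a b :: "real^'n"
  assumes "compact K" "K \<subseteq> box a b" "K \<noteq> {}"
  obtains a' b' where "K \<subseteq> cbox a' b'" "\<And>i. a $ i < a' $ i" "\<And>i. b' $ i < b $ i"
proof -
  have c: "continuous_on K (\<lambda>x. x $ i)" for i by (intro continuous_intros)
  have "\<exists>l. (\<forall>x\<in>K. l \<le> x $ i) \<and> a $ i < l" for i
    using continuous_attains_inf[OF assms(1,3) c[of i]] assms(2) by (fastforce simp: mem_box_cart)
  then obtain l where l: "\<And>i x. x \<in> K \<Longrightarrow> l i \<le> x $ i" "\<And>i. a $ i < l i" by metis
  have "\<exists>u. (\<forall>x\<in>K. x $ i \<le> u) \<and> u < b $ i" for i
    using continuous_attains_sup[OF assms(1,3) c[of i]] assms(2) by (fastforce simp: mem_box_cart)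
  then obtain u where u: "\<And>i x. x \<in> K \<Longrightarrow> x $ i \<le> u i" "\<And>i. u i < b $ i" by metis
  show ?thesis
    by (rule that[of "\<chi> i. l i" "\<chi> i. u i"]) (use l u in \<open>auto simp: mem_box_cart\<close>)
qed

section \<open>Continuous functionals on test functions\<close>

text \<open>The condition of \<open>distributions\<close> without extensionality: only the values on
  \<open>test_functions U\<close> matter, so functionals can be added, composed and restricted to
  smaller sets as plain functions.\<close>

definition distribution_on :: "(real^'n) set \<Rightarrow> ('n::finite, 'k::real_normed_field) functional \<Rightarrow> bool"
  where "distribution_on U u \<longleftrightarrow>
    (\<forall>\<phi>\<in>test_functions U. \<forall>\<psi>\<in>test_functions U. u (\<lambda>x. \<phi> x + \<psi> x) = u \<phi> + u \<psi>) \<and>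
    (\<forall>c. \<forall>\<phi>\<in>test_functions U. u (\<lambda>x. c * \<phi> x) = c * u \<phi>) \<and>
    (\<forall>K. compact K \<and> K \<subseteq> U \<longrightarrow>
      (\<exists>C N. \<forall>\<phi>\<in>test_functions U. supp \<phi> \<subseteq> K \<longrightarrow> norm (u \<phi>) \<le> C * seminorm N \<phi>))"

lemma distributions_iff: "u \<in> distributions U \<longleftrightarrow> u \<in> extensional (test_functions U) \<and> distribution_on U u"
  unfolding distributions_def distribution_on_def seminorm_def by simp

lemma distribution_onI:
  assumes "\<And>\<phi> \<psi>. \<lbrakk>\<phi> \<in> test_functions U; \<psi> \<in> test_functions U\<rbrakk> \<Longrightarrow> u (\<lambda>x. \<phi> x + \<psi> x) = u \<phi> + u \<psi>"
    and "\<And>c \<phi>. \<phi> \<in> test_functions U \<Longrightarrow> u (\<lambda>x. c * \<phi> x) = c * u \<phi>"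
    and "\<And>K. \<lbrakk>compact K; K \<subseteq> U\<rbrakk> \<Longrightarrow>
      \<exists>C N. \<forall>\<phi>\<in>test_functions U. supp \<phi> \<subseteq> K \<longrightarrow> norm (u \<phi>) \<le> C * seminorm N \<phi>"
  shows "distribution_on U u"
  using assms unfolding distribution_on_def by simp

context
  fixes U :: "(real^'n) set" and u :: "('n::finite, 'k::real_normed_field) functional"
  assumes u: "distribution_on U u"
begin

lemma distribution_on_add:
  "\<phi> \<in> test_functions U \<Longrightarrow> \<psi> \<in> test_functions U \<Longrightarrow> u (\<lambda>x. \<phi> x + \<psi> x) = u \<phi> + u \<psi>"
  using u unfolding distribution_on_def by blast

lemma distribution_on_mult: "\<phi> \<in> test_functions U \<Longrightarrow> u (\<lambda>x. c * \<phi> x) = c * u \<phi>"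
  using u unfolding distribution_on_def by blast

lemma distribution_on_zero: "u (\<lambda>x. 0) = 0"
  using distribution_on_mult[OF test_functions_zero, of 0] by simp

lemma distribution_on_diff:
  assumes "\<phi> \<in> test_functions U" "\<psi> \<in> test_functions U"
  shows "u (\<lambda>x. \<phi> x - \<psi> x) = u \<phi> - u \<psi>"
  using distribution_on_add[OF test_functions_diff[OF assms] assms(2)] by simp

lemma distribution_on_sum:
  "(\<And>i. i \<in> I \<Longrightarrow> \<phi> i \<in> test_functions U) \<Longrightarrow> u (\<lambda>x. \<Sum>i\<in>I. \<phi> i x) = (\<Sum>i\<in>I. u (\<phi> i))"
  by (induction I rule: infinite_finite_induct)
     (auto simp: distribution_on_zero distribution_on_add test_functions_sum)

lemma distribution_on_bound:
  assumes "compact K" "K \<subseteq> U"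
  obtains C N where "C \<ge> 0" "\<And>\<phi>. \<phi> \<in> test_functions U \<Longrightarrow> supp \<phi> \<subseteq> K \<Longrightarrow> norm (u \<phi>) \<le> C * seminorm N \<phi>"
proof -
  have "\<exists>C N. \<forall>\<phi>\<in>test_functions U. supp \<phi> \<subseteq> K \<longrightarrow> norm (u \<phi>) \<le> C * seminorm N \<phi>"
    using u assms unfolding distribution_on_def by simp
  then obtain C N where C: "\<And>\<phi>. \<phi> \<in> test_functions U \<Longrightarrow> supp \<phi> \<subseteq> K \<Longrightarrow> norm (u \<phi>) \<le> C * seminorm N \<phi>"
    by blast
  have "norm (u \<phi>) \<le> \<bar>C\<bar> * seminorm N \<phi>" if "\<phi> \<in> test_functions U" "supp \<phi> \<subseteq> K" for \<phi>
    by (rule order_trans[OF C[OF that]])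
       (intro mult_right_mono abs_ge_self seminorm_nonneg test_functionsD[OF that(1)])
  then show ?thesis by (intro that[of "\<bar>C\<bar>" N]) auto
qed

end

lemma distribution_on_zero_functional: "distribution_on U (\<lambda>\<phi>. 0)"
  by (rule distribution_onI) (auto intro!: exI[of _ 0])

text \<open>Transposition of a continuous linear map \<open>T\<close> between spaces of test
  functions. A common compact set for the supports of the images is asked for besides the seminorm
  bound, since the constant and the order of \<open>v\<close> depend on that compact set.\<close>

lemma distribution_on_compose:
  assumes v: "distribution_on V v"
    and T: "\<And>\<phi>. \<phi> \<in> test_functions U \<Longrightarrow> T \<phi> \<in> test_functions V"
    and add: "\<And>\<phi> \<psi>. \<lbrakk>\<phi> \<in> test_functions U; \<psi> \<in> test_functions U\<rbrakk> \<Longrightarrow> T (\<lambda>x. \<phi> x + \<psi> x) = (\<lambda>x. T \<phi> x + T \<psi> x)"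
    and mult: "\<And>c \<phi>. \<phi> \<in> test_functions U \<Longrightarrow> T (\<lambda>x. c * \<phi> x) = (\<lambda>x. c * T \<phi> x)"
    and supp: "\<And>K. \<lbrakk>compact K; K \<subseteq> U\<rbrakk> \<Longrightarrow>
       \<exists>K'. compact K' \<and> K' \<subseteq> V \<and> (\<forall>\<phi>\<in>test_functions U. supp \<phi> \<subseteq> K \<longrightarrow> supp (T \<phi>) \<subseteq> K')"
    and bound: "\<And>K N. \<lbrakk>compact K; K \<subseteq> U\<rbrakk> \<Longrightarrow>
       \<exists>C M. \<forall>\<phi>\<in>test_functions U. supp \<phi> \<subseteq> K \<longrightarrow> seminorm N (T \<phi>) \<le> C * seminorm M \<phi>"
  shows "distribution_on U (\<lambda>\<phi>. v (T \<phi>))"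
proof (rule distribution_onI)
  fix K assume K: "compact K" "K \<subseteq> U"
  obtain K' where K': "compact K'" "K' \<subseteq> V" "\<And>\<phi>. \<phi> \<in> test_functions U \<Longrightarrow> supp \<phi> \<subseteq> K \<Longrightarrow> supp (T \<phi>) \<subseteq> K'"
    using supp[OF K] by blast
  obtain C N where C: "C \<ge> 0" "\<And>\<phi>. \<phi> \<in> test_functions V \<Longrightarrow> supp \<phi> \<subseteq> K' \<Longrightarrow> norm (v \<phi>) \<le> C * seminorm N \<phi>"
    using distribution_on_bound[OF v K'(1,2)] by metis
  obtain D M where D: "\<And>\<phi>. \<phi> \<in> test_functions U \<Longrightarrow> supp \<phi> \<subseteq> K \<Longrightarrow> seminorm N (T \<phi>) \<le> D * seminorm M \<phi>"
    using bound[OF K, of N] by blast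
  have "norm (v (T \<phi>)) \<le> (C * D) * seminorm M \<phi>" if "\<phi> \<in> test_functions U" "supp \<phi> \<subseteq> K" for \<phi>
  proof -
    have "norm (v (T \<phi>)) \<le> C * seminorm N (T \<phi>)" using C(2) T K'(3) that by blast
    also have "\<dots> \<le> C * (D * seminorm M \<phi>)" using D[OF that] C(1) by (rule mult_left_mono)
    finally show ?thesis by (simp add: mult.assoc)
  qed
  then show "\<exists>C N. \<forall>\<phi>\<in>test_functions U. supp \<phi> \<subseteq> K \<longrightarrow> norm (v (T \<phi>)) \<le> C * seminorm N \<phi>" by blast
qed (simp_all add: add mult distribution_on_add[OF v] distribution_on_mult[OF v] T)

lemma distribution_on_add_functional:
  assumes u: "distribution_on U u" and v: "distribution_on U v"
  shows "distribution_on U (\<lambda>\<phi>. u \<phi> + v \<phi>)"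
proof (rule distribution_onI)
  fix K assume K: "compact K" "K \<subseteq> U"
  obtain C N where C: "C \<ge> 0" "\<And>\<phi>. \<phi> \<in> test_functions U \<Longrightarrow> supp \<phi> \<subseteq> K \<Longrightarrow> norm (u \<phi>) \<le> C * seminorm N \<phi>"
    using distribution_on_bound[OF u K] by metis
  obtain D M where D: "D \<ge> 0" "\<And>\<phi>. \<phi> \<in> test_functions U \<Longrightarrow> supp \<phi> \<subseteq> K \<Longrightarrow> norm (v \<phi>) \<le> D * seminorm M \<phi>"
    using distribution_on_bound[OF v K] by metis
  have "norm (u \<phi> + v \<phi>) \<le> (C + D) * seminorm (max N M) \<phi>" if \<phi>: "\<phi> \<in> test_functions U" "supp \<phi> \<subseteq> K" for \<phi>
  proof -
    have "C * seminorm N \<phi> \<le> C * seminorm (max N M) \<phi>" "D * seminorm M \<phi> \<le> D * seminorm (max N M) \<phi>"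
      using C(1) D(1) by (auto intro!: mult_left_mono seminorm_mono test_functionsD[OF \<phi>(1)])
    then show ?thesis using C(2)[OF \<phi>] D(2)[OF \<phi>] norm_triangle_ineq[of "u \<phi>" "v \<phi>"]
      unfolding distrib_right by linarith
  qed
  then show "\<exists>C N. \<forall>\<phi>\<in>test_functions U. supp \<phi> \<subseteq> K \<longrightarrow> norm (u \<phi> + v \<phi>) \<le> C * seminorm N \<phi>" by blast
qed (simp_all add: distribution_on_add[OF v] distribution_on_mult[OF v] distribution_on_add[OF u]
     distribution_on_mult[OF u] distrib_left)

lemma distribution_on_mult_functional:
  assumes u: "distribution_on U u"
  shows "distribution_on U (\<lambda>\<phi>. c * u \<phi>)"
proof (rule distribution_onI)
  fix K assume K: "compact K" "K \<subseteq> U"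
  obtain C N where C: "C \<ge> 0" "\<And>\<phi>. \<phi> \<in> test_functions U \<Longrightarrow> supp \<phi> \<subseteq> K \<Longrightarrow> norm (u \<phi>) \<le> C * seminorm N \<phi>"
    using distribution_on_bound[OF u K] by metis
  have "norm (c * u \<phi>) \<le> (norm c * C) * seminorm N \<phi>" if \<phi>: "\<phi> \<in> test_functions U" "supp \<phi> \<subseteq> K" for \<phi>
    using mult_left_mono[OF C(2)[OF \<phi>], of "norm c"] by (simp add: norm_mult mult.assoc)
  then show "\<exists>C N. \<forall>\<phi>\<in>test_functions U. supp \<phi> \<subseteq> K \<longrightarrow> norm (c * u \<phi>) \<le> C * seminorm N \<phi>" by blast
qed (simp_all add: distribution_on_add[OF u] distribution_on_mult[OF u] distrib_left)

lemma distribution_on_uminus_functional: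
  "distribution_on U u \<Longrightarrow> distribution_on U (\<lambda>\<phi>. - u \<phi>)"
  using distribution_on_mult_functional[of U u "-1"] by simp

lemma distribution_on_diff_functional:
  "distribution_on U u \<Longrightarrow> distribution_on U v \<Longrightarrow> distribution_on U (\<lambda>\<phi>. u \<phi> - v \<phi>)"
  using distribution_on_add_functional[OF _ distribution_on_uminus_functional, of U u v] by simp

lemma distribution_on_sum_functional:
  "(\<And>i. i \<in> I \<Longrightarrow> distribution_on U (u i)) \<Longrightarrow> distribution_on U (\<lambda>\<phi>. \<Sum>i\<in>I. u i \<phi>)"
  by (induction I rule: infinite_finite_induct)
     (auto intro: distribution_on_add_functional distribution_on_zero_functional)

lemma distribution_on_mono:
  assumes "distribution_on U u" "V \<subseteq> U"
  shows "distribution_on V u"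
proof (rule distribution_on_compose[where T = "\<lambda>\<phi>. \<phi>", OF assms(1)])
  fix K assume "compact K" "K \<subseteq> V"
  then show "\<exists>K'. compact K' \<and> K' \<subseteq> U \<and> (\<forall>\<phi>\<in>test_functions V. supp \<phi> \<subseteq> K \<longrightarrow> supp \<phi> \<subseteq> K')"
    using assms(2) by blast
  show "\<exists>C M. \<forall>\<phi>\<in>test_functions V. supp \<phi> \<subseteq> K \<longrightarrow> seminorm N \<phi> \<le> C * seminorm M \<phi>" for N
    by (intro exI[of _ 1] exI[of _ N]) simp
qed (use assms(2) test_functions_mono in auto)

lemma partial_deriv_mult_left:
  fixes f :: "real^'n \<Rightarrow> 'k::real_normed_field"
  shows "smooth f \<Longrightarrow> partial_deriv i (\<lambda>x. c * f x) = (\<lambda>x. c * partial_deriv i f x)"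
  by (rule partial_deriv_bounded_linear[OF bounded_linear_mult_right])

lemma distribution_on_partial_deriv:
  assumes u: "distribution_on U u"
  shows "distribution_on U (\<lambda>\<phi>. u (partial_deriv j \<phi>))"
proof (rule distribution_on_compose[where T = "partial_deriv j", OF u])
  fix K assume K: "compact K" "K \<subseteq> U"
  show "\<exists>K'. compact K' \<and> K' \<subseteq> U \<and> (\<forall>\<phi>\<in>test_functions U. supp \<phi> \<subseteq> K \<longrightarrow> supp (partial_deriv j \<phi>) \<subseteq> K')"
    using K supp_partial_deriv by blast
  show "\<exists>C M. \<forall>\<phi>\<in>test_functions U. supp \<phi> \<subseteq> K \<longrightarrow> seminorm N (partial_deriv j \<phi>) \<le> C * seminorm M \<phi>" for N
    by (intro exI[of _ 1] exI[of _ "Suc N"]) (simp add: seminorm_partial_deriv test_functionsD)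
qed (auto simp: partial_deriv_add partial_deriv_mult_left test_functionsD)

text \<open>As \<eta> has compact support in \<open>V\<close>, multiplication by it maps test
  functions on an arbitrary \<open>U\<close> to test functions on \<open>V\<close>. In the gluing
  this carries a local piece to the whole domain.\<close>

lemma distribution_on_scaleR:
  fixes \<eta> :: "real^'n \<Rightarrow> real" and u :: "('n::finite, 'k::{real_normed_field,euclidean_space}) functional"
  assumes u: "distribution_on V u" and \<eta>: "\<eta> \<in> test_functions V"
  shows "distribution_on U (\<lambda>\<phi>. u (\<lambda>x. \<eta> x *\<^sub>R \<phi> x))"
proof (rule distribution_on_compose[where T = "\<lambda>\<phi> x. \<eta> x *\<^sub>R \<phi> x", OF u])
  fix K assume K: "compact K" "K \<subseteq> U"
  show "\<exists>K'. compact K' \<and> K' \<subseteq> V \<and> (\<forall>\<phi> :: real^'n \<Rightarrow> 'k\<in>test_functions U. supp \<phi> \<subseteq> K \<longrightarrow> supp (\<lambda>x. \<eta> x *\<^sub>R \<phi> x) \<subseteq> K')"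
    using supp_scaleR(2)[of \<eta>] test_functionsD[OF \<eta>] by blast
  fix N
  obtain C where "\<And>f :: real^'n \<Rightarrow> 'k. smooth f \<Longrightarrow> supp f \<subseteq> K \<Longrightarrow>
    seminorm N (\<lambda>x. \<eta> x *\<^sub>R f x) \<le> C * seminorm N f"
    by (rule seminorm_scaleR[OF K(1) test_functionsD(1)[OF \<eta>]]) blast
  then show "\<exists>C M. \<forall>\<phi> :: real^'n \<Rightarrow> 'k\<in>test_functions U. supp \<phi> \<subseteq> K \<longrightarrow> seminorm N (\<lambda>x. \<eta> x *\<^sub>R \<phi> x) \<le> C * seminorm M \<phi>"
    using test_functionsD(1) by blast
qed (auto intro: test_functions_scaleR'[OF \<eta>] test_functionsD(1) simp: scaleR_add_right)

section \<open>The integral as a distribution with vanishing gradient\<close>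

lemma integral_UNIV_eq_cbox:
  fixes \<phi> :: "real^'n \<Rightarrow> 'k::euclidean_space"
  assumes "smooth \<phi>" "\<And>x. x \<notin> cbox c d \<Longrightarrow> \<phi> x = 0"
  shows "(\<phi> has_integral integral UNIV \<phi>) (cbox c d)" "(\<phi> has_integral integral UNIV \<phi>) UNIV"
    "integral UNIV \<phi> = integral (cbox c d) \<phi>"
proof -
  have 1: "(\<phi> has_integral integral (cbox c d) \<phi>) (cbox c d)"
    by (intro integrable_integral integrable_continuous smooth_continuous_on assms)
  then have 2: "(\<phi> has_integral integral (cbox c d) \<phi>) UNIV"
    by (rule has_integral_on_superset) (use assms in auto)
  then show "integral UNIV \<phi> = integral (cbox c d) \<phi>" by (rule integral_unique)
  then show "(\<phi> has_integral integral UNIV \<phi>) (cbox c d)" "(\<phi> has_integral integral UNIV \<phi>) UNIV"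
    using 1 2 by auto
qed

lemma compact_subset_cbox_cart:
  fixes K :: "(real^'n) set"
  assumes "compact K"
  obtains c d where "K \<subseteq> cbox c d"
  using bounded_subset_cbox_symmetric[OF compact_imp_bounded[OF assms]] by metis

lemma test_function_vanishes_off_cbox:
  assumes "\<phi> \<in> test_functions U"
  obtains c d where "\<And>x. x \<notin> cbox c d \<Longrightarrow> \<phi> x = 0"
  using compact_subset_cbox_cart[OF test_functionsD(2)[OF assms]] eq_0_if_notin_supp by (metis subsetD)

lemma test_function_has_integral:
  fixes \<phi> :: "real^'n \<Rightarrow> 'k::euclidean_space"
  assumes "\<phi> \<in> test_functions U"
  shows "(\<phi> has_integral integral UNIV \<phi>) UNIV"
  using test_function_vanishes_off_cbox[OF assms] integral_UNIV_eq_cbox(2)[OF test_functionsD(1)[OF assms]] by metis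

lemma distribution_on_integral:
  "distribution_on U (integral UNIV :: ('n::finite, 'k::{real_normed_field,euclidean_space}) functional)"
proof (rule distribution_onI)
  fix \<phi> \<psi> :: "real^'n \<Rightarrow> 'k" assume "\<phi> \<in> test_functions U" "\<psi> \<in> test_functions U"
  then show "integral UNIV (\<lambda>x. \<phi> x + \<psi> x) = integral UNIV \<phi> + integral UNIV \<psi>"
    by (intro integral_unique has_integral_add test_function_has_integral)
next
  fix c and \<phi> :: "real^'n \<Rightarrow> 'k" assume "\<phi> \<in> test_functions U"
  then show "integral UNIV (\<lambda>x. c * \<phi> x) = c * integral UNIV \<phi>"
    by (intro integral_unique has_integral_linear[OF _ bounded_linear_mult_right, unfolded o_def] test_function_has_integral)
next
  fix K :: "(real^'n) set" assume K: "compact K" "K \<subseteq> U"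
  obtain c d where cd: "K \<subseteq> cbox c d" using compact_subset_cbox_cart[OF K(1)] .
  have "norm (integral UNIV \<phi>) \<le> measure lborel (cbox c d) * seminorm 0 \<phi>" if \<phi>: "\<phi> \<in> test_functions U" "supp \<phi> \<subseteq> K"
    for \<phi> :: "real^'n \<Rightarrow> 'k"
  proof -
    note s = test_functionsD(1,2)[OF \<phi>(1)]
    have "(\<phi> has_integral integral UNIV \<phi>) (cbox c d)"
      using cd \<phi>(2) by (intro integral_UNIV_eq_cbox s eq_0_if_notin_supp) auto
    then have "norm (integral UNIV \<phi>) \<le> seminorm 0 \<phi> * measure lborel (cbox c d)"
      by (intro has_integral_bound[of _ \<phi>] seminorm_nonneg s norm_le_seminorm)
    then show ?thesis by (simp add: mult.commute)
  qed
  then show "\<exists>C N. \<forall>\<phi>::real^'n \<Rightarrow> 'k\<in>test_functions U. supp \<phi> \<subseteq> K \<longrightarrow> norm (integral UNIV \<phi>) \<le> C * seminorm N \<phi>" by blast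
qed

text \<open>The integral of a translate of \<phi> along the \<open>j\<close>-th axis does not depend
  on the shift; differentiating under the integral sign at shift 0 gives the claim without iterated
  integrals.\<close>

lemma integral_partial_deriv:
  fixes \<phi> :: "real^'n \<Rightarrow> 'k::euclidean_space"
  assumes \<phi>: "\<phi> \<in> test_functions U"
  shows "integral UNIV (partial_deriv j \<phi>) = 0"
proof -
  note s = test_functionsD(1)[OF \<phi>]
  obtain c d where cd: "\<And>x. x \<notin> cbox c d \<Longrightarrow> \<phi> x = 0" using test_function_vanishes_off_cbox[OF \<phi>] by metis
  \<comment> \<open>The box is enlarged by 1 on every side, so that it contains the support of each
    translate by less than 1.\<close>
  define C D where "C = c - (\<chi> i. 1)" and "D = d + (\<chi> i. 1)"
  have cdCD: "cbox c d \<subseteq> cbox (C + t *\<^sub>R axis j 1) (D + t *\<^sub>R axis j 1)" if "\<bar>t\<bar> < 1" for t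
  proof
    fix x assume x: "x \<in> cbox c d"
    have "c $ i - 1 + t * axis j 1 $ i \<le> x $ i \<and> x $ i \<le> d $ i + 1 + t * axis j 1 $ i" for i
      using x[unfolded mem_box_cart, rule_format, of i] that by (auto simp: axis_def)
    then show "x \<in> cbox (C + t *\<^sub>R axis j 1) (D + t *\<^sub>R axis j 1)"
      by (simp add: mem_box_cart C_def D_def)
  qed
  have cdCD0: "cbox c d \<subseteq> cbox C D" using cdCD[of 0] by simp
  have vanish: "partial_deriv j \<phi> x = 0" if "x \<notin> cbox C D" for x
  proof (rule eq_0_if_notin_supp)
    have "supp \<phi> \<subseteq> cbox c d" by (rule supp_subsetI) (use cd in auto)
    then show "x \<notin> supp (partial_deriv j \<phi>)" using supp_partial_deriv cdCD0 that by blast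
  qed
  define g where "g t = integral (cbox C D) (\<lambda>x. \<phi> (x + t *\<^sub>R axis j 1))" for t
  have g: "g t = integral UNIV \<phi>" if "\<bar>t\<bar> < 1" for t
  proof -
    have "g t = integral (cbox (C + t *\<^sub>R axis j 1) (D + t *\<^sub>R axis j 1)) \<phi>"
      using integral_shift_cbox_plus[of C D \<phi> "t *\<^sub>R axis j 1"] by (simp add: g_def o_def add.commute)
    also have "\<dots> = integral UNIV \<phi>"
      by (rule integral_UNIV_eq_cbox(3)[OF s, symmetric]) (use cd cdCD[OF that] in blast)
    finally show ?thesis .
  qed
  have "(g has_vector_derivative integral (cbox C D) (\<lambda>x. partial_deriv j \<phi> (x + 0 *\<^sub>R axis j 1))) (at 0 within UNIV)"
    unfolding g_def
  proof (rule leibniz_rule_vector_derivative)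
    fix t :: real and x
    show "((\<lambda>t. \<phi> (x + t *\<^sub>R axis j 1)) has_vector_derivative partial_deriv j \<phi> (x + t *\<^sub>R axis j 1)) (at t within UNIV)"
      using smooth_line_has_vector_derivative[OF s, of x 1 j t] by simp
    show "(\<lambda>x. \<phi> (x + t *\<^sub>R axis j 1)) integrable_on cbox C D"
      by (intro integrable_continuous continuous_on_compose2[OF smooth_continuous_on[OF s, of UNIV]] continuous_intros) auto
  next
    show "continuous_on (UNIV \<times> cbox C D) (\<lambda>(t, x). partial_deriv j \<phi> (x + t *\<^sub>R axis j 1))"
      unfolding split_beta
      by (intro continuous_on_compose2[OF smooth_continuous_on[OF smooth_partial_deriv[OF s], of UNIV]] continuous_intros) auto
  qed auto
  moreover have "(g has_vector_derivative 0) (at 0)"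
    by (rule has_vector_derivative_transform_within_open[OF has_vector_derivative_const[of "integral UNIV \<phi>"], of "{-1<..<1}"])
       (auto simp: g)
  ultimately have "integral (cbox C D) (partial_deriv j \<phi>) = 0"
    using vector_derivative_unique_at by fastforce
  then show ?thesis
    using integral_UNIV_eq_cbox(3)[OF smooth_partial_deriv[OF s] vanish] by simp
qed

text \<open>A nonnegative bump equal to 1 on a smaller box of positive volume is mapped into the
  scalar field by \<open>of_real\<close>.\<close>

lemma test_function_nonzero_integral:
  fixes a b :: "real^'n"
  assumes "\<And>i. a $ i < b $ i"
  obtains \<phi> :: "real^'n \<Rightarrow> 'k::{real_normed_field,euclidean_space}"
  where "\<phi> \<in> test_functions (box a b)" "integral UNIV \<phi> \<noteq> 0"
proof -
  define a' b' :: "real^'n" where "a' = (\<chi> i. (2 * a $ i + b $ i) / 3)" and "b' = (\<chi> i. (a $ i + 2 * b $ i) / 3)"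
  have ab: "a $ i < a' $ i" "a' $ i < b' $ i" "b' $ i < b $ i" for i
    using assms[of i] by (simp_all add: a'_def b'_def)
  obtain \<beta> :: "real^'n \<Rightarrow> real" where \<beta>: "\<beta> \<in> test_functions (box a b)" "\<And>x. 0 \<le> \<beta> x" "\<And>x. x \<in> cbox a' b' \<Longrightarrow> \<beta> x = 1"
    using smooth_bump_exists[OF ab(1,3)] by metis
  have "measure lborel (cbox a' b') \<le> integral UNIV \<beta>"
  proof (rule has_integral_subset_le)
    show "((\<lambda>x. \<beta> x) has_integral measure lborel (cbox a' b')) (cbox a' b')"
      by (rule has_integral_eq[OF _ has_integral_const[of "1::real", simplified]]) (simp add: \<beta>(3))
  qed (use \<beta> test_function_has_integral[OF \<beta>(1)] in auto)
  moreover have "0 < measure lborel (cbox a' b')"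
    using ab(2) by (auto simp: content_pos_lt_eq Basis_vec_def inner_axis)
  ultimately have pos: "0 < integral UNIV \<beta>" by linarith
  have "((\<lambda>x. of_real (\<beta> x) :: 'k) has_integral of_real (integral UNIV \<beta>)) UNIV"
    by (rule has_integral_linear[OF test_function_has_integral[OF \<beta>(1)] bounded_linear_of_real, unfolded o_def])
  then have "integral UNIV (\<lambda>x. of_real (\<beta> x) :: 'k) = of_real (integral UNIV \<beta>)" by (rule integral_unique)
  then show ?thesis
    using pos by (intro that[OF test_functions_bounded_linear[OF bounded_linear_of_real \<beta>(1)]]) simp
qed

section \<open>Distributions on a box\<close>

lemma seminorm_add:
  assumes "smooth f" "compact (supp f)" "smooth g" "compact (supp g)"
  shows "seminorm N (\<lambda>x. f x + g x) \<le> seminorm N f + seminorm N g"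
proof -
  have "norm (iterated_partial is (\<lambda>x. f x + g x) x) \<le>
      (SUP x. norm (iterated_partial is f x)) + (SUP x. norm (iterated_partial is g x))" for "is" x
    unfolding iterated_partial_add[OF assms(1,3)]
    by (intro norm_triangle_le add_mono cSUP_upper bdd_above_iterated_partial assms UNIV_I)
  then have "seminorm N (\<lambda>x. f x + g x) \<le>
      (\<Sum>is | length is \<le> N. (SUP x. norm (iterated_partial is f x)) + (SUP x. norm (iterated_partial is g x)))"
    by (intro seminorm_le)
  then show ?thesis by (simp add: seminorm_def sum.distrib)
qed

text \<open>The points \<open>x\<close> for which the segment from \<open>x\<close> to
  \<open>x + v\<close> meets \<open>K\<close>: elsewhere the average of a function supported in
  \<open>K\<close> vanishes.\<close>

definition segment_sweep :: "real^'n \<Rightarrow> (real^'n) set \<Rightarrow> (real^'n) set"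
  where "segment_sweep v K = (\<lambda>(x, t). x - t *\<^sub>R v) ` (K \<times> {0..1})"

lemma compact_segment_sweep: "compact K \<Longrightarrow> compact (segment_sweep v K)"
  unfolding segment_sweep_def split_beta
  by (intro compact_continuous_image continuous_intros compact_Times compact_Icc)

lemma segment_average_eq_0:
  assumes "\<And>t. t \<in> {0..1} \<Longrightarrow> f (x + t *\<^sub>R v) = 0"
  shows "segment_average v f x = 0"
proof -
  have "segment_average v f x = integral {0..1} (\<lambda>t::real. 0)"
    unfolding segment_average_def by (rule integral_cong) (rule assms)
  then show ?thesis by simp
qed

lemma supp_segment_average:
  assumes "compact K" "supp f \<subseteq> K"
  shows "supp (segment_average v f) \<subseteq> segment_sweep v K"
proof (rule supp_subsetI)
  show "closed (segment_sweep v K)" by (intro compact_imp_closed compact_segment_sweep assms)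
  fix x assume x: "x \<notin> segment_sweep v K"
  show "segment_average v f x = 0"
  proof (rule segment_average_eq_0, rule eq_0_if_notin_supp)
    fix t :: real assume t: "t \<in> {0..1}"
    show "x + t *\<^sub>R v \<notin> supp f"
    proof
      assume "x + t *\<^sub>R v \<in> supp f"
      then have "(\<lambda>(x, t). x - t *\<^sub>R v) (x + t *\<^sub>R v, t) \<in> segment_sweep v K"
        unfolding segment_sweep_def using t assms(2) by blast
      then show False using x by simp
    qed
  qed
qed

lemma segment_average_add:
  fixes f g :: "real^'n \<Rightarrow> 'k::euclidean_space"
  assumes "smooth f" "smooth g"
  shows "segment_average v (\<lambda>x. f x + g x) = (\<lambda>x. segment_average v f x + segment_average v g x)"
  unfolding segment_average_def by (intro ext integral_add smooth_integrable_segment assms)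

lemma segment_average_mult_left:
  fixes f :: "real^'n \<Rightarrow> 'k::{euclidean_space,real_normed_field}"
  assumes "smooth f"
  shows "segment_average v (\<lambda>x. c * f x) = (\<lambda>x. c * segment_average v f x)"
  unfolding segment_average_def 
  using integral_linear[OF smooth_integrable_segment[OF assms] bounded_linear_mult_right, unfolded o_def] by blast

definition coord_update :: "real^'n \<Rightarrow> 'n \<Rightarrow> real \<Rightarrow> real^'n"
  where "coord_update x j t = (\<chi> i. if i = j then t else x $ i)"

lemma coord_update_nth [simp]: "coord_update x j t $ i = (if i = j then t else x $ i)"
  by (simp add: coord_update_def)

lemma add_axis_eq_coord_update: "x + r *\<^sub>R axis j 1 = coord_update x j (x $ j + r)"
  by (simp add: vec_eq_iff axis_def)

text \<open>One primitive \<open>F\<close> along the coordinate line serves all \<open>r\<close> of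
  either sign, so that averages to the left and to the right can be combined by subtraction.\<close>

lemma segment_average_axis:
  fixes f :: "real^'n \<Rightarrow> 'k::euclidean_space"
  assumes f: "smooth f"
  obtains F where "\<And>t. (F has_vector_derivative f (coord_update x j t)) (at t)"
    "\<And>r. r *\<^sub>R segment_average (r *\<^sub>R axis j 1) f x = F (x $ j + r) - F (x $ j)"
proof -
  have line: "(\<lambda>t. f (coord_update x j t)) = (\<lambda>t. f (x + (t - x $ j) *\<^sub>R axis j 1))"
    by (simp add: add_axis_eq_coord_update)
  have "isCont (\<lambda>t. f (coord_update x j t)) t" for t
  proof -
    have "continuous_on UNIV (\<lambda>t. f (coord_update x j t))"
      unfolding line by (intro continuous_on_compose2[OF smooth_continuous_on[OF f, of UNIV]] continuous_intros) auto
    then show ?thesis by (simp add: continuous_on_eq_continuous_at)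
  qed
  then obtain F where F: "\<And>t. (F has_vector_derivative f (coord_update x j t)) (at t)"
    using einterval_antiderivative[of "-\<infinity>" "\<infinity>" "\<lambda>t. f (coord_update x j t)"] by auto
  have "r *\<^sub>R segment_average (r *\<^sub>R axis j 1) f x = F (x $ j + r) - F (x $ j)" for r
  proof -
    have "((\<lambda>s. r *\<^sub>R f (coord_update x j (x $ j + s * r))) has_integral F (x $ j + 1 * r) - F (x $ j + 0 * r)) {0..1}"
    proof (rule fundamental_theorem_of_calculus)
      fix s :: real
      have "((\<lambda>s. x $ j + s * r) has_vector_derivative r) (at s within {0..1})"
        by (auto intro!: derivative_eq_intros)
      from vector_diff_chain_within[OF this has_vector_derivative_at_within[OF F]]
      show "((\<lambda>s. F (x $ j + s * r)) has_vector_derivative r *\<^sub>R f (coord_update x j (x $ j + s * r))) (at s within {0..1})"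
        by (simp add: o_def)
    qed simp
    then show ?thesis
      unfolding segment_average_def by (simp add: add_axis_eq_coord_update integral_unique flip: integral_cmul)
  qed
  then show ?thesis using F that by blast
qed

text \<open>\<open>H i\<close> rises from 0 to 1 strictly inside the \<open>i\<close>-th side of the
  box. Its derivative \<open>h i\<close> therefore has integral 1; it is the fixed bump that
  replaces the dependence on a coordinate.\<close>

locale box_step =
  fixes a b p q :: "real^'n" and H h :: "'n \<Rightarrow> real \<Rightarrow> real"
  assumes order: "\<And>i. a $ i < p $ i" "\<And>i. p $ i < q $ i" "\<And>i. q $ i < b $ i"
    and H_deriv: "\<And>i t. (H i has_real_derivative h i t) (at t)"
    and H_0: "\<And>i t. t \<le> p $ i \<Longrightarrow> H i t = 0"
    and H_1: "\<And>i t. q $ i \<le> t \<Longrightarrow> H i t = 1"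
    and h_0: "\<And>i t. t \<notin> {p $ i..q $ i} \<Longrightarrow> h i t = 0"
    and smooth_H: "\<And>i. smooth (\<lambda>x::real^'n. H i (x $ i))"
begin

definition side :: "'n \<Rightarrow> real"
  where "side j = b $ j - a $ j"

text \<open>A move by one full side in either direction leads out of the box. For \<open>f\<close>
  supported in the box, the side length times the mean over such a segment from a point of the box
  is thus a one-sided line integral.\<close>

definition shift :: "'n \<Rightarrow> real^'n"
  where "shift j = side j *\<^sub>R axis j 1"

text \<open>For \<open>f\<close> supported in the box this is
  \<open>\<integral>\<^bsub>-\<infinity>\<^esub>\<^bsup>x\<^sub>j\<^esup> f - H\<^sub>j(x\<^sub>j) \<integral>\<^bsub>-\<infinity>\<^esub>\<^bsup>\<infinity>\<^esup> f\<close>, integrating along the \<open>j\<close>-th coordinate line through \<open>x\<close>. The cutoff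
  \<open>H\<^sub>j\<close> restores the compact support that the plain antiderivative lacks.\<close>

definition antideriv :: "'n \<Rightarrow> (real^'n \<Rightarrow> 'k::euclidean_space) \<Rightarrow> real^'n \<Rightarrow> 'k"
  where "antideriv j f = (\<lambda>x. (side j * (1 - H j (x $ j))) *\<^sub>R segment_average (- shift j) f x +
    (- side j * H j (x $ j)) *\<^sub>R segment_average (shift j) f x)"

lemma minus_shift: "- shift j = (- side j) *\<^sub>R axis j 1"
  by (simp only: shift_def scaleR_minus_left)

lemma side_pos: "0 < side j"
  using order[of j] unfolding side_def by linarith

lemma smooth_weights:
  "smooth (\<lambda>x::real^'n. side j * (1 - H j (x $ j)))" "smooth (\<lambda>x::real^'n. - side j * H j (x $ j))"
  by (intro smooth_mult_left smooth_diff smooth_const smooth_H)+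

lemma smooth_antideriv: "smooth f \<Longrightarrow> smooth (antideriv j f)"
  unfolding antideriv_def by (intro smooth_add smooth_scaleR smooth_weights smooth_segment_average)

text \<open>The definition is \<open>1 - H j\<close> times the integral to the left of
  \<open>x\<close> minus \<open>H j\<close> times the integral to the right. Left of
  \<open>a' $ j\<close> the weight \<open>H j\<close> is 0 and the left integral misses the support;
  right of \<open>b' $ j\<close> the roles are exchanged. If \<open>x\<close> leaves the closed box
  in another coordinate, the whole line misses the support.\<close>

lemma antideriv_eq_0:
  assumes f: "\<And>x. x \<notin> cbox a' b' \<Longrightarrow> f x = 0" and ab: "\<And>i. a' $ i \<le> p $ i" "\<And>i. q $ i \<le> b' $ i"
    and x: "x \<notin> cbox a' b'"
  shows "antideriv j f x = 0"
proof -
  obtain i where i: "x $ i < a' $ i \<or> b' $ i < x $ i" using x by (auto simp: mem_box_cart not_le)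
  have vanish: "f y = 0" if "y $ k < a' $ k \<or> b' $ k < y $ k" for y k
    using f[of y] that by (auto simp: mem_box_cart not_le)
  have comp: "(x + t *\<^sub>R v) $ k = x $ k + t * v $ k" for t v k by simp
  have R: "side j > 0" by (rule side_pos)
  have sh: "shift j $ k = (if k = j then side j else 0)" for k by (simp add: shift_def axis_def)
  show ?thesis
  proof (cases "i = j")
    case False
    then have "segment_average (shift j) f x = 0" "segment_average (- shift j) f x = 0"
      using i by (auto intro!: segment_average_eq_0 vanish[of _ i] simp: sh)
    then show ?thesis by (simp add: antideriv_def)
  next
    case True
    then consider "x $ j < a' $ j" | "b' $ j < x $ j" using i by blast
    then show ?thesis
    proof cases
      case 1
      then have "H j (x $ j) = 0" using ab(1)[of j] by (intro H_0) linarith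
      moreover have "segment_average (- shift j) f x = 0"
      proof (intro segment_average_eq_0 vanish disjI1)
        fix t :: real assume "t \<in> {0..1}"
        then have "0 \<le> t * side j" using R by simp
        then show "(x + t *\<^sub>R - shift j) $ j < a' $ j" using 1 by (simp add: sh)
      qed
      ultimately show ?thesis by (simp add: antideriv_def)
    next
      case 2
      then have "H j (x $ j) = 1" using ab(2)[of j] by (intro H_1) linarith
      moreover have "segment_average (shift j) f x = 0"
      proof (intro segment_average_eq_0 vanish disjI2)
        fix t :: real assume "t \<in> {0..1}"
        then have "0 \<le> t * side j" using R by simp
        then show "b' $ j < (x + t *\<^sub>R shift j) $ j" using 2 by (simp add: sh)
      qed
      ultimately show ?thesis by (simp add: antideriv_def)
    qed
  qed
qed

text \<open>\<open>p\<close> and \<open>q\<close> are added to \<open>K\<close> so that the closed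
  box found around it contains the transition zones of the steps, as \<open>antideriv_eq_0\<close>
  requires.\<close>

lemma supp_antideriv:
  assumes "compact K" "K \<subseteq> box a b"
  obtains K' where "compact K'" "K' \<subseteq> box a b"
    "\<And>f :: real^'n \<Rightarrow> 'k::euclidean_space. supp f \<subseteq> K \<Longrightarrow> (\<forall>x. x \<notin> K' \<longrightarrow> antideriv j f x = 0)"
proof -
  have "compact (K \<union> {p, q})" using assms(1) by (intro compact_Un) auto
  moreover have "p \<in> box a b" "q \<in> box a b"
    using order less_trans[OF order(1) order(2)] less_trans[OF order(2) order(3)] by (auto simp: mem_box_cart)
  ultimately obtain a' b' where K: "K \<union> {p, q} \<subseteq> cbox a' b'" and ab: "\<And>i. a $ i < a' $ i" "\<And>i. b' $ i < b $ i"
    using compact_subset_box[of "K \<union> {p, q}" a b] assms(2) by blast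
  show ?thesis
  proof (rule that[of "cbox a' b'"])
    show "cbox a' b' \<subseteq> box a b"
      using less_le_trans[OF ab(1)] le_less_trans[OF _ ab(2)] by (auto simp: mem_box_cart subset_eq)
    fix f :: "real^'n \<Rightarrow> 'k" assume "supp f \<subseteq> K"
    then have "f x = 0" if "x \<notin> cbox a' b'" for x
      using that K by (intro eq_0_if_notin_supp) auto
    then show "\<forall>x. x \<notin> cbox a' b' \<longrightarrow> antideriv j f x = 0"
      using antideriv_eq_0[of a' b' f] K by (auto simp: mem_box_cart)
  qed auto
qed

lemma test_functions_antideriv:
  fixes f :: "real^'n \<Rightarrow> 'k::euclidean_space"
  assumes "f \<in> test_functions (box a b)"
  shows "antideriv j f \<in> test_functions (box a b)"
proof -
  note f = test_functionsD[OF assms]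
  obtain K' where "compact K'" "K' \<subseteq> box a b" "\<forall>x. x \<notin> K' \<longrightarrow> antideriv j f x = 0"
    by (rule supp_antideriv[OF f(2,3), where 'k='k]) blast
  then show ?thesis using f(1) by (intro test_functionsI[of _ K'] smooth_antideriv) auto
qed

text \<open>The weights have no compact support, so \<open>seminorm_scaleR\<close> is applied on the
  swept sets, which are compact and contain the supports of the averages.\<close>

lemma seminorm_antideriv:
  assumes K: "compact K"
  obtains C where "\<And>f :: real^'n \<Rightarrow> 'k::euclidean_space. smooth f \<Longrightarrow> supp f \<subseteq> K \<Longrightarrow>
    seminorm N (antideriv j f) \<le> C * seminorm N f"
proof -
  obtain C where C: "C \<ge> 0" "\<And>f :: real^'n \<Rightarrow> 'k. smooth f \<Longrightarrow> supp f \<subseteq> segment_sweep (- shift j) K \<Longrightarrow>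
    seminorm N (\<lambda>x. (side j * (1 - H j (x $ j))) *\<^sub>R f x) \<le> C * seminorm N f"
    by (rule seminorm_scaleR[OF compact_segment_sweep[OF K] smooth_weights(1)]) blast
  obtain D where D: "D \<ge> 0" "\<And>f :: real^'n \<Rightarrow> 'k. smooth f \<Longrightarrow> supp f \<subseteq> segment_sweep (shift j) K \<Longrightarrow>
    seminorm N (\<lambda>x. (- side j * H j (x $ j)) *\<^sub>R f x) \<le> D * seminorm N f"
    by (rule seminorm_scaleR[OF compact_segment_sweep[OF K] smooth_weights(2)]) blast
  have "seminorm N (antideriv j f) \<le> (C + D) * seminorm N f" if f: "smooth f" "supp f \<subseteq> K" for f :: "real^'n \<Rightarrow> 'k"
  proof -
    have cf: "compact (supp f)" using compact_Int_closed[OF K closed_supp[of f]] f by (simp add: Int_absorb1)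
    have sub: "supp (segment_average v f) \<subseteq> segment_sweep v K" for v by (rule supp_segment_average[OF K f(2)])
    have c: "compact (supp (\<lambda>x. m x *\<^sub>R segment_average v f x))" for v m
      using compact_Int_closed[OF compact_segment_sweep[OF K, of v] closed_supp[of "\<lambda>x. m x *\<^sub>R segment_average v f x"]]
        order_trans[OF supp_scaleR(1) sub, of m v] by (simp add: Int_absorb1)
    have sav: "smooth (segment_average v f)" for v by (rule smooth_segment_average[OF f(1)])
    have "seminorm N (antideriv j f) \<le>
        seminorm N (\<lambda>x. (side j * (1 - H j (x $ j))) *\<^sub>R segment_average (- shift j) f x) +
        seminorm N (\<lambda>x. (- side j * H j (x $ j)) *\<^sub>R segment_average (shift j) f x)"
      unfolding antideriv_def by (intro seminorm_add c smooth_scaleR smooth_weights sav)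
    also have "\<dots> \<le> C * seminorm N (segment_average (- shift j) f) + D * seminorm N (segment_average (shift j) f)"
      by (intro add_mono C(2) D(2) sav sub)
    also have "\<dots> \<le> C * seminorm N f + D * seminorm N f"
      by (intro add_mono mult_left_mono seminorm_segment_average f(1) cf C(1) D(1))
    finally show ?thesis by (simp add: distrib_right)
  qed
  then show ?thesis by (rule that)
qed

lemma distribution_on_antideriv:
  fixes u :: "('n, 'k::{real_normed_field,euclidean_space}) functional"
  assumes u: "distribution_on (box a b) u"
  shows "distribution_on (box a b) (\<lambda>\<phi>. u (antideriv j \<phi>))"
proof (rule distribution_on_compose[where T = "antideriv j", OF u])
  fix K :: "(real^'n) set" assume K: "compact K" "K \<subseteq> box a b"
  obtain K' where K': "compact K'" "K' \<subseteq> box a b"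
    "\<And>f :: real^'n \<Rightarrow> 'k. supp f \<subseteq> K \<Longrightarrow> (\<forall>x. x \<notin> K' \<longrightarrow> antideriv j f x = 0)"
    by (rule supp_antideriv[OF K, where 'k='k]) blast
  have "supp (antideriv j f) \<subseteq> K'" if "supp f \<subseteq> K" for f :: "real^'n \<Rightarrow> 'k"
    using K'(3)[OF that] by (intro supp_subsetI compact_imp_closed K'(1)) auto
  then show "\<exists>K'. compact K' \<and> K' \<subseteq> box a b \<and>
      (\<forall>\<phi> :: real^'n \<Rightarrow> 'k\<in>test_functions (box a b). supp \<phi> \<subseteq> K \<longrightarrow> supp (antideriv j \<phi>) \<subseteq> K')"
    using K'(1,2) by blast
  fix N
  obtain C where "\<And>f :: real^'n \<Rightarrow> 'k. smooth f \<Longrightarrow> supp f \<subseteq> K \<Longrightarrow> seminorm N (antideriv j f) \<le> C * seminorm N f"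
    by (rule seminorm_antideriv[OF K(1), where 'k='k]) blast
  then show "\<exists>C M. \<forall>\<phi> :: real^'n \<Rightarrow> 'k\<in>test_functions (box a b). supp \<phi> \<subseteq> K \<longrightarrow>
      seminorm N (antideriv j \<phi>) \<le> C * seminorm M \<phi>"
    using test_functionsD(1) by blast
next
  fix \<phi> \<psi> :: "real^'n \<Rightarrow> 'k" assume "\<phi> \<in> test_functions (box a b)" "\<psi> \<in> test_functions (box a b)"
  then have s: "smooth \<phi>" "smooth \<psi>" by (auto dest: test_functionsD(1))
  show "antideriv j (\<lambda>x. \<phi> x + \<psi> x) = (\<lambda>x. antideriv j \<phi> x + antideriv j \<psi> x)"
    by (simp only: antideriv_def segment_average_add[OF s] scaleR_add_right add_ac)
next
  fix c and \<phi> :: "real^'n \<Rightarrow> 'k" assume "\<phi> \<in> test_functions (box a b)"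
  then have s: "smooth \<phi>" by (rule test_functionsD(1))
  show "antideriv j (\<lambda>x. c * \<phi> x) = (\<lambda>x. c * antideriv j \<phi> x)"
    by (simp add: antideriv_def segment_average_mult_left[OF s] right_diff_distrib)
qed (rule test_functions_antideriv)

text \<open>The fundamental theorem leaves the values of \<open>f\<close> at
  \<open>x + shift j\<close> and \<open>x - shift j\<close> besides \<open>f x\<close>. The first is
  nonzero only if \<open>x $ j < a $ j\<close>, where \<open>H j\<close> is 0; the second only if
  \<open>b $ j < x $ j\<close>, where \<open>1 - H j\<close> is 0.\<close>

lemma antideriv_partial_deriv:
  fixes f :: "real^'n \<Rightarrow> 'k::euclidean_space"
  assumes f: "f \<in> test_functions (box a b)"
  shows "antideriv j (partial_deriv j f) = f"
proof
  fix x
  note s = test_functionsD(1)[OF f]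
  let ?R = "side j"
  have vanish: "f y = 0" if "y \<notin> box a b" for y
    using test_functionsD(3)[OF f] that by (intro eq_0_if_notin_supp) auto
  have plus: "?R *\<^sub>R segment_average (shift j) (partial_deriv j f) x = f (x + shift j) - f x"
    unfolding shift_def by (rule segment_average_partial_deriv[OF s])
  have "(- ?R) *\<^sub>R segment_average (- shift j) (partial_deriv j f) x = f (x + - shift j) - f x"
    unfolding minus_shift by (rule segment_average_partial_deriv[OF s])
  then have minus: "?R *\<^sub>R segment_average (- shift j) (partial_deriv j f) x = f x - f (x - shift j)"
    by (simp add: minus_equation_iff[of "side j *\<^sub>R _"])
  have "H j (x $ j) *\<^sub>R f (x + shift j) = 0"
  proof (cases "x + shift j \<in> box a b")
    case True
    then have "x $ j + ?R < b $ j" using vector_add_component[of x "shift j" j] by (auto simp: mem_box_cart shift_def dest: spec[of _ j])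
    then have "H j (x $ j) = 0" using order(1)[of j] unfolding side_def by (intro H_0) linarith
    then show ?thesis by simp
  qed (simp add: vanish)
  moreover have "(1 - H j (x $ j)) *\<^sub>R f (x - shift j) = 0"
  proof (cases "x - shift j \<in> box a b")
    case True
    then have "a $ j < x $ j - ?R" using vector_minus_component[of x "shift j" j] by (auto simp: mem_box_cart shift_def dest: spec[of _ j])
    then have "H j (x $ j) = 1" using order(3)[of j] unfolding side_def by (intro H_1) linarith
    then show ?thesis by simp
  qed (simp add: vanish)
  moreover have "antideriv j (partial_deriv j f) x = 
      (1 - H j (x $ j)) *\<^sub>R (?R *\<^sub>R segment_average (- shift j) (partial_deriv j f) x) -
      H j (x $ j) *\<^sub>R (?R *\<^sub>R segment_average (shift j) (partial_deriv j f) x)"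
    by (simp add: antideriv_def mult.commute)
  ultimately show "antideriv j (partial_deriv j f) x = f x"
    unfolding plus minus by (simp add: scaleR_diff_right scaleR_diff_left)
qed

lemma partial_deriv_weights:
  "partial_deriv i (\<lambda>x::real^'n. side j * (1 - H j (x $ j))) =
     (\<lambda>x. if i = j then - side j * h j (x $ j) else 0)"
  "partial_deriv i (\<lambda>x::real^'n. - side j * H j (x $ j)) =
     (\<lambda>x. if i = j then - side j * h j (x $ j) else 0)"
proof -
  have D: "((\<lambda>t. side j * (1 - H j t)) has_real_derivative - side j * h j t) (at t)"
    "((\<lambda>t. - side j * H j t) has_real_derivative - side j * h j t) (at t)" for t
    by (auto intro!: derivative_eq_intros H_deriv)
  show "partial_deriv i (\<lambda>x::real^'n. side j * (1 - H j (x $ j))) =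
     (\<lambda>x. if i = j then - side j * h j (x $ j) else 0)"
    by (rule partial_deriv_coordinate(2)[OF D(1)])
  show "partial_deriv i (\<lambda>x::real^'n. - side j * H j (x $ j)) =
     (\<lambda>x. if i = j then - side j * h j (x $ j) else 0)"
    by (rule partial_deriv_coordinate(2)[OF D(2)])
qed

text \<open>The weights depend on the \<open>j\<close>-th coordinate alone and have equal
  derivatives there, so the product rule adds the same multiple of both averages for
  \<open>i = j\<close> and nothing in the other directions.\<close>

lemma partial_deriv_antideriv:
  fixes f :: "real^'n \<Rightarrow> 'k::euclidean_space"
  assumes f: "smooth f"
  shows "partial_deriv i (antideriv j f) = (\<lambda>x. antideriv j (partial_deriv i f) x -
    (if i = j then side j * h j (x $ j) else 0) *\<^sub>R
      (segment_average (- shift j) f x + segment_average (shift j) f x))"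
proof -
  note sav = smooth_segment_average[OF f]
  have "partial_deriv i (antideriv j f) = (\<lambda>x.
      ((if i = j then - side j * h j (x $ j) else 0) *\<^sub>R segment_average (- shift j) f x +
       (side j * (1 - H j (x $ j))) *\<^sub>R segment_average (- shift j) (partial_deriv i f) x) +
      ((if i = j then - side j * h j (x $ j) else 0) *\<^sub>R segment_average (shift j) f x +
       (- side j * H j (x $ j)) *\<^sub>R segment_average (shift j) (partial_deriv i f) x))"
    unfolding antideriv_def
      partial_deriv_add[OF smooth_scaleR[OF smooth_weights(1) sav] smooth_scaleR[OF smooth_weights(2) sav]]
      partial_deriv_scaleR[OF smooth_weights(1) sav] partial_deriv_scaleR[OF smooth_weights(2) sav]
      partial_deriv_weights partial_deriv_segment_average[OF f] ..
  then show ?thesis unfolding antideriv_def by (auto simp: fun_eq_iff scaleR_add_right)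
qed

definition line_integral :: "'n \<Rightarrow> (real^'n \<Rightarrow> 'k::euclidean_space) \<Rightarrow> real^'n \<Rightarrow> 'k"
  where "line_integral j f x = integral {a $ j..b $ j} (\<lambda>t. f (coord_update x j t))"

text \<open>The two averages combine to the integral from one side length before
  \<open>x $ j\<close> to one side length after it. Where \<open>h j\<close> is nonzero,
  \<open>x $ j\<close> lies between \<open>a $ j\<close> and \<open>b $ j\<close>, so this interval
  contains the whole side, and \<open>f\<close> vanishes on the rest.\<close>

lemma diff_partial_deriv_antideriv:
  fixes f :: "real^'n \<Rightarrow> 'k::euclidean_space"
  assumes f: "f \<in> test_functions (box a b)"
  shows "f x - partial_deriv j (antideriv j f) x = h j (x $ j) *\<^sub>R line_integral j f x"
proof -
  note s = test_functionsD(1)[OF f]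
  let ?R = "side j"
  have vanish: "f y = 0" if "y \<notin> box a b" for y
    using test_functionsD(3)[OF f] that by (intro eq_0_if_notin_supp) auto
  obtain F where F: "\<And>t. (F has_vector_derivative f (coord_update x j t)) (at t)"
    "\<And>r. r *\<^sub>R segment_average (r *\<^sub>R axis j 1) f x = F (x $ j + r) - F (x $ j)"
    by (rule segment_average_axis[OF s, of x j]) blast
  have plus: "?R *\<^sub>R segment_average (shift j) f x = F (x $ j + ?R) - F (x $ j)"
    using F(2)[of ?R] by (simp add: shift_def)
  have "(- ?R) *\<^sub>R segment_average (- shift j) f x = F (x $ j + - ?R) - F (x $ j)"
    unfolding minus_shift by (rule F(2))
  then have minus: "?R *\<^sub>R segment_average (- shift j) f x = F (x $ j) - F (x $ j - ?R)"
    by (simp add: minus_equation_iff[of "side j *\<^sub>R _"])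
  have "f x - partial_deriv j (antideriv j f) x = (h j (x $ j) * ?R) *\<^sub>R
      (segment_average (- shift j) f x + segment_average (shift j) f x)"
    by (simp add: partial_deriv_antideriv[OF s] antideriv_partial_deriv[OF f] mult.commute)
  also have "\<dots> = h j (x $ j) *\<^sub>R (?R *\<^sub>R segment_average (- shift j) f x + ?R *\<^sub>R segment_average (shift j) f x)"
    by (simp add: scaleR_add_right)
  also have "\<dots> = h j (x $ j) *\<^sub>R (F (x $ j + ?R) - F (x $ j - ?R))"
    unfolding plus minus by simp
  also have "\<dots> = h j (x $ j) *\<^sub>R line_integral j f x"
  proof (cases "x $ j \<in> {p $ j..q $ j}")
    case True
    have "((\<lambda>t. f (coord_update x j t)) has_integral F (b $ j) - F (a $ j)) {a $ j..b $ j}"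
      by (rule fundamental_theorem_of_calculus[where f = F], use side_pos[of j] in \<open>simp add: side_def\<close>)
         (rule has_vector_derivative_at_within[OF F(1)])
    then have "(\<lambda>t. f (coord_update x j t)) integrable_on {a $ j..b $ j}" by (rule has_integral_integrable)
    then have "((\<lambda>t. f (coord_update x j t)) has_integral line_integral j f x) {a $ j..b $ j}"
      unfolding line_integral_def by (rule integrable_integral)
    then have 1: "((\<lambda>t. f (coord_update x j t)) has_integral line_integral j f x) {x $ j - ?R..x $ j + ?R}"
    proof (rule has_integral_on_superset)
      show "{a $ j..b $ j} \<subseteq> {x $ j - ?R..x $ j + ?R}" using True order[of j] by (auto simp: side_def)
      fix t assume "t \<notin> {a $ j..b $ j}"
      then have "\<not> (a $ j < coord_update x j t $ j \<and> coord_update x j t $ j < b $ j)" by auto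
      then have "coord_update x j t \<notin> box a b" unfolding mem_box_cart by blast
      then show "f (coord_update x j t) = 0" by (rule vanish)
    qed
    have 2: "((\<lambda>t. f (coord_update x j t)) has_integral F (x $ j + ?R) - F (x $ j - ?R)) {x $ j - ?R..x $ j + ?R}"
      by (rule fundamental_theorem_of_calculus[where f = F], use side_pos[of j] in \<open>simp add: side_def\<close>)
         (rule has_vector_derivative_at_within[OF F(1)])
    show ?thesis by (simp only: has_integral_unique[OF 1 2])
  qed (simp add: h_0)
  finally show ?thesis .
qed

end

definition locally_constant_distribution :: "(real^'n) set \<Rightarrow> ('n::finite, 'k::real_normed_field) functional \<Rightarrow> bool"
  where "locally_constant_distribution U u \<longleftrightarrow>
    distribution_on U u \<and> (\<forall>j. \<forall>\<phi>\<in>test_functions U. u (partial_deriv j \<phi>) = 0)"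

lemma locally_constant_distribution_integral:
  "locally_constant_distribution U (integral UNIV :: ('n::finite, 'k::{real_normed_field,euclidean_space}) functional)"
  unfolding locally_constant_distribution_def using distribution_on_integral integral_partial_deriv by blast

context box_step
begin

text \<open>Each coordinate of \<open>S\<close> is treated by subtracting a derivative, which no
  \<open>F\<close> with vanishing gradient sees. The same \<phi>' serves all such \<open>F\<close>,
  so that two of them can be compared on it.\<close>

lemma integrate_out_coordinates:
  fixes \<phi> :: "real^'n \<Rightarrow> 'k::{real_normed_field,euclidean_space}"
  assumes \<phi>: "\<phi> \<in> test_functions (box a b)"
  shows "\<exists>\<phi>' m. \<phi>' \<in> test_functions (box a b) \<and>
    (\<forall>F. locally_constant_distribution (box a b) F \<longrightarrow> F \<phi>' = F \<phi>) \<and>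
    (\<forall>x. \<phi>' x = (\<Prod>i\<in>S. h i (x $ i)) *\<^sub>R m x) \<and>
    (\<forall>x y. (\<forall>i. i \<notin> S \<longrightarrow> x $ i = y $ i) \<longrightarrow> m x = m y)"
proof (induction S rule: finite_induct[OF finite])
  case 1
  show ?case by (rule exI[of _ \<phi>], rule exI[of _ \<phi>]) (auto simp: \<phi> vec_eq_iff[symmetric])
next
  case (2 j S)
  then obtain \<phi>' m where \<phi>': "\<phi>' \<in> test_functions (box a b)"
    and F: "\<And>F. locally_constant_distribution (box a b) F \<Longrightarrow> F \<phi>' = F \<phi>"
    and m: "\<And>x. \<phi>' x = (\<Prod>i\<in>S. h i (x $ i)) *\<^sub>R m x" "\<And>x y. (\<And>i. i \<notin> S \<Longrightarrow> x $ i = y $ i) \<Longrightarrow> m x = m y"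
    by blast
  define \<phi>'' where "\<phi>'' x = \<phi>' x - partial_deriv j (antideriv j \<phi>') x" for x
  define m' where "m' x = integral {a $ j..b $ j} (\<lambda>t. m (coord_update x j t))" for x
  have A: "antideriv j \<phi>' \<in> test_functions (box a b)" by (rule test_functions_antideriv[OF \<phi>'])
  have "\<phi>'' \<in> test_functions (box a b)"
    unfolding \<phi>''_def by (intro test_functions_diff test_functions_partial_deriv \<phi>' A)
  moreover have "F \<phi>'' = F \<phi>" if "locally_constant_distribution (box a b) F" for F
  proof -
    have "F \<phi>'' = F \<phi>' - F (partial_deriv j (antideriv j \<phi>'))"
      using that unfolding \<phi>''_def locally_constant_distribution_def
      by (intro distribution_on_diff[of "box a b"] \<phi>' test_functions_partial_deriv A) simp
    then show ?thesis using that A F[OF that] unfolding locally_constant_distribution_def by simp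
  qed
  moreover have "\<phi>'' x = (\<Prod>i\<in>insert j S. h i (x $ i)) *\<^sub>R m' x" for x
  proof -
    \<comment> \<open>As \<open>j\<close> is not in \<open>S\<close>, the product is constant along
      the \<open>j\<close>-th line and leaves the integral; the new factor \<open>h j\<close> comes
      from \<open>diff_partial_deriv_antideriv\<close>.\<close>
    have "(\<Prod>i\<in>S. h i (coord_update x j t $ i)) = (\<Prod>i\<in>S. h i (x $ i))" for t
      using 2(2) by (intro prod.cong) auto
    then have "line_integral j \<phi>' x = (\<Prod>i\<in>S. h i (x $ i)) *\<^sub>R m' x"
      by (simp only: line_integral_def m(1) m'_def integral_cmul)
    then show ?thesis
      unfolding \<phi>''_def diff_partial_deriv_antideriv[OF \<phi>'] using 2(1,2) by simp
  qed
  moreover have "m' x = m' y" if "\<forall>i. i \<notin> insert j S \<longrightarrow> x $ i = y $ i" for x y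
  proof -
    have "m (coord_update x j t) = m (coord_update y j t)" for t using that by (intro m(2)) auto
    then show ?thesis by (simp add: m'_def)
  qed
  ultimately show ?case by blast
qed

text \<open>With all coordinates integrated out, both test functions become multiples
  \<open>c\<close> and \<open>c0\<close> of the same product of bumps, so
  \<open>c0 * \<psi> = c * \<psi>0\<close>. Applying \<open>F\<close> and \<open>I\<close> gives the
  ratio; \<open>c0 \<noteq> 0\<close> because \<open>I \<phi>0 \<noteq> 0\<close>.\<close>

lemma locally_constant_proportional:
  fixes F I :: "('n, 'k::{real_normed_field,euclidean_space}) functional"
  assumes F: "locally_constant_distribution (box a b) F" and I: "locally_constant_distribution (box a b) I"
    and \<phi>: "\<phi> \<in> test_functions (box a b)" and \<phi>0: "\<phi>0 \<in> test_functions (box a b)" "I \<phi>0 \<noteq> 0"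
  shows "F \<phi> = F \<phi>0 / I \<phi>0 * I \<phi>"
proof -
  let ?w = "\<lambda>x. \<Prod>i\<in>UNIV. h i (x $ i)"
  have "\<exists>\<psi>' c. \<psi>' \<in> test_functions (box a b) \<and> F \<psi>' = F \<psi> \<and> I \<psi>' = I \<psi> \<and> (\<forall>x. \<psi>' x = ?w x *\<^sub>R c)"
    if \<psi>: "\<psi> \<in> test_functions (box a b)" for \<psi>
  proof -
    obtain \<psi>' m where *: "\<psi>' \<in> test_functions (box a b)"
      "\<And>F. locally_constant_distribution (box a b) F \<Longrightarrow> F \<psi>' = F \<psi>" "\<And>x. \<psi>' x = ?w x *\<^sub>R m x" "\<And>x y. m x = m y"
      using integrate_out_coordinates[OF \<psi>, of UNIV] by auto
    have "\<psi>' x = ?w x *\<^sub>R m 0" for x by (simp only: *(3) *(4)[of x 0])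
    then show ?thesis using *(1,2) F I by blast
  qed
  note reduce = this
  obtain \<psi> c where \<psi>: "\<psi> \<in> test_functions (box a b)" "F \<psi> = F \<phi>" "I \<psi> = I \<phi>" "\<And>x. \<psi> x = ?w x *\<^sub>R c"
    using reduce[OF \<phi>] by blast
  obtain \<psi>0 c0 where \<psi>0: "\<psi>0 \<in> test_functions (box a b)" "F \<psi>0 = F \<phi>0" "I \<psi>0 = I \<phi>0" "\<And>x. \<psi>0 x = ?w x *\<^sub>R c0"
    using reduce[OF \<phi>0(1)] by blast
  have d: "distribution_on (box a b) F" "distribution_on (box a b) I"
    using F I by (auto simp: locally_constant_distribution_def)
  have eq: "(\<lambda>x. c0 * \<psi> x) = (\<lambda>x. c * \<psi>0 x)" by (simp add: \<psi>(4) \<psi>0(4) mult.commute)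
  have "c0 * u \<psi> = c * u \<psi>0" if "distribution_on (box a b) u" for u
    using distribution_on_mult[OF that \<psi>(1), of c0] distribution_on_mult[OF that \<psi>0(1), of c] by (simp add: eq)
  then have 1: "c0 * F \<phi> = c * F \<phi>0" "c0 * I \<phi> = c * I \<phi>0" using d \<psi>(2,3) \<psi>0(2,3) by metis+
  have "c0 \<noteq> 0"
  proof
    assume "c0 = 0"
    then have "\<psi>0 = (\<lambda>x. 0)" by (simp add: \<psi>0(4) fun_eq_iff)
    then show False using \<psi>0(3) \<phi>0(2) distribution_on_zero[OF d(2)] by simp
  qed
  then have "F \<phi> = c / c0 * F \<phi>0" "c / c0 = I \<phi> / I \<phi>0" using 1 \<phi>0(2) by (auto simp: field_simps)
  then show ?thesis by simp
qed

text \<open>Induction on the set \<open>S\<close> of components that may be nonzero, general in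
  \<open>G\<close> because each step passes to a corrected field. The minus sign in the conclusion
  is that of the distributional derivative.\<close>

lemma primitive_exists_coordinates:
  fixes G :: "'n \<Rightarrow> ('n, 'k::{real_normed_field,euclidean_space}) functional"
  assumes "\<And>k. distribution_on (box a b) (G k)"
    and "\<And>j k \<phi>. \<phi> \<in> test_functions (box a b) \<Longrightarrow> G k (partial_deriv j \<phi>) = G j (partial_deriv k \<phi>)"
    and "\<And>k \<phi>. k \<notin> S \<Longrightarrow> \<phi> \<in> test_functions (box a b) \<Longrightarrow> G k \<phi> = 0"
  shows "\<exists>F. distribution_on (box a b) F \<and> (\<forall>k. \<forall>\<phi>\<in>test_functions (box a b). F (partial_deriv k \<phi>) = - G k \<phi>)"
  using assms
proof (induction S arbitrary: G rule: finite_induct[OF finite])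
  case 1
  show ?case by (rule exI[of _ "\<lambda>\<phi>. 0"]) (use 1(3) in \<open>simp add: distribution_on_zero_functional\<close>)
next
  case (2 j S)
  note G = 2(4) and comm = 2(5) and vanish = 2(6)
  define F1 where "F1 \<phi> = - G j (antideriv j \<phi>)" for \<phi>
  \<comment> \<open>This is \<open>G - grad F1\<close>; the plus sign absorbs the minus of the
    distributional derivative.\<close>
  define G' where "G' k \<phi> = G k \<phi> + F1 (partial_deriv k \<phi>)" for k \<phi>
  have F1: "distribution_on (box a b) F1"
    unfolding F1_def by (intro distribution_on_uminus_functional distribution_on_antideriv G)
  have "\<exists>F. distribution_on (box a b) F \<and> (\<forall>k. \<forall>\<phi>\<in>test_functions (box a b). F (partial_deriv k \<phi>) = - G' k \<phi>)"
  proof (rule 2(3))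
    show "distribution_on (box a b) (G' k)" for k
      unfolding G'_def by (intro distribution_on_add_functional distribution_on_partial_deriv G F1)
    show "G' k (partial_deriv i \<phi>) = G' i (partial_deriv k \<phi>)" if "\<phi> \<in> test_functions (box a b)" for i k \<phi>
      using comm[OF that] partial_deriv_commute[OF test_functionsD(1)[OF that]] by (simp add: G'_def)
    fix k and \<phi> :: "real^'n \<Rightarrow> 'k"
    assume k: "k \<notin> S" and \<phi>: "\<phi> \<in> test_functions (box a b)"
    note s = test_functionsD(1)[OF \<phi>]
    show "G' k \<phi> = 0"
    proof (cases "k = j")
      case True
      then show ?thesis by (simp add: G'_def F1_def antideriv_partial_deriv[OF \<phi>])
    next
      case False
      \<comment> \<open>The symmetry hypothesis turns \<open>G j\<close> into \<open>G k\<close>,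
        which vanishes since \<open>k\<close> lies outside \<open>insert j S\<close>. So a component
        that is already zero stays zero.\<close>
      have "partial_deriv k (antideriv j \<phi>) = antideriv j (partial_deriv k \<phi>)"
        using False by (simp add: partial_deriv_antideriv[OF s])
      then have "F1 (partial_deriv k \<phi>) = - G j (partial_deriv k (antideriv j \<phi>))" by (simp add: F1_def)
      also have "\<dots> = - G k (partial_deriv j (antideriv j \<phi>))"
        using comm[OF test_functions_antideriv[OF \<phi>]] by simp
      also have "\<dots> = 0"
        using vanish[of k "partial_deriv j (antideriv j \<phi>)"] k False \<phi>
        by (auto intro: test_functions_partial_deriv test_functions_antideriv)
      finally show ?thesis using vanish[of k \<phi>] k False \<phi> by (simp add: G'_def)
    qed
  qed
  then obtain F2 where F2: "distribution_on (box a b) F2"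
    "\<And>k \<phi>. \<phi> \<in> test_functions (box a b) \<Longrightarrow> F2 (partial_deriv k \<phi>) = - G' k \<phi>" by blast
  show ?case
    by (rule exI[of _ "\<lambda>\<phi>. F2 \<phi> + F1 \<phi>"])
       (simp add: distribution_on_add_functional F1 F2 G'_def)
qed

end

section \<open>Primitives and locally constant distributions on nonempty open boxes\<close>

lemma box_step_exists:
  fixes a b :: "real^'n"
  assumes ab: "\<And>i. a $ i < b $ i"
  shows "\<exists>p q H h. box_step a b p q H h"
proof -
  define p q :: "real^'n" where "p = (\<chi> i. (2 * a $ i + b $ i) / 3)" and "q = (\<chi> i. (a $ i + 2 * b $ i) / 3)"
  have pq: "a $ i < p $ i" "p $ i < q $ i" "q $ i < b $ i" for i
    using ab[of i] by (simp_all add: p_def q_def)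
  have "\<forall>i. \<exists>Hh :: (real \<Rightarrow> real) \<times> (real \<Rightarrow> real). (\<forall>t. (fst Hh has_real_derivative snd Hh t) (at t)) \<and>
     (\<forall>t. t \<le> p $ i \<longrightarrow> fst Hh t = 0) \<and> (\<forall>t. q $ i \<le> t \<longrightarrow> fst Hh t = 1) \<and>
     (\<forall>t. t \<notin> {p $ i..q $ i} \<longrightarrow> snd Hh t = 0) \<and> smooth (\<lambda>x::real^'n. fst Hh (x $ i))"
  proof
    fix i
    obtain H h where *: "\<And>t. (H has_real_derivative h t) (at t)" "\<And>t. t \<le> p $ i \<Longrightarrow> H t = 0" "\<And>t. q $ i \<le> t \<Longrightarrow> H t = 1"
      "\<And>t. 0 \<le> H t" "\<And>t. H t \<le> 1" "\<And>t. t \<notin> {p $ i..q $ i} \<Longrightarrow> h t = 0"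
      "\<And>j::'n. smooth (\<lambda>x::real^'n. H (x $ j))"
      by (rule smooth_step_exists[OF pq(2)[of i], where 'n = 'n]) blast
    show "\<exists>Hh :: (real \<Rightarrow> real) \<times> (real \<Rightarrow> real). (\<forall>t. (fst Hh has_real_derivative snd Hh t) (at t)) \<and>
     (\<forall>t. t \<le> p $ i \<longrightarrow> fst Hh t = 0) \<and> (\<forall>t. q $ i \<le> t \<longrightarrow> fst Hh t = 1) \<and>
     (\<forall>t. t \<notin> {p $ i..q $ i} \<longrightarrow> snd Hh t = 0) \<and> smooth (\<lambda>x::real^'n. fst Hh (x $ i))"
      by (rule exI[of _ "(H, h)"], unfold fst_conv snd_conv, intro conjI allI impI) (rule *; assumption)+
  qed
  from choice[OF this] obtain Hh :: "'n \<Rightarrow> (real \<Rightarrow> real) \<times> (real \<Rightarrow> real)"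
    where Hh: "\<And>i. (\<forall>t. (fst (Hh i) has_real_derivative snd (Hh i) t) (at t)) \<and>
     (\<forall>t. t \<le> p $ i \<longrightarrow> fst (Hh i) t = 0) \<and> (\<forall>t. q $ i \<le> t \<longrightarrow> fst (Hh i) t = 1) \<and>
     (\<forall>t. t \<notin> {p $ i..q $ i} \<longrightarrow> snd (Hh i) t = 0) \<and> smooth (\<lambda>x::real^'n. fst (Hh i) (x $ i))" by blast
  have "box_step a b p q (\<lambda>i. fst (Hh i)) (\<lambda>i. snd (Hh i))"
    by unfold_locales (use pq Hh in blast)+
  then show ?thesis by blast
qed

proposition box_distribution_primitive:
  fixes G :: "'n \<Rightarrow> ('n::finite, 'k::{real_normed_field,euclidean_space}) functional"
  assumes "\<And>i. a $ i < b $ i" "\<And>k. distribution_on (box a b) (G k)"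
    and "\<And>j k \<phi>. \<phi> \<in> test_functions (box a b) \<Longrightarrow> G k (partial_deriv j \<phi>) = G j (partial_deriv k \<phi>)"
  obtains F where "distribution_on (box a b) F"
    "\<And>k \<phi>. \<phi> \<in> test_functions (box a b) \<Longrightarrow> F (partial_deriv k \<phi>) = - G k \<phi>"
proof -
  obtain p q H h where "box_step a b p q H h" using box_step_exists[OF assms(1)] by blast
  then interpret box_step a b p q H h .
  show ?thesis using primitive_exists_coordinates[OF assms(2,3), of UNIV] that by blast
qed

proposition box_locally_constant_distribution:
  fixes F :: "('n::finite, 'k::{real_normed_field,euclidean_space}) functional"
  assumes ab: "\<And>i. a $ i < b $ i" and F: "locally_constant_distribution (box a b) F"
  obtains c where "\<And>\<phi>. \<phi> \<in> test_functions (box a b) \<Longrightarrow> F \<phi> = c * integral UNIV \<phi>"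
proof -
  obtain p q H h where "box_step a b p q H h" using box_step_exists[OF ab] by blast
  then interpret box_step a b p q H h .
  obtain \<phi>0 :: "real^'n \<Rightarrow> 'k" where \<phi>0: "\<phi>0 \<in> test_functions (box a b)" "integral UNIV \<phi>0 \<noteq> 0"
    using test_function_nonzero_integral[OF ab] by metis
  show ?thesis
    by (rule that) (rule locally_constant_proportional[OF F locally_constant_distribution_integral _ \<phi>0])
qed

section \<open>Gluing\<close>

lemma partial_deriv_sum:
  "(\<And>i. i \<in> I \<Longrightarrow> smooth (f i)) \<Longrightarrow> partial_deriv k (\<lambda>x. \<Sum>i\<in>I. f i x) = (\<lambda>x. \<Sum>i\<in>I. partial_deriv k (f i) x)"
  by (induction I rule: infinite_finite_induct) (simp_all add: partial_deriv_add smooth_sum)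

text \<open>The sum is 1 on \<open>K\<close> only, which suffices to decompose functions supported
  in \<open>K\<close>. For nonempty \<open>K\<close> this forces \<open>I\<close> to be finite, as
  sums over infinite sets are 0 by convention.\<close>

definition partition_on_compact ::
    "(real^'n \<Rightarrow> (real^'n) set) \<Rightarrow> (real^'n) set \<Rightarrow> (real^'n) set \<Rightarrow> (real^'n \<Rightarrow> real^'n \<Rightarrow> real) \<Rightarrow> bool"
  where "partition_on_compact W K I \<theta> \<longleftrightarrow> (\<forall>i\<in>I. \<theta> i \<in> test_functions (W i)) \<and> (\<forall>x\<in>K. (\<Sum>i\<in>I. \<theta> i x) = 1)"

text \<open>The functions \<open>\<theta>\<^sub>k = \<beta>\<^sub>k (1 - \<beta>\<^sub>1) \<dots> (1 - \<beta>\<^sub>k\<^sub>-\<^sub>1)\<close> give a partition of unity without a division.\<close>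

lemma sum_bumps_eq:
  fixes \<beta> :: "'i \<Rightarrow> real^'n \<Rightarrow> real"
  assumes "finite I" "\<And>i. i \<in> I \<Longrightarrow> \<beta> i \<in> test_functions (W i)"
  shows "\<exists>\<theta>. (\<forall>i\<in>I. \<theta> i \<in> test_functions (W i)) \<and> (\<forall>x. (\<Sum>i\<in>I. \<theta> i x) = 1 - (\<Prod>i\<in>I. 1 - \<beta> i x))"
  using assms
proof (induction I rule: finite_induct)
  case (insert j I)
  then obtain \<theta> where \<theta>: "\<And>i. i \<in> I \<Longrightarrow> \<theta> i \<in> test_functions (W i)" "\<And>x. (\<Sum>i\<in>I. \<theta> i x) = 1 - (\<Prod>i\<in>I. 1 - \<beta> i x)"
    by auto
  define \<theta>' where "\<theta>' = \<theta>(j := \<lambda>x. (\<Prod>i\<in>I. 1 - \<beta> i x) *\<^sub>R \<beta> j x)"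
  have "\<theta>' i \<in> test_functions (W i)" if "i \<in> insert j I" for i
  proof (cases "i = j")
    case True
    have "smooth (\<lambda>x. \<Prod>i\<in>I. 1 - \<beta> i x)"
      using insert.prems by (intro smooth_prod smooth_diff smooth_const test_functionsD(1)[of _ "W _"]) auto
    from test_functions_scaleR[OF this, of "\<beta> j" "W j"] insert.prems[of j]
    show ?thesis by (simp add: \<theta>'_def True)
  qed (use that \<theta>(1) in \<open>auto simp: \<theta>'_def\<close>)
  moreover have "(\<Sum>i\<in>insert j I. \<theta>' i x) = 1 - (\<Prod>i\<in>insert j I. 1 - \<beta> i x)" for x
  proof -
    have "(\<Sum>i\<in>I. \<theta>' i x) = (\<Sum>i\<in>I. \<theta> i x)"
      using insert.hyps by (intro sum.cong) (auto simp: \<theta>'_def)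
    then show ?thesis using insert.hyps by (simp add: \<theta>(2)) (simp add: \<theta>'_def algebra_simps)
  qed
  ultimately show ?case by blast
qed simp

text \<open>Each box is shrunk halfway towards its point \<open>x\<close>, and its bump is 1 on the
  shrunken box. Finitely many shrunken boxes cover \<open>K\<close>, so at each point of
  \<open>K\<close> some factor in the product of \<open>sum_bumps_eq\<close> is 0.\<close>

lemma partition_on_compact_exists:
  fixes l u :: "real^'n \<Rightarrow> real^'n"
  assumes "compact K" and W: "\<And>x. x \<in> K \<Longrightarrow> x \<in> box (l x) (u x)"
  obtains I \<theta> where "I \<subseteq> K" "partition_on_compact (\<lambda>x. box (l x) (u x)) K I \<theta>"
proof -
  define a b where "a x = (1 / 2) *\<^sub>R (l x + x)" and "b x = (1 / 2) *\<^sub>R (x + u x)" for x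
  have ab: "l x $ i < a x $ i" "a x $ i < x $ i" "x $ i < b x $ i" "b x $ i < u x $ i" if "x \<in> K" for x i
    using W[OF that] by (auto simp: a_def b_def mem_box_cart dest!: spec[of _ i])
  have "\<exists>\<beta> :: real^'n \<Rightarrow> real. \<beta> \<in> test_functions (box (l x) (u x)) \<and> (\<forall>y\<in>cbox (a x) (b x). \<beta> y = 1)" if "x \<in> K" for x
    by (rule smooth_bump_exists[OF ab(1)[OF that] ab(4)[OF that]]) blast
  then have "\<forall>x. \<exists>\<beta> :: real^'n \<Rightarrow> real. x \<in> K \<longrightarrow> \<beta> \<in> test_functions (box (l x) (u x)) \<and> (\<forall>y\<in>cbox (a x) (b x). \<beta> y = 1)"
    by blast
  from choice[OF this] obtain \<beta> :: "real^'n \<Rightarrow> real^'n \<Rightarrow> real"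
    where \<beta>: "\<And>x. x \<in> K \<Longrightarrow> \<beta> x \<in> test_functions (box (l x) (u x))" "\<And>x y. x \<in> K \<Longrightarrow> y \<in> cbox (a x) (b x) \<Longrightarrow> \<beta> x y = 1"
    by blast
  have "K \<subseteq> (\<Union>x\<in>K. box (a x) (b x))" using ab(2,3) by (auto simp: mem_box_cart)
  then obtain I where I: "I \<subseteq> K" "finite I" "K \<subseteq> (\<Union>x\<in>I. box (a x) (b x))"
    using compactE_image[OF assms(1), of K "\<lambda>x. box (a x) (b x)"] by auto
  obtain \<theta> where \<theta>: "\<And>i. i \<in> I \<Longrightarrow> \<theta> i \<in> test_functions (box (l i) (u i))"
    "\<And>x. (\<Sum>i\<in>I. \<theta> i x) = 1 - (\<Prod>i\<in>I. 1 - \<beta> i x)"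
    using sum_bumps_eq[OF I(2), of \<beta> "\<lambda>x. box (l x) (u x)"] \<beta>(1) I(1) by blast
  have "(\<Sum>i\<in>I. \<theta> i x) = 1" if x: "x \<in> K" for x
  proof -
    obtain i where i: "i \<in> I" "x \<in> box (a i) (b i)" using I(3) x by blast
    then have "1 - \<beta> i x = 0" using \<beta>(2)[of i x] I(1) box_subset_cbox by auto
    then have "(\<Prod>i\<in>I. 1 - \<beta> i x) = 0" using i(1) I(2) by (intro prod_zero) auto
    then show ?thesis by (simp add: \<theta>(2))
  qed
  then have "partition_on_compact (\<lambda>x. box (l x) (u x)) K I \<theta>"
    using \<theta>(1) by (simp add: partition_on_compact_def)
  then show ?thesis using that I(1) by blast
qed

lemma partition_decompose:
  assumes "partition_on_compact W K I \<theta>" "supp \<phi> \<subseteq> K"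
  shows "(\<lambda>x. \<Sum>i\<in>I. \<theta> i x *\<^sub>R \<phi> x) = \<phi>"
proof
  fix x
  show "(\<Sum>i\<in>I. \<theta> i x *\<^sub>R \<phi> x) = \<phi> x"
  proof (cases "x \<in> K")
    case True
    then have "(\<Sum>i\<in>I. \<theta> i x) = 1" using assms(1) by (simp add: partition_on_compact_def)
    then show ?thesis by (simp flip: scaleR_sum_left)
  next
    case False
    then have "\<phi> x = 0" using assms(2) eq_0_if_notin_supp by blast
    then show ?thesis by simp
  qed
qed

text \<open>\<open>F \<phi>\<close> is the sum of the \<open>H i\<close> applied to the pieces of
  \<phi> under a partition of unity on its support. This partition changes with \<phi>, so linearity
  and continuity become visible only once the value is known not to depend on it.\<close>

proposition glue_distributions:
  fixes l u :: "real^'n \<Rightarrow> real^'n" and H :: "real^'n \<Rightarrow> ('n::finite, 'k::{real_normed_field,euclidean_space}) functional"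
  defines "W \<equiv> \<lambda>x. box (l x) (u x)"
  assumes W: "\<And>x. x \<in> \<Omega> \<Longrightarrow> x \<in> W x" "\<And>x. x \<in> \<Omega> \<Longrightarrow> W x \<subseteq> \<Omega>"
    and H: "\<And>x. x \<in> \<Omega> \<Longrightarrow> distribution_on (W x) (H x)"
    and agree: "\<And>x y \<phi>. \<lbrakk>x \<in> \<Omega>; y \<in> \<Omega>; \<phi> \<in> test_functions (W x \<inter> W y)\<rbrakk> \<Longrightarrow> H x \<phi> = H y \<phi>"
  obtains F where "distribution_on \<Omega> F" "\<And>x \<phi>. x \<in> \<Omega> \<Longrightarrow> \<phi> \<in> test_functions (W x) \<Longrightarrow> F \<phi> = H x \<phi>"
proof -
  define glue where "glue I \<theta> \<phi> = (\<Sum>i\<in>I. H i (\<lambda>x. \<theta> i x *\<^sub>R \<phi> x))"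
    for I and \<theta> :: "real^'n \<Rightarrow> real^'n \<Rightarrow> real" and \<phi> :: "real^'n \<Rightarrow> 'k"
  \<comment> \<open>Both partitions are refined to the products of their members, which are
    supported in \<open>W i \<inter> W j\<close>, where \<open>H i\<close> and \<open>H j\<close>
    agree; then the two sums are exchanged.\<close>
  have indep: "glue I \<theta> \<phi> = glue J \<eta> \<phi>"
    if I: "I \<subseteq> \<Omega>" "partition_on_compact W K I \<theta>" and J: "J \<subseteq> \<Omega>" "partition_on_compact W K' J \<eta>"
      and \<phi>: "smooth \<phi>" "supp \<phi> \<subseteq> K" "supp \<phi> \<subseteq> K'" for I J K K' \<theta> \<eta> \<phi>
  proof -
    have \<theta>: "\<theta> i \<in> test_functions (W i)" if "i \<in> I" for i using I(2) that by (simp add: partition_on_compact_def)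
    have \<eta>: "\<eta> j \<in> test_functions (W j)" if "j \<in> J" for j using J(2) that by (simp add: partition_on_compact_def)
    have both: "(\<lambda>x. \<eta> j x *\<^sub>R \<theta> i x *\<^sub>R \<phi> x) \<in> test_functions (W i \<inter> W j)" if "i \<in> I" "j \<in> J" for i j
    proof (rule test_functions_Int)
      show "(\<lambda>x. \<eta> j x *\<^sub>R \<theta> i x *\<^sub>R \<phi> x) \<in> test_functions (W i)"
        using \<theta> \<eta> that \<phi>(1) by (intro test_functions_scaleR test_functions_scaleR') (auto dest: test_functionsD(1))
      show "(\<lambda>x. \<eta> j x *\<^sub>R \<theta> i x *\<^sub>R \<phi> x) \<in> test_functions (W j)"
        using \<theta> \<eta> that \<phi>(1) by (intro test_functions_scaleR' smooth_scaleR) (auto dest: test_functionsD(1))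
    qed
    have "glue I \<theta> \<phi> = (\<Sum>i\<in>I. \<Sum>j\<in>J. H i (\<lambda>x. \<eta> j x *\<^sub>R \<theta> i x *\<^sub>R \<phi> x))"
      unfolding glue_def
    proof (rule sum.cong[OF refl])
      fix i assume i: "i \<in> I"
      have "supp (\<lambda>x. \<theta> i x *\<^sub>R \<phi> x) \<subseteq> K'" using supp_scaleR(1)[of "\<theta> i" \<phi>] \<phi>(3) by blast
      then have "H i (\<lambda>x. \<theta> i x *\<^sub>R \<phi> x) = H i (\<lambda>x. \<Sum>j\<in>J. \<eta> j x *\<^sub>R \<theta> i x *\<^sub>R \<phi> x)"
        by (simp only: partition_decompose[OF J(2)])
      also have "\<dots> = (\<Sum>j\<in>J. H i (\<lambda>x. \<eta> j x *\<^sub>R \<theta> i x *\<^sub>R \<phi> x))"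
        using i I(1) both[OF i] by (intro distribution_on_sum[OF H] test_functions_mono[of "W i \<inter> W _" "W i"]) auto
      finally show "H i (\<lambda>x. \<theta> i x *\<^sub>R \<phi> x) = (\<Sum>j\<in>J. H i (\<lambda>x. \<eta> j x *\<^sub>R \<theta> i x *\<^sub>R \<phi> x))" .
    qed
    also have "\<dots> = (\<Sum>i\<in>I. \<Sum>j\<in>J. H j (\<lambda>x. \<eta> j x *\<^sub>R \<theta> i x *\<^sub>R \<phi> x))"
    proof (intro sum.cong refl)
      fix i j assume "i \<in> I" "j \<in> J"
      then show "H i (\<lambda>x. \<eta> j x *\<^sub>R \<theta> i x *\<^sub>R \<phi> x) = H j (\<lambda>x. \<eta> j x *\<^sub>R \<theta> i x *\<^sub>R \<phi> x)"
        using I(1) J(1) by (intro agree both) auto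
    qed
    also have "\<dots> = (\<Sum>j\<in>J. \<Sum>i\<in>I. H j (\<lambda>x. \<eta> j x *\<^sub>R \<theta> i x *\<^sub>R \<phi> x))"
      by (rule sum.swap)
    also have "\<dots> = glue J \<eta> \<phi>"
      unfolding glue_def
    proof (rule sum.cong[OF refl])
      fix j assume j: "j \<in> J"
      have "(\<Sum>i\<in>I. H j (\<lambda>x. \<eta> j x *\<^sub>R \<theta> i x *\<^sub>R \<phi> x)) = H j (\<lambda>x. \<Sum>i\<in>I. \<eta> j x *\<^sub>R \<theta> i x *\<^sub>R \<phi> x)"
        using j J(1) both[OF _ j]
        by (intro distribution_on_sum[OF H, symmetric] test_functions_mono[of "W _ \<inter> W j" "W j"]) auto
      also have "(\<lambda>x. \<Sum>i\<in>I. \<eta> j x *\<^sub>R \<theta> i x *\<^sub>R \<phi> x) = (\<lambda>x. \<eta> j x *\<^sub>R \<phi> x)"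
        by (simp only: fun_cong[OF partition_decompose[OF I(2) \<phi>(2)]] flip: scaleR_sum_right)
      finally show "(\<Sum>i\<in>I. H j (\<lambda>x. \<eta> j x *\<^sub>R \<theta> i x *\<^sub>R \<phi> x)) = H j (\<lambda>x. \<eta> j x *\<^sub>R \<phi> x)" .
    qed
    finally show ?thesis .
  qed
  have "\<exists>I\<theta>. fst I\<theta> \<subseteq> \<Omega> \<and> partition_on_compact W K (fst I\<theta>) (snd I\<theta>)"
    if K: "compact K" "K \<subseteq> \<Omega>" for K
  proof -
    obtain I \<theta> where "I \<subseteq> K" "partition_on_compact W K I \<theta>"
      unfolding W_def by (rule partition_on_compact_exists[OF K(1)]) (use W(1) K(2) in \<open>auto simp: W_def\<close>)
    then show ?thesis using K(2) by (intro exI[of _ "(I, \<theta>)"]) auto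
  qed
  then have "\<forall>K. \<exists>I\<theta>. compact K \<and> K \<subseteq> \<Omega> \<longrightarrow> fst I\<theta> \<subseteq> \<Omega> \<and> partition_on_compact W K (fst I\<theta>) (snd I\<theta>)" by blast
  from choice[OF this] obtain P where P: "\<And>K. compact K \<Longrightarrow> K \<subseteq> \<Omega> \<Longrightarrow> fst (P K) \<subseteq> \<Omega>"
    "\<And>K. compact K \<Longrightarrow> K \<subseteq> \<Omega> \<Longrightarrow> partition_on_compact W K (fst (P K)) (snd (P K))" by blast
  define F where "F \<phi> = glue (fst (P (supp \<phi>))) (snd (P (supp \<phi>))) \<phi>" for \<phi>
  \<comment> \<open>For all \<phi> supported in a fixed compact \<open>K\<close> the partition
    chosen for \<open>K\<close> may be used, so on these functions \<open>F\<close> coincides with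
    one fixed sum of distributions.\<close>
  have F_eq: "F \<phi> = glue (fst (P K)) (snd (P K)) \<phi>"
    if "compact K" "K \<subseteq> \<Omega>" "\<phi> \<in> test_functions \<Omega>" "supp \<phi> \<subseteq> K" for K \<phi>
    unfolding F_def using test_functionsD[OF that(3)] that
    by (intro indep[of _ "supp \<phi>" _ _ K] P) auto
  have glue_distr: "distribution_on \<Omega> (glue (fst (P K)) (snd (P K)))" if "compact K" "K \<subseteq> \<Omega>" for K
    unfolding glue_def[abs_def]
  proof (rule distribution_on_sum_functional)
    fix i assume "i \<in> fst (P K)"
    then have "i \<in> \<Omega>" "snd (P K) i \<in> test_functions (W i)"
      using P[OF that] by (auto simp: partition_on_compact_def)
    then show "distribution_on \<Omega> (\<lambda>\<phi>. H i (\<lambda>x. snd (P K) i x *\<^sub>R \<phi> x))"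
      by (intro distribution_on_scaleR[OF H])
  qed
  have "distribution_on \<Omega> F"
  proof (rule distribution_onI)
    fix \<phi> \<psi> :: "real^'n \<Rightarrow> 'k" assume \<phi>: "\<phi> \<in> test_functions \<Omega>" and \<psi>: "\<psi> \<in> test_functions \<Omega>"
    have K: "compact (supp \<phi> \<union> supp \<psi>)" "supp \<phi> \<union> supp \<psi> \<subseteq> \<Omega>"
      using test_functionsD[OF \<phi>] test_functionsD[OF \<psi>] by auto
    have "supp (\<lambda>x. \<phi> x + \<psi> x) \<subseteq> supp \<phi> \<union> supp \<psi>"
      by (rule supp_subsetI) (auto simp: eq_0_if_notin_supp[of _ \<phi>] eq_0_if_notin_supp[of _ \<psi>])
    then show "F (\<lambda>x. \<phi> x + \<psi> x) = F \<phi> + F \<psi>"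
      using F_eq[OF K] distribution_on_add[OF glue_distr[OF K] \<phi> \<psi>] \<phi> \<psi> test_functions_add[OF \<phi> \<psi>] by simp
  next
    fix c and \<phi> :: "real^'n \<Rightarrow> 'k" assume \<phi>: "\<phi> \<in> test_functions \<Omega>"
    have K: "compact (supp \<phi>)" "supp \<phi> \<subseteq> \<Omega>" using test_functionsD[OF \<phi>] by auto
    have "supp (\<lambda>x. c * \<phi> x) \<subseteq> supp \<phi>"
      by (rule supp_subsetI) (auto simp: eq_0_if_notin_supp[of _ \<phi>])
    then show "F (\<lambda>x. c * \<phi> x) = c * F \<phi>"
      using F_eq[OF K] distribution_on_mult[OF glue_distr[OF K] \<phi>] \<phi> test_functions_mult_left[OF \<phi>] by simp
  next
    fix K assume K: "compact K" "K \<subseteq> \<Omega>"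
    obtain C N where "\<And>\<phi>. \<phi> \<in> test_functions \<Omega> \<Longrightarrow> supp \<phi> \<subseteq> K \<Longrightarrow>
        norm (glue (fst (P K)) (snd (P K)) \<phi>) \<le> C * seminorm N \<phi>"
      by (rule distribution_on_bound[OF glue_distr[OF K] K]) blast
    then show "\<exists>C N. \<forall>\<phi>\<in>test_functions \<Omega>. supp \<phi> \<subseteq> K \<longrightarrow> norm (F \<phi>) \<le> C * seminorm N \<phi>"
      using F_eq[OF K] by (intro exI[of _ C] exI[of _ N]) simp
  qed
  moreover have "F \<phi> = H x \<phi>" if x: "x \<in> \<Omega>" and \<phi>: "\<phi> \<in> test_functions (W x)" for x \<phi>
  proof -
    note s = test_functionsD[OF \<phi>]
    let ?I = "fst (P (supp \<phi>))" and ?\<theta> = "snd (P (supp \<phi>))"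
    have K: "supp \<phi> \<subseteq> \<Omega>" using s W(2)[OF x] by blast
    have \<theta>: "?\<theta> i \<in> test_functions (W i)" if "i \<in> ?I" for i
      using P(2)[OF s(2) K] that by (simp add: partition_on_compact_def)
    have T: "(\<lambda>y. ?\<theta> i y *\<^sub>R \<phi> y) \<in> test_functions (W i \<inter> W x)" if "i \<in> ?I" for i
      using \<theta>[OF that] \<phi> by (intro test_functions_Int test_functions_scaleR' test_functions_scaleR) (auto dest: test_functionsD(1))
    have "F \<phi> = (\<Sum>i\<in>?I. H x (\<lambda>y. ?\<theta> i y *\<^sub>R \<phi> y))"
      unfolding F_def glue_def
      using P(1)[OF s(2) K] x T by (intro sum.cong refl agree) auto
    also have "\<dots> = H x (\<lambda>y. \<Sum>i\<in>?I. ?\<theta> i y *\<^sub>R \<phi> y)"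
      by (intro distribution_on_sum[OF H[OF x], symmetric] test_functions_mono[OF _ T]) auto
    also have "\<dots> = H x \<phi>"
      by (simp only: partition_decompose[OF P(2)[OF s(2) K] order_refl])
    finally show ?thesis .
  qed
  ultimately show ?thesis by (rule that)
qed

text \<open>The glued \<open>F\<close> is known to equal \<open>H x\<close> only on functions
  supported in one box. Hence \<phi> is cut into such pieces before differentiating, and derivatives
  keep the pieces inside their boxes.\<close>

lemma primitive_from_local_primitives:
  fixes l u :: "real^'n \<Rightarrow> real^'n" and H :: "real^'n \<Rightarrow> ('n::finite, 'k::{real_normed_field,euclidean_space}) functional"
    and G :: "'n \<Rightarrow> ('n, 'k) functional"
  defines "W \<equiv> \<lambda>x. box (l x) (u x)"
  assumes W: "\<And>x. x \<in> \<Omega> \<Longrightarrow> x \<in> W x" "\<And>x. x \<in> \<Omega> \<Longrightarrow> W x \<subseteq> \<Omega>"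
    and H: "\<And>x. x \<in> \<Omega> \<Longrightarrow> distribution_on (W x) (H x)"
    and agree: "\<And>x y \<phi>. \<lbrakk>x \<in> \<Omega>; y \<in> \<Omega>; \<phi> \<in> test_functions (W x \<inter> W y)\<rbrakk> \<Longrightarrow> H x \<phi> = H y \<phi>"
    and G: "\<And>k. distribution_on \<Omega> (G k)"
    and HG: "\<And>x k \<phi>. \<lbrakk>x \<in> \<Omega>; \<phi> \<in> test_functions (W x)\<rbrakk> \<Longrightarrow> H x (partial_deriv k \<phi>) = - G k \<phi>"
  obtains F where "distribution_on \<Omega> F" "\<And>k \<phi>. \<phi> \<in> test_functions \<Omega> \<Longrightarrow> F (partial_deriv k \<phi>) = - G k \<phi>"
proof -
  obtain F where F: "distribution_on \<Omega> F" "\<And>x \<phi>. x \<in> \<Omega> \<Longrightarrow> \<phi> \<in> test_functions (W x) \<Longrightarrow> F \<phi> = H x \<phi>"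
    unfolding W_def
    by (rule glue_distributions[of \<Omega> l u H, OF W[unfolded W_def] H[unfolded W_def] agree[unfolded W_def]]) blast+
  have "F (partial_deriv k \<phi>) = - G k \<phi>" if \<phi>: "\<phi> \<in> test_functions \<Omega>" for k \<phi>
  proof -
    note s = test_functionsD[OF \<phi>]
    obtain I \<theta> where I: "I \<subseteq> supp \<phi>" "partition_on_compact W (supp \<phi>) I \<theta>"
      unfolding W_def by (rule partition_on_compact_exists[OF s(2)]) (use W(1) s(3) in \<open>auto simp: W_def\<close>)
    have \<theta>: "\<theta> i \<in> test_functions (W i)" if "i \<in> I" for i
      using I(2) that by (simp add: partition_on_compact_def)
    have I\<Omega>: "i \<in> \<Omega>" if "i \<in> I" for i using that I(1) s(3) by blast
    define \<psi> where "\<psi> i = (\<lambda>x. \<theta> i x *\<^sub>R \<phi> x)" for i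
    have \<psi>: "\<psi> i \<in> test_functions (W i)" if "i \<in> I" for i
      unfolding \<psi>_def by (rule test_functions_scaleR'[OF \<theta>[OF that] s(1)])
    have \<psi>\<Omega>: "\<psi> i \<in> test_functions \<Omega>" if "i \<in> I" for i
      by (rule test_functions_mono[OF W(2)[OF I\<Omega>[OF that]] \<psi>[OF that]])
    have \<phi>_sum: "\<phi> = (\<lambda>x. \<Sum>i\<in>I. \<psi> i x)"
      unfolding \<psi>_def by (rule partition_decompose[OF I(2) order_refl, symmetric])
    have "F (partial_deriv k \<phi>) = F (\<lambda>x. \<Sum>i\<in>I. partial_deriv k (\<psi> i) x)"
      unfolding \<phi>_sum using test_functionsD(1)[OF \<psi>] by (simp add: partial_deriv_sum)
    also have "\<dots> = (\<Sum>i\<in>I. F (partial_deriv k (\<psi> i)))"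
      by (rule distribution_on_sum[OF F(1)]) (rule test_functions_partial_deriv[OF \<psi>\<Omega>])
    also have "\<dots> = (\<Sum>i\<in>I. - G k (\<psi> i))"
    proof (rule sum.cong[OF refl])
      fix i assume i: "i \<in> I"
      show "F (partial_deriv k (\<psi> i)) = - G k (\<psi> i)"
        using F(2)[OF I\<Omega>[OF i] test_functions_partial_deriv[OF \<psi>[OF i]]] HG[OF I\<Omega>[OF i] \<psi>[OF i]] by simp
    qed
    also have "\<dots> = - G k (\<lambda>x. \<Sum>i\<in>I. \<psi> i x)"
      unfolding sum_negf by (subst distribution_on_sum[OF G]) (rule \<psi>\<Omega>, auto)
    also have "\<dots> = - G k \<phi>" unfolding \<phi>_sum[symmetric] ..
    finally show ?thesis .
  qed
  then show ?thesis using F(1) that by blast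
qed

section \<open>Cubes around the points and the correction of the local primitives by
  constants\<close>

lemma box_radius_exists:
  fixes \<Omega> :: "(real^'n) set"
  assumes "open \<Omega>"
  obtains r :: "real^'n \<Rightarrow> real" where "continuous_on \<Omega> r" "\<And>x. x \<in> \<Omega> \<Longrightarrow> 0 < r x"
    "\<And>x y. x \<in> \<Omega> \<Longrightarrow> (\<And>i. \<bar>y $ i - x $ i\<bar> < r x) \<Longrightarrow> y \<in> \<Omega>"
proof (cases "\<Omega> = UNIV")
  \<comment> \<open>\<open>infdist\<close> to the empty set is 0, so the whole space is treated
    apart, with radius 1.\<close>
  case True
  then show ?thesis by (intro that[of "\<lambda>_. 1"]) auto
next
  case False
  \<comment> \<open>Dividing by the dimension turns a bound on each coordinate into a bound on their
    sum, which dominates the Euclidean norm.\<close>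
  define r where "r x = infdist x (- \<Omega>) / CARD('n)" for x
  have ne: "- \<Omega> \<noteq> {}" using False by auto
  show ?thesis
  proof (rule that[of r])
    show "continuous_on \<Omega> r" unfolding r_def by (intro continuous_intros) auto
    fix x assume x: "x \<in> \<Omega>"
    then show "0 < r x"
      unfolding r_def using infdist_pos_not_in_closed[OF _ ne, of x] assms by (auto simp: closed_def)
    fix y assume y: "\<And>i. \<bar>y $ i - x $ i\<bar> < r x"
    show "y \<in> \<Omega>"
    proof (rule ccontr)
      assume "y \<notin> \<Omega>"
      then have "infdist x (- \<Omega>) \<le> dist x y" by (intro infdist_le) auto
      also have "\<dots> \<le> (\<Sum>i\<in>UNIV. \<bar>(y - x) $ i\<bar>)"
        using norm_le_l1_cart[of "y - x"] by (simp only: dist_norm norm_minus_commute)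
      also have "\<dots> < (\<Sum>i\<in>(UNIV :: 'n set). r x)"
        by (rule sum_strict_mono) (use y in auto)
      also have "\<dots> = infdist x (- \<Omega>)" by (simp add: r_def)
      finally show False by simp
    qed
  qed
qed

lemma Int_box_vec:
  "box a b \<inter> box c d = box (\<chi> i. max (a $ i) (c $ i)) (\<chi> i. min (b $ i) (d $ i) :: real^'n)"
  by (auto simp: mem_box_cart)

lemma box_nonempty_vec: "x \<in> box a b \<Longrightarrow> a $ i < (b $ i :: real)" for a b :: "real^'n"
  using less_trans by (auto simp: mem_box_cart)


theorem distribution_primitive_exists:
  fixes G :: "'n \<Rightarrow> ('n::finite, 'k::{real_normed_field,euclidean_space}) functional"
  assumes \<Omega>: "open \<Omega>" "simply_connected \<Omega>"
    and G: "\<And>k. distribution_on \<Omega> (G k)"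
    and comm: "\<And>j k \<phi>. \<phi> \<in> test_functions \<Omega> \<Longrightarrow> G k (partial_deriv j \<phi>) = G j (partial_deriv k \<phi>)"
  obtains F where "distribution_on \<Omega> F" "\<And>k \<phi>. \<phi> \<in> test_functions \<Omega> \<Longrightarrow> F (partial_deriv k \<phi>) = - G k \<phi>"
proof -
  obtain r where r: "continuous_on \<Omega> r" "\<And>x. x \<in> \<Omega> \<Longrightarrow> 0 < r x"
    "\<And>x y. x \<in> \<Omega> \<Longrightarrow> (\<And>i. \<bar>y $ i - x $ i\<bar> < r x) \<Longrightarrow> y \<in> \<Omega>"
    by (rule box_radius_exists[OF \<Omega>(1)]) blast
  define l u where "l x = x - (\<chi> i. r x)" and "u x = x + (\<chi> i. r x)" for x :: "real^'n"
  define W where "W x = box (l x) (u x)" for x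
  have W_iff: "y \<in> W x \<longleftrightarrow> (\<forall>i. \<bar>y $ i - x $ i\<bar> < r x)" for x y
    by (auto simp: W_def l_def u_def mem_box_cart abs_less_iff algebra_simps)
  have W: "x \<in> W x" "W x \<subseteq> \<Omega>" if "x \<in> \<Omega>" for x
    using r(2,3)[OF that] by (auto simp: W_iff)
  define I where "I = (integral UNIV :: ('n, 'k) functional)"
  have Idist: "distribution_on U I" for U unfolding I_def by (rule distribution_on_integral)
  have I0: "I (partial_deriv k \<phi>) = 0" if "\<phi> \<in> test_functions U" for k \<phi> U
    unfolding I_def by (rule integral_partial_deriv[OF that])
  have "\<exists>F. distribution_on (W x) F \<and> (\<forall>k. \<forall>\<phi>\<in>test_functions (W x). F (partial_deriv k \<phi>) = - G k \<phi>)"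
    if x: "x \<in> \<Omega>" for x
  proof -
    have ne: "l x $ i < u x $ i" for i using r(2)[OF x] by (simp add: l_def u_def)
    have Gx: "distribution_on (box (l x) (u x)) (G k)" for k
      using distribution_on_mono[OF G W(2)[OF x]] by (simp add: W_def)
    have cx: "G k (partial_deriv j \<phi>) = G j (partial_deriv k \<phi>)" if "\<phi> \<in> test_functions (box (l x) (u x))" for j k \<phi>
      using comm[OF test_functions_mono[OF W(2)[OF x]]] that by (simp add: W_def)
    obtain F where "distribution_on (box (l x) (u x)) F"
      "\<And>k \<phi>. \<phi> \<in> test_functions (box (l x) (u x)) \<Longrightarrow> F (partial_deriv k \<phi>) = - G k \<phi>"
      using box_distribution_primitive[OF ne Gx cx] by metis
    then show ?thesis unfolding W_def by blast
  qed
  then have "\<forall>x. \<exists>F. x \<in> \<Omega> \<longrightarrow> distribution_on (W x) F \<and>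
      (\<forall>k. \<forall>\<phi>\<in>test_functions (W x). F (partial_deriv k \<phi>) = - G k \<phi>)" by blast
  from choice[OF this] obtain P where P: "\<And>x. x \<in> \<Omega> \<Longrightarrow> distribution_on (W x) (P x)"
    "\<And>x k \<phi>. x \<in> \<Omega> \<Longrightarrow> \<phi> \<in> test_functions (W x) \<Longrightarrow> P x (partial_deriv k \<phi>) = - G k \<phi>" by blast
  have "\<exists>c. \<forall>\<phi>\<in>test_functions (W x \<inter> W y). P x \<phi> - P y \<phi> = c * I \<phi>"
    if xy: "x \<in> \<Omega>" "y \<in> \<Omega>" for x y
  \<comment> \<open>On an empty overlap the only test function is 0, and the value of
    \<open>c\<close> carries no information; this is why the later identities for \<open>c\<close>
    involve a common point.\<close>
  proof (cases "W x \<inter> W y = {}")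
    case True
    have "P x \<phi> - P y \<phi> = 0 * I \<phi>" if "\<phi> \<in> test_functions (W x \<inter> W y)" for \<phi>
    proof -
      have "\<phi> = (\<lambda>x. 0)" using that unfolding True by (rule test_functions_empty)
      then show ?thesis using distribution_on_zero[OF P(1)[OF xy(1)]] distribution_on_zero[OF P(1)[OF xy(2)]] by simp
    qed
    then show ?thesis by blast
  next
    case False
    obtain a b where ab: "W x \<inter> W y = box a b" unfolding W_def Int_box_vec by blast
    have ne: "a $ i < b $ i" for i using False box_nonempty_vec unfolding ab by blast
    have "locally_constant_distribution (box a b) (\<lambda>\<phi>. P x \<phi> - P y \<phi>)"
      unfolding locally_constant_distribution_def ab[symmetric]
    proof (intro conjI allI ballI)
      show "distribution_on (W x \<inter> W y) (\<lambda>\<phi>. P x \<phi> - P y \<phi>)"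
        by (intro distribution_on_diff_functional distribution_on_mono[OF P(1)[OF xy(1)]]
            distribution_on_mono[OF P(1)[OF xy(2)]]) auto
      fix j and \<phi> :: "real^'n \<Rightarrow> 'k" assume "\<phi> \<in> test_functions (W x \<inter> W y)"
      then have "\<phi> \<in> test_functions (W x)" "\<phi> \<in> test_functions (W y)"
        using test_functions_mono[of "W x \<inter> W y"] by (metis Int_lower1 Int_lower2)+
      then show "P x (partial_deriv j \<phi>) - P y (partial_deriv j \<phi>) = 0"
        using P(2)[OF xy(1)] P(2)[OF xy(2)] by simp
    qed
    then obtain c where "\<And>\<phi>. \<phi> \<in> test_functions (box a b) \<Longrightarrow> P x \<phi> - P y \<phi> = c * I \<phi>"
      unfolding I_def by (rule box_locally_constant_distribution[OF ne]) blast
    then show ?thesis unfolding ab by blast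
  qed
  then obtain c where c: "\<And>x y \<phi>. \<lbrakk>x \<in> \<Omega>; y \<in> \<Omega>; \<phi> \<in> test_functions (W x \<inter> W y)\<rbrakk> \<Longrightarrow> P x \<phi> - P y \<phi> = c x y * I \<phi>"
    by metis
  \<comment> \<open>The triple overlap is again a nonempty box; a test function in it with nonzero
    integral allows the multiples of \<open>I\<close> to be compared.\<close>
  have cocycle: "c x z = c x y + c y z"
    if xyz: "x \<in> \<Omega>" "y \<in> \<Omega>" "z \<in> \<Omega>" and w: "w \<in> W x" "w \<in> W y" "w \<in> W z" for w x y z
  proof -
    obtain a b where ab: "W x \<inter> W y \<inter> W z = box a b" unfolding W_def Int_box_vec by blast
    have ne: "a $ i < b $ i" for i using w box_nonempty_vec[of w a b] ab by blast
    obtain \<phi> where \<phi>: "\<phi> \<in> test_functions (box a b)" "I \<phi> \<noteq> 0"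
      unfolding I_def by (rule test_function_nonzero_integral[OF ne]) blast
    have "\<phi> \<in> test_functions (W x \<inter> W z)" "\<phi> \<in> test_functions (W x \<inter> W y)" "\<phi> \<in> test_functions (W y \<inter> W z)"
      by (rule test_functions_mono[OF _ \<phi>(1)[folded ab]]; blast)+
    then have "P x \<phi> - P z \<phi> = c x z * I \<phi>" "P x \<phi> - P y \<phi> = c x y * I \<phi>" "P y \<phi> - P z \<phi> = c y z * I \<phi>"
      using c xyz by blast+
    then have "c x z * I \<phi> = (c x y + c y z) * I \<phi>" by (simp add: distrib_right[symmetric] algebra_simps)
    then show ?thesis using \<phi>(2) by simp
  qed
  \<comment> \<open>By continuity of \<open>r\<close> the inequalities defining
    \<open>x \<in> W y\<close> are open in \<open>y\<close>. All cubes with centre in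
    \<open>U\<close> then contain \<open>x\<close>, the common point for the cocycle
    identity.\<close>
  have nbhd: "\<exists>U. open U \<and> x \<in> U \<and> U \<subseteq> \<Omega> \<and> (\<forall>y\<in>U. x \<in> W y)" if x: "x \<in> \<Omega>" for x
  proof -
    define N where "N i = {y \<in> \<Omega>. \<bar>x $ i - y $ i\<bar> - r y < 0}" for i
    have "open (N i)" for i
    proof -
      have "open ((\<lambda>y. \<bar>x $ i - y $ i\<bar> - r y) -` {..<0} \<inter> \<Omega>)"
        by (intro continuous_on_open_vimage[OF \<Omega>(1), THEN iffD1, rule_format] continuous_intros r)
      moreover have "(\<lambda>y. \<bar>x $ i - y $ i\<bar> - r y) -` {..<0} \<inter> \<Omega> = N i" by (auto simp: N_def)
      ultimately show ?thesis by simp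
    qed
    then have "open (\<Inter>i\<in>UNIV. N i)" by (intro open_INT) auto
    then show ?thesis
      using x r(2)[OF x] by (intro exI[of _ "\<Inter>i\<in>UNIV. N i"]) (auto simp: N_def W_iff)
  qed
  have "local_cocycle \<Omega> c"
    unfolding local_cocycle_def
  proof
    fix x assume "x \<in> \<Omega>"
    then obtain U where "open U" "x \<in> U" "U \<subseteq> \<Omega>" "\<forall>y\<in>U. x \<in> W y" using nbhd by blast
    then show "\<exists>U. open U \<and> x \<in> U \<and> (\<forall>p\<in>U \<inter> \<Omega>. \<forall>q\<in>U \<inter> \<Omega>. \<forall>s\<in>U \<inter> \<Omega>. c p s = c p q + c q s)"
      by (intro exI[of _ U] conjI ballI cocycle[of _ _ _ x]) auto
  qed
  then obtain g where g: "\<And>x. x \<in> \<Omega> \<Longrightarrow> \<exists>U. open U \<and> x \<in> U \<and> U \<subseteq> \<Omega> \<and> (\<forall>y\<in>U. \<forall>z\<in>U. c y z = g z - g y)"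
    by (rule simply_connected_local_cocycle_trivial[OF \<Omega>]) blast
  have c_refl: "c x x = 0" if "x \<in> \<Omega>" for x
    using cocycle[OF that that that W(1)[OF that] W(1)[OF that] W(1)[OF that]] by simp
  \<comment> \<open>The potential \<open>g\<close> controls \<open>c\<close> only between nearby
    points. For fixed \<open>x\<close> the cocycle identity makes \<open>c x w - g w\<close> locally
    constant in \<open>w\<close>, and the cube \<open>W x\<close> is connected.\<close>
  have c_near: "c x w = g w - g x" if x: "x \<in> \<Omega>" and w: "w \<in> W x" for x w
  proof -
    have "(\<lambda>w. c x w - g w) constant_on W x"
    proof (rule locally_constant_imp_constant)
      show "connected (W x)" unfolding W_def by (intro convex_connected convex_box)
      fix v assume v: "v \<in> W x"
      then have v\<Omega>: "v \<in> \<Omega>" using W(2)[OF x] by blast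
      obtain U where U: "open U" "v \<in> U" "U \<subseteq> \<Omega>" "\<And>y. y \<in> U \<Longrightarrow> v \<in> W y" using nbhd[OF v\<Omega>] by blast
      obtain V where V: "open V" "v \<in> V" "\<And>y z. y \<in> V \<Longrightarrow> z \<in> V \<Longrightarrow> c y z = g z - g y" using g[OF v\<Omega>] by blast
      have "c x y - g y = c x v - g v" if "y \<in> U" "y \<in> V" for y
      proof -
        have "c x y = c x v + c v y"
          using that U by (intro cocycle[OF x v\<Omega> _ v W(1)[OF v\<Omega>]]) auto
        then show ?thesis using V(3)[OF V(2) that(2)] by simp
      qed
      moreover have "openin (top_of_set (W x)) (W x \<inter> (U \<inter> V))" using U(1) V(1) by (intro openin_open_Int open_Int)
      ultimately show "\<exists>T. openin (top_of_set (W x)) T \<and> v \<in> T \<and> (\<forall>y\<in>T. c x y - g y = c x v - g v)"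
        using v U(2) V(2) by blast
    qed
    then obtain k where "\<And>w. w \<in> W x \<Longrightarrow> c x w - g w = k" unfolding constant_on_def by blast
    then have "c x w - g w = c x x - g x" using w W(1)[OF x] by metis
    then show ?thesis using c_refl[OF x] by (simp add: algebra_simps)
  qed
  \<comment> \<open>Overlapping cubes need not contain each other's centres, so the identity passes
    through a common point \<open>w\<close>.\<close>
  have c_g: "c x y = g y - g x" if xy: "x \<in> \<Omega>" "y \<in> \<Omega>" and w: "w \<in> W x" "w \<in> W y" for x y w
  proof -
    have w\<Omega>: "w \<in> \<Omega>" using W(2)[OF xy(1)] w(1) by blast
    have "c x y = c x w + c w y" by (rule cocycle[OF xy(1) w\<Omega> xy(2) w(1) W(1)[OF w\<Omega>] w(2)])
    moreover have "c y y = c y w + c w y" by (rule cocycle[OF xy(2) w\<Omega> xy(2) w(2) W(1)[OF w\<Omega>] w(2)])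
    ultimately show ?thesis using c_near[OF xy(1) w(1)] c_near[OF xy(2) w(2)] c_refl[OF xy(2)]
      by (simp add: algebra_simps)
  qed
  \<comment> \<open>On an overlap \<open>P x - P y\<close> is \<open>(g y - g x) * I\<close>, which
    the added terms cancel. As \<open>I\<close> annihilates derivatives, \<open>H x\<close> is still
    a primitive.\<close>
  define H where "H x \<phi> = P x \<phi> + g x * I \<phi>" for x \<phi>
  have H: "distribution_on (W x) (H x)" if "x \<in> \<Omega>" for x
    unfolding H_def by (intro distribution_on_add_functional distribution_on_mult_functional P that Idist)
  have H_agree: "H x \<phi> = H y \<phi>" if xy: "x \<in> \<Omega>" "y \<in> \<Omega>" and \<phi>: "\<phi> \<in> test_functions (W x \<inter> W y)" for x y \<phi>
  proof (cases "W x \<inter> W y = {}")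
    case True
    have "\<phi> = (\<lambda>x. 0)" using \<phi> unfolding True by (rule test_functions_empty)
    then show ?thesis using distribution_on_zero[OF H[OF xy(1)]] distribution_on_zero[OF H[OF xy(2)]] by simp
  next
    case False
    then obtain w where "w \<in> W x" "w \<in> W y" by blast
    then have "P x \<phi> - P y \<phi> = (g y - g x) * I \<phi>" using c[OF xy \<phi>] c_g[OF xy] by simp
    then show ?thesis by (simp add: H_def algebra_simps)
  qed
  have HG: "H x (partial_deriv k \<phi>) = - G k \<phi>" if "x \<in> \<Omega>" "\<phi> \<in> test_functions (W x)" for x k \<phi>
    using P(2)[OF that] I0[OF that(2)] by (simp add: H_def)
  show ?thesis
    by (rule primitive_from_local_primitives[of \<Omega> l u H G, folded W_def, OF W H H_agree G HG]) (auto intro: that)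
qed

text \<open>The sort of \<open>'k\<close> covers \<open>real\<close> and \<open>complex\<close> at
  once; its Euclidean structure makes integrals of \<open>'k\<close>-valued functions
  available.\<close>

lemma distr_grad_surj:
  fixes G :: "('n::finite, 'k::{real_normed_field,euclidean_space}) functional ^ 'n"
  assumes \<Omega>: "open \<Omega>" "simply_connected \<Omega>"
    and G: "\<And>j. G $ j \<in> distributions \<Omega>"
    and comm: "\<And>j k. distr_deriv \<Omega> j (G $ k) = distr_deriv \<Omega> k (G $ j)"
  shows "\<exists>F \<in> distributions \<Omega>. distr_grad \<Omega> F = G"
proof -
  have "(G $ k) (partial_deriv j \<phi>) = (G $ j) (partial_deriv k \<phi>)" if "\<phi> \<in> test_functions \<Omega>" for j k \<phi>
    using fun_cong[OF comm[of j k], of \<phi>] that by (simp add: distr_deriv_def)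
  moreover have "distribution_on \<Omega> (G $ k)" for k using G distributions_iff by blast
  ultimately obtain F where F: "distribution_on \<Omega> F"
    "\<And>k \<phi>. \<phi> \<in> test_functions \<Omega> \<Longrightarrow> F (partial_deriv k \<phi>) = - (G $ k) \<phi>"
    using distribution_primitive_exists[OF \<Omega>, of "\<lambda>k. G $ k"] by metis
  \<comment> \<open>Membership in \<open>distributions\<close> requires the value
    \<open>undefined\<close> off the test functions.\<close>
  define F' where "F' = restrict F (test_functions \<Omega>)"
  have F': "F' \<phi> = F \<phi>" if "\<phi> \<in> test_functions \<Omega>" for \<phi> using that by (simp add: F'_def)
  have "distribution_on \<Omega> F'"
    using F(1) unfolding distribution_on_def
    by (simp add: F' test_functions_add test_functions_mult_left cong: ball_cong)
  then have "F' \<in> distributions \<Omega>" by (simp add: distributions_iff F'_def)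
  moreover have "distr_deriv \<Omega> j F' = G $ j" for j
  proof
    fix \<phi>
    show "distr_deriv \<Omega> j F' \<phi> = (G $ j) \<phi>"
    proof (cases "\<phi> \<in> test_functions \<Omega>")
      case True
      then show ?thesis by (simp add: distr_deriv_def F' test_functions_partial_deriv F(2))
    next
      case False
      then show ?thesis using G[of j] by (simp add: distr_deriv_def distributions_iff extensional_def)
    qed
  qed
  ultimately show ?thesis by (intro bexI[of _ F']) (auto simp: distr_grad_def vec_eq_iff)
qed

theorem theorem0p2:
  fixes \<Omega> :: "(real^'n) set"
  assumes "open \<Omega>" and "simply_connected \<Omega>"
  shows "(\<forall>G :: ('n, real) functional ^ 'n.
            (\<forall>j. G $ j \<in> distributions \<Omega>) \<and>
            (\<forall>j k. distr_deriv \<Omega> j (G $ k) = distr_deriv \<Omega> k (G $ j))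
            \<longrightarrow> (\<exists>F \<in> distributions \<Omega>. distr_grad \<Omega> F = G)) \<and>
         (\<forall>G :: ('n, complex) functional ^ 'n.
            (\<forall>j. G $ j \<in> distributions \<Omega>) \<and>
            (\<forall>j k. distr_deriv \<Omega> j (G $ k) = distr_deriv \<Omega> k (G $ j))
            \<longrightarrow> (\<exists>F \<in> distributions \<Omega>. distr_grad \<Omega> F = G))"
  using distr_grad_surj[OF assms, where 'k = real] distr_grad_surj[OF assms, where 'k = complex] by blast

end
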